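(* Let $t>1$. There exist constants $0<c<C<\infty$, depending only on $t$, such that for all sufficiently large integers $n$, $$\frac{c}{\log\log n}\le \frac13\,\kappa_{n\lfloor(\log\log n)^4\rfloor}(\mathbb{T},t)\le \kappa_n(\overline{\mathbb{D}},t)\le \kappa_n(\mathbb{T},t)\le \frac{C}{\log\log n}.$$
   Context: $\mathbb{T}$ is the unit circle and $\overline{\mathbb{D}}$ the closed unit disc in $\mathbb{C}$. For compact $K\subseteq\mathbb{C}$, $\mathcal{P}_n(K)$ is the set of monic complex polynomials of degree $n$ all of whose zeros lie in $K$. For a polynomial $p$ and $t>0$, $\Lambda_p(t)=\{z\in\mathbb{C}: |p(z)|\le t\}$. $m$ is Lebesgue measure on $\mathbb{C}$, and $\kappa_n(K,t)=\inf\{m(\Lambda_p(t)): p\in\mathcal{P}_n(K)\}$. *)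

theory Defs
  imports "HOL-Analysis.Analysis" "HOL-Computational_Algebra.Polynomial"
begin

definition monic_polys_zeros_in :: "nat \<Rightarrow> complex set \<Rightarrow> complex poly set" where
  "monic_polys_zeros_in n K =
     {p. degree p = n \<and> lead_coeff p = 1 \<and> {z. poly p z = 0} \<subseteq> K}"

definition sublevel_set :: "complex poly \<Rightarrow> real \<Rightarrow> complex set" where
  "sublevel_set p t = {z. norm (poly p z) \<le> t}"

text \<open>
  Areas are extended nonnegative reals, so that the infimum needs no side conditions.
  For \<open>n = 0\<close> and \<open>t \<ge> 1\<close> the sublevel set is the whole plane, of infinite area.
  Sublevel sets are closed, so Lebesgue measure on Borel sets suffices.
\<close>

definition kappa :: "nat \<Rightarrow> complex set \<Rightarrow> real \<Rightarrow> ennreal" where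
  "kappa n K t = (INF p\<in>monic_polys_zeros_in n K. emeasure lborel (sublevel_set p t))"

end

theory Submission
  imports Defs "HOL-Complex_Analysis.Complex_Analysis" "HOL-Real_Asymp.Real_Asymp"
    "HOL-Computational_Algebra.Fundamental_Theorem_Algebra"
begin

text \<open>
  Lower bound: for \<open>p\<close> with all zeros on the circle, \<open>F = 1 - Ln p / ln t\<close> is holomorphic in the
  disc, \<open>F 0 = 1\<close>, and \<open>\<bar>p\<bar> \<le> t\<close> means \<open>Re F \<ge> 0\<close>. Let this set have area \<open>A\<close> and cut a square into
  concentric square annuli of width about \<open>A\<close>; most of them meet the set in a small proportion.
  The sub-mean value property makes \<open>max Re F\<close> grow by a constant factor on each such annulus, so
  \<open>ln \<bar>F\<bar>\<close> reaches a large multiple of \<open>1 / A\<close>. From then on \<open>ln \<bar>F\<bar>\<close> itself doubles on each of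
  them: on the half plane \<open>Re F \<le> 0\<close> it has a bounded conjugate function, so that its oscillation
  along a thin annulus is \<open>O(1 / A)\<close> plus an integral over the thin set, and the latter is controlled
  by the supremum of \<open>ln \<bar>F\<bar>\<close> on the next annulus through a Caccioppoli inequality localised to the
  set. As \<open>ln \<bar>F\<bar> = O(ln n)\<close>, this forces \<open>1 / A = O(ln (ln n))\<close>.

  Discs versus circles: for \<open>q\<close> with reciprocal polynomial \<open>q*\<close>, the polynomial \<open>z ^ N * g + g*\<close> with
  \<open>g = q\<^sup>2\<close> has its zeros on the circle and modulus at least \<open>\<bar>q\<bar>\<^sup>2 * \<bar>\<bar>z\<bar> ^ N - 1\<bar>\<close>.

  Upper bound: apply the same construction to a Taylor polynomial of \<open>exp h\<close>, where \<open>h\<close> is an entire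
  function with \<open>h 0 = 0\<close> whose real part is large off a strip of width \<open>O(1 / ln (ln n))\<close>.
\<close>

subsection \<open>Calculus on rectangles\<close>

text \<open>The sub-mean value property alone multiplies max Re F by a constant on each annulus,
  which would only give 1 / A = O(ln n). The second logarithm comes from the stage in which ln |F|
  itself is multiplied; each of its steps loses O(1 / A), so ln |F| has to be lifted above that size
  beforehand. The width of the annuli is a large multiple of A because the average annulus then
  meets the set in a small multiple of the squared width: at this scale the area cancels the squared
  gradient of a cutoff, so that the energy enters a step without a factor 1 / A. The argument of 1 -
  F is bounded only while F stays in the left half plane; on the set this fails, so the conjugate is
  altered there and the failure of the Cauchy-Riemann equations is paid for by area. The energy
  inequality needs a logarithmic weight, which is why a step is linear in the supremum of ln |F| on
  the next annulus. Squares take the place of discs so that all sweeps run along coordinate lines,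
  where Fubini and the fundamental theorem of calculus suffice.\<close>

lemma integral_rect_x:
  fixes f :: "real \<times> real \<Rightarrow> real"
  assumes "continuous_on (cbox (a, c) (b, d)) f"
  shows "integral (cbox (a, c) (b, d)) f = integral {a..b} (\<lambda>x. integral {c..d} (\<lambda>y. f (x, y)))"
  using integral_prod_continuous[OF assms] by simp

lemma integral_rect_y:
  fixes f :: "real \<times> real \<Rightarrow> real"
  assumes "continuous_on (cbox (a, c) (b, d)) f"
  shows "integral (cbox (a, c) (b, d)) f = integral {c..d} (\<lambda>y. integral {a..b} (\<lambda>x. f (x, y)))"
proof -
  have "integral (cbox a b) (\<lambda>x. integral (cbox c d) (\<lambda>y. f (x, y)))
      = integral (cbox c d) (\<lambda>y. integral (cbox a b) (\<lambda>x. f (x, y)))"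
    by (rule integral_swap_continuous) (use assms in simp)
  then show ?thesis
    using integral_rect_x[OF assms] by simp
qed

lemma mem_rect: "(x, y) \<in> cbox (a, c) (b, d) \<longleftrightarrow> a \<le> x \<and> x \<le> b \<and> c \<le> y \<and> y \<le> (d::real)"
  for x a b :: real
  by (auto simp: cbox_Pair_eq)

lemma rect_mono:
  fixes a b c d a' b' c' d' :: real
  assumes "a' \<le> a" "b \<le> b'" "c' \<le> c" "d \<le> d'"
  shows "cbox (a, c) (b, d) \<subseteq> cbox (a', c') (b', d')"
  using assms by (auto simp: cbox_Pair_eq)

lemma integral_real_derivative:
  assumes "a \<le> b" "\<And>x. x \<in> {a..b} \<Longrightarrow> (F has_real_derivative F' x) (at x)"
  shows "integral {a..b} F' = F b - F a"
proof (intro integral_unique fundamental_theorem_of_calculus)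
  show "(F has_vector_derivative F' x) (at x within {a..b})" if "x \<in> {a..b}" for x
    using has_field_derivative_at_within[OF assms(2)[OF that]]
    by (simp add: has_real_derivative_iff_has_vector_derivative)
qed fact

lemma integral_rect_ftc_x:
  fixes f :: "real \<times> real \<Rightarrow> real"
  assumes "a \<le> b" and "continuous_on (cbox (a, c) (b, d)) fx"
    and "\<And>x y. (x, y) \<in> cbox (a, c) (b, d) \<Longrightarrow>
           ((\<lambda>x. f (x, y)) has_real_derivative fx (x, y)) (at x)"
  shows "integral (cbox (a, c) (b, d)) fx = integral {c..d} (\<lambda>y. f (b, y) - f (a, y))"
proof -
  have "integral {a..b} (\<lambda>x. fx (x, y)) = f (b, y) - f (a, y)" if "y \<in> {c..d}" for y
    by (rule integral_real_derivative[OF assms(1)], rule assms(3)) (use that in \<open>auto simp: mem_rect\<close>)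
  then show ?thesis
    by (subst integral_rect_y[OF assms(2)], intro integral_cong)
qed

lemma integral_rect_ftc_y:
  fixes f :: "real \<times> real \<Rightarrow> real"
  assumes "c \<le> d" and "continuous_on (cbox (a, c) (b, d)) fy"
    and "\<And>x y. (x, y) \<in> cbox (a, c) (b, d) \<Longrightarrow>
           ((\<lambda>y. f (x, y)) has_real_derivative fy (x, y)) (at y)"
  shows "integral (cbox (a, c) (b, d)) fy = integral {a..b} (\<lambda>x. f (x, d) - f (x, c))"
proof -
  have "integral {c..d} (\<lambda>y. fy (x, y)) = f (x, d) - f (x, c)" if "x \<in> {a..b}" for x
    by (rule integral_real_derivative[OF assms(1)], rule assms(3)) (use that in \<open>auto simp: mem_rect\<close>)
  then show ?thesis
    by (subst integral_rect_x[OF assms(2)], intro integral_cong)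
qed

lemma abs_integral_diff_le:
  fixes B :: "real \<Rightarrow> real"
  assumes "a \<le> b" "continuous_on {a..b} B1" "continuous_on {a..b} B2"
    and "\<And>x. x \<in> {a..b} \<Longrightarrow> \<bar>B1 x\<bar> \<le> \<beta>" "\<And>x. x \<in> {a..b} \<Longrightarrow> \<bar>B2 x\<bar> \<le> (\<beta>::real)"
  shows "\<bar>integral {a..b} (\<lambda>x. B1 x - B2 x)\<bar> \<le> 2 * \<beta> * (b - a)"
proof -
  have "norm (integral {a..b} (\<lambda>x. B1 x - B2 x)) \<le> (2 * \<beta>) * (b - a)"
  proof (rule integral_bound)
    fix x assume "x \<in> {a..b}"
    then show "norm (B1 x - B2 x) \<le> 2 * \<beta>"
      using assms(4,5)[of x] by (simp add: abs_le_iff)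
  qed (use assms in \<open>auto intro: continuous_intros\<close>)
  then show ?thesis by simp
qed

lemma abs_integral_le_dominated:
  fixes f g :: "real \<times> real \<Rightarrow> real"
  assumes "continuous_on (cbox a b) f" "continuous_on (cbox a b) g"
    and "\<And>z. z \<in> cbox a b \<Longrightarrow> \<bar>f z\<bar> \<le> g z"
  shows "\<bar>integral (cbox a b) f\<bar> \<le> integral (cbox a b) g"
  using integral_norm_bound_integral[of f "cbox a b" g] assms
  by (simp add: integrable_continuous)

lemma continuous_on_slice_x:
  fixes f :: "real \<times> real \<Rightarrow> real"
  assumes "continuous_on (cbox (a, c) (b, d)) f" "y \<in> {c..d}"
  shows "continuous_on {a..b} (\<lambda>x. f (x, y))"
  by (rule continuous_on_compose2[OF assms(1)]) (use assms in \<open>auto simp: mem_rect intro!: continuous_intros\<close>)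

lemma continuous_on_slice_y:
  fixes f :: "real \<times> real \<Rightarrow> real"
  assumes "continuous_on (cbox (a, c) (b, d)) f" "x \<in> {a..b}"
  shows "continuous_on {c..d} (\<lambda>y. f (x, y))"
  by (rule continuous_on_compose2[OF assms(1)]) (use assms in \<open>auto simp: mem_rect intro!: continuous_intros\<close>)

text \<open>The pair \<open>(V, B)\<close> consists of a function and an approximate harmonic conjugate; \<open>g\<close>
  bounds the defect in the Cauchy--Riemann equations.\<close>

lemma conjugate_sweep_x:
  fixes V B :: "real \<times> real \<Rightarrow> real"
  assumes "a \<le> b" "c \<le> d"
    and cont: "continuous_on (cbox (a, c) (b, d)) B"
      "continuous_on (cbox (a, c) (b, d)) Vx" "continuous_on (cbox (a, c) (b, d)) By"
      "continuous_on (cbox (a, c) (b, d)) g"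
    and Vx: "\<And>x y. (x, y) \<in> cbox (a, c) (b, d) \<Longrightarrow> ((\<lambda>x. V (x, y)) has_real_derivative Vx (x, y)) (at x)"
    and By: "\<And>x y. (x, y) \<in> cbox (a, c) (b, d) \<Longrightarrow> ((\<lambda>y. B (x, y)) has_real_derivative By (x, y)) (at y)"
    and B: "\<And>z. z \<in> cbox (a, c) (b, d) \<Longrightarrow> \<bar>B z\<bar> \<le> \<beta>"
    and g: "\<And>z. z \<in> cbox (a, c) (b, d) \<Longrightarrow> \<bar>Vx z - By z\<bar> \<le> g z"
  shows "\<bar>integral {c..d} (\<lambda>y. V (b, y) - V (a, y))\<bar> \<le> 2 * \<beta> * (b - a) + integral (cbox (a, c) (b, d)) g"
proof -
  let ?R = "cbox (a, c) (b, d)"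
  have "integral {c..d} (\<lambda>y. V (b, y) - V (a, y)) = integral ?R Vx"
    by (rule integral_rect_ftc_x[symmetric]) (use assms in auto)
  also have "\<dots> = integral ?R By + integral ?R (\<lambda>z. Vx z - By z)"
    using cont by (subst integral_diff) (auto intro!: integrable_continuous)
  also have "integral ?R By = integral {a..b} (\<lambda>x. B (x, d) - B (x, c))"
    by (rule integral_rect_ftc_y) (use assms in auto)
  finally have eq: "integral {c..d} (\<lambda>y. V (b, y) - V (a, y)) =
      integral {a..b} (\<lambda>x. B (x, d) - B (x, c)) + integral ?R (\<lambda>z. Vx z - By z)" .
  have 1: "\<bar>integral {a..b} (\<lambda>x. B (x, d) - B (x, c))\<bar> \<le> 2 * \<beta> * (b - a)"
    by (rule abs_integral_diff_le)
       (use assms in \<open>auto intro!: B continuous_on_slice_x[OF cont(1)] simp: mem_rect\<close>)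
  have 2: "\<bar>integral ?R (\<lambda>z. Vx z - By z)\<bar> \<le> integral ?R g"
    by (rule abs_integral_le_dominated) (use cont g in \<open>auto intro!: continuous_intros\<close>)
  show ?thesis
    unfolding eq using 1 2 by linarith
qed

lemma conjugate_sweep_y:
  fixes V B :: "real \<times> real \<Rightarrow> real"
  assumes "a \<le> b" "c \<le> d"
    and cont: "continuous_on (cbox (a, c) (b, d)) B"
      "continuous_on (cbox (a, c) (b, d)) Vy" "continuous_on (cbox (a, c) (b, d)) Bx"
      "continuous_on (cbox (a, c) (b, d)) g"
    and Vy: "\<And>x y. (x, y) \<in> cbox (a, c) (b, d) \<Longrightarrow> ((\<lambda>y. V (x, y)) has_real_derivative Vy (x, y)) (at y)"
    and Bx: "\<And>x y. (x, y) \<in> cbox (a, c) (b, d) \<Longrightarrow> ((\<lambda>x. B (x, y)) has_real_derivative Bx (x, y)) (at x)"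
    and B: "\<And>z. z \<in> cbox (a, c) (b, d) \<Longrightarrow> \<bar>B z\<bar> \<le> \<beta>"
    and g: "\<And>z. z \<in> cbox (a, c) (b, d) \<Longrightarrow> \<bar>Vy z + Bx z\<bar> \<le> g z"
  shows "\<bar>integral {a..b} (\<lambda>x. V (x, d) - V (x, c))\<bar> \<le> 2 * \<beta> * (d - c) + integral (cbox (a, c) (b, d)) g"
proof -
  let ?R = "cbox (a, c) (b, d)"
  have "integral {a..b} (\<lambda>x. V (x, d) - V (x, c)) = integral ?R Vy"
    by (rule integral_rect_ftc_y[symmetric]) (use assms in auto)
  also have "\<dots> = integral ?R (\<lambda>z. Vy z + Bx z) - integral ?R Bx"
    using cont by (subst integral_add) (auto intro!: integrable_continuous)
  also have "integral ?R Bx = integral {c..d} (\<lambda>y. B (b, y) - B (a, y))"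
    by (rule integral_rect_ftc_x) (use assms in auto)
  finally have eq: "integral {a..b} (\<lambda>x. V (x, d) - V (x, c)) =
      integral ?R (\<lambda>z. Vy z + Bx z) - integral {c..d} (\<lambda>y. B (b, y) - B (a, y))" .
  have 1: "\<bar>integral {c..d} (\<lambda>y. B (b, y) - B (a, y))\<bar> \<le> 2 * \<beta> * (d - c)"
    by (rule abs_integral_diff_le)
       (use assms in \<open>auto intro!: B continuous_on_slice_y[OF cont(1)] simp: mem_rect\<close>)
  have 2: "\<bar>integral ?R (\<lambda>z. Vy z + Bx z)\<bar> \<le> integral ?R g"
    by (rule abs_integral_le_dominated) (use cont g in \<open>auto intro!: continuous_intros\<close>)
  show ?thesis
    unfolding eq using 1 2 by linarith
qed

text \<open>Moving a segment across a rectangle changes the integral of V over it by at most 2 *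
  \<beta> times the distance, whatever the length of the segment, plus the integral of
  \<open>g\<close>. Sweeping sideways from the central segment, where V <= v0, bounds the averages
  of V over all parallel segments of half-length c. By Fubini some height y1 in [-c, c] has a small
  strip integral, and a second sweep along the strip carries this to any height y0.\<close>

lemma conjugate_strip_bound:
  fixes V B :: "real \<times> real \<Rightarrow> real"
  assumes c: "0 < c" "c \<le> l" and x12: "-l \<le> x1" "x1 < x2" "x2 \<le> l"
    and cont: "continuous_on (cbox (-l, -l) (l, l)) V" "continuous_on (cbox (-l, -l) (l, l)) B"
      "continuous_on (cbox (-l, -l) (l, l)) Vx" "continuous_on (cbox (-l, -l) (l, l)) Vy"
      "continuous_on (cbox (-l, -l) (l, l)) Bx" "continuous_on (cbox (-l, -l) (l, l)) By"
      "continuous_on (cbox (-l, -l) (l, l)) g"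
    and Vx: "\<And>x y. (x, y) \<in> cbox (-l, -l) (l, l) \<Longrightarrow> ((\<lambda>x. V (x, y)) has_real_derivative Vx (x, y)) (at x)"
    and Vy: "\<And>x y. (x, y) \<in> cbox (-l, -l) (l, l) \<Longrightarrow> ((\<lambda>y. V (x, y)) has_real_derivative Vy (x, y)) (at y)"
    and Bx: "\<And>x y. (x, y) \<in> cbox (-l, -l) (l, l) \<Longrightarrow> ((\<lambda>x. B (x, y)) has_real_derivative Bx (x, y)) (at x)"
    and By: "\<And>x y. (x, y) \<in> cbox (-l, -l) (l, l) \<Longrightarrow> ((\<lambda>y. B (x, y)) has_real_derivative By (x, y)) (at y)"
    and B: "\<And>z. z \<in> cbox (-l, -l) (l, l) \<Longrightarrow> \<bar>B z\<bar> \<le> \<beta>"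
    and g1: "\<And>z. z \<in> cbox (-l, -l) (l, l) \<Longrightarrow> \<bar>Vx z - By z\<bar> \<le> g z"
    and g2: "\<And>z. z \<in> cbox (-l, -l) (l, l) \<Longrightarrow> \<bar>Vy z + Bx z\<bar> \<le> g z"
    and v0: "\<And>y. \<bar>y\<bar> \<le> c \<Longrightarrow> V (0, y) \<le> v0"
    and IQ: "integral (cbox (-l, -l) (l, l)) g \<le> IQ"
    and IS: "integral (cbox (x1, -l) (x2, l)) g \<le> IS"
    and y0: "y0 \<in> {-l..l}"
  shows "integral {x1..x2} (\<lambda>x. V (x, y0)) \<le>
      (x2 - x1) * (v0 + (\<beta> * l + IQ / 2) / c) + (4 * \<beta> * l + IS)"
proof -
  let ?Q = "cbox (-l, -l) (l, l)"
  have l: "0 < l" using c by simp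
  have g0: "0 \<le> g z" if "z \<in> ?Q" for z using g1[OF that] by linarith
  have \<beta>0: "0 \<le> \<beta>" using B[of "(0,0)"] l by (auto simp: mem_rect)
  have contsub: "continuous_on (cbox (a, c') (b, d)) f"
    if "continuous_on ?Q f" "-l \<le> a" "b \<le> l" "-l \<le> c'" "d \<le> l" for f :: "real \<times> real \<Rightarrow> real" and a b c' d
    by (rule continuous_on_subset[OF that(1) rect_mono]) (use that in auto)
  have sub: "(x, y) \<in> ?Q" if "(x, y) \<in> cbox (a, c') (b, d)" "-l \<le> a" "b \<le> l" "-l \<le> c'" "d \<le> l" for x y a b c' d
    using that by (auto simp: mem_rect)
  have subint: "integral (cbox (a, c') (b, d)) g \<le> integral (cbox (a', c'') (b', d')) g"
    if "-l \<le> a'" "a' \<le> a" "b \<le> b'" "b' \<le> l" "-l \<le> c''" "c'' \<le> c'" "d \<le> d'" "d' \<le> l" for a b c' d a' b' c'' d'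
  proof (rule integral_subset_le)
    show "cbox (a, c') (b, d) \<subseteq> cbox (a', c'') (b', d')" by (rule rect_mono) (use that in auto)
    show "\<forall>x\<in>cbox (a', c'') (b', d'). 0 \<le> g x" using g0 sub that by (auto simp: mem_rect)
    show "g integrable_on cbox (a, c') (b, d)"
      by (rule integrable_continuous, rule contsub[OF cont(7)]) (use that in auto)
    show "g integrable_on cbox (a', c'') (b', d')"
      by (rule integrable_continuous, rule contsub[OF cont(7)]) (use that in auto)
  qed
  have sweepx: "\<bar>integral {c'..d} (\<lambda>y. V (b, y) - V (a, y))\<bar> \<le> 2 * \<beta> * (b - a) + integral (cbox (a, c') (b, d)) g"
    if "a \<le> b" "c' \<le> d" "-l \<le> a" "b \<le> l" "-l \<le> c'" "d \<le> l" for a b c' d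
    by (rule conjugate_sweep_x[where B = B and Vx = Vx and By = By])
       (use that cont Vx By B g1 in \<open>auto intro!: contsub simp: mem_rect\<close>)
  have sweepy: "\<bar>integral {a..b} (\<lambda>x. V (x, d) - V (x, c'))\<bar> \<le> 2 * \<beta> * (d - c') + integral (cbox (a, c') (b, d)) g"
    if "a \<le> b" "c' \<le> d" "-l \<le> a" "b \<le> l" "-l \<le> c'" "d \<le> l" for a b c' d
    by (rule conjugate_sweep_y[where B = B and Vy = Vy and Bx = Bx])
       (use that cont Vy Bx B g2 in \<open>auto intro!: contsub simp: mem_rect\<close>)
  have slx: "(\<lambda>x. V (x, y)) integrable_on {a..b}" if "-l \<le> a" "b \<le> l" "y \<in> {-l..l}" for a b y
    by (rule integrable_continuous_real, rule continuous_on_subset[OF continuous_on_slice_x[OF cont(1)]])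
       (use that in auto)
  have sly: "(\<lambda>y. V (x, y)) integrable_on {a..b}" if "-l \<le> a" "b \<le> l" "x \<in> {-l..l}" for a b x
    by (rule integrable_continuous_real, rule continuous_on_subset[OF continuous_on_slice_y[OF cont(1)]])
       (use that in auto)
  define m where "m x = integral {-c..c} (\<lambda>y. V (x, y))" for x
  have m0: "m 0 \<le> 2 * c * v0"
  proof -
    have "m 0 \<le> integral {-c..c} (\<lambda>y. v0)"
      unfolding m_def by (rule integral_le) (use v0 sly[of "-c" c 0] c l in auto)
    then show ?thesis using c by simp
  qed
  have m: "m x \<le> 2 * c * v0 + 2 * \<beta> * l + IQ" if "x \<in> {-l..l}" for x
  proof (cases "0 \<le> x")
    case True
    have "integral {-c..c} (\<lambda>y. V (x, y) - V (0, y)) = m x - m 0"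
      unfolding m_def by (rule integral_diff) (use sly c l that in auto)
    moreover have "integral (cbox (0, -c) (x, c)) g \<le> IQ"
      by (rule order_trans[OF subint IQ]) (use that c l in auto)
    moreover have "2 * \<beta> * (x - 0) \<le> 2 * \<beta> * l" using \<beta>0 that by (intro mult_left_mono) auto
    ultimately show ?thesis
      using sweepx[of 0 x "-c" c] that True c m0 by auto
  next
    case False
    have "integral {-c..c} (\<lambda>y. V (0, y) - V (x, y)) = m 0 - m x"
      unfolding m_def by (rule integral_diff) (use sly c l that in auto)
    moreover have "integral (cbox (x, -c) (0, c)) g \<le> IQ"
      by (rule order_trans[OF subint IQ]) (use that c l in auto)
    moreover have "2 * \<beta> * (0 - x) \<le> 2 * \<beta> * l" using \<beta>0 that by (intro mult_left_mono) auto
    ultimately show ?thesis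
      using sweepx[of x 0 "-c" c] that False c m0 l by auto
  qed
  define W where "W y = integral {x1..x2} (\<lambda>x. V (x, y))" for y
  have contW: "continuous_on {-c..c} W"
  proof -
    have "continuous_on (cbox (-c) c) (\<lambda>y. integral (cbox x1 x2) (\<lambda>x. V (x, y)))"
    proof (rule integral_continuous_on_param)
      show "continuous_on (cbox (- c) c \<times> cbox x1 x2) (\<lambda>(y, x). V (x, y))"
        unfolding case_prod_unfold
        by (rule continuous_on_compose2[OF cont(1)])
           (use c x12 in \<open>auto intro!: continuous_intros simp: mem_rect\<close>)
    qed
    then show ?thesis by (simp add: W_def)
  qed
  obtain y1 where y1: "y1 \<in> {-c..c}" "\<And>y. y \<in> {-c..c} \<Longrightarrow> W y1 \<le> W y"
    using continuous_attains_inf[OF compact_Icc _ contW] c by auto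
  have contV': "continuous_on (cbox (x1, -c) (x2, c)) V"
    by (rule contsub[OF cont(1)]) (use c x12 in auto)
  have "2 * c * W y1 = integral {-c..c} (\<lambda>y. W y1)" using c by simp
  also have "\<dots> \<le> integral {-c..c} W"
    by (rule integral_le) (use y1 contW in \<open>auto intro: integrable_continuous_real\<close>)
  also have "\<dots> = integral {x1..x2} m"
    unfolding W_def m_def integral_rect_x[OF contV', symmetric] integral_rect_y[OF contV', symmetric] ..
  also have "\<dots> \<le> integral {x1..x2} (\<lambda>x. 2 * c * v0 + 2 * \<beta> * l + IQ)"
  proof (rule integral_le)
    have "continuous_on (cbox x1 x2) (\<lambda>x. integral (cbox (-c) c) (\<lambda>y. V (x, y)))"
    proof (rule integral_continuous_on_param)
      show "continuous_on (cbox x1 x2 \<times> cbox (- c) c) (\<lambda>(x, y). V (x, y))"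
        unfolding case_prod_unfold prod.collapse
        by (rule continuous_on_subset[OF cont(1)]) (use c x12 in \<open>auto simp: mem_rect\<close>)
    qed
    then show "m integrable_on {x1..x2}"
      unfolding m_def using integrable_continuous_real by fastforce
    show "m x \<le> 2 * c * v0 + 2 * \<beta> * l + IQ" if "x \<in> {x1..x2}" for x
      by (rule m) (use that x12 in auto)
  qed auto
  also have "\<dots> = (x2 - x1) * (2 * c * v0 + 2 * \<beta> * l + IQ)" using x12 by simp
  finally have "W y1 \<le> (x2 - x1) * (2 * c * v0 + 2 * \<beta> * l + IQ) / (2 * c)"
    using c by (simp add: field_simps)
  also have "\<dots> = (x2 - x1) * (v0 + (\<beta> * l + IQ / 2) / c)" using c by (simp add: field_simps)
  finally have Wy1: "W y1 \<le> (x2 - x1) * (v0 + (\<beta> * l + IQ / 2) / c)" .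
  \<comment> \<open>The distance is at most 2 * l and the bound does not shrink with the width x2 -
    x1; dividing by the width later is the origin of the terms of order 1 / h.\<close>
  have "W y0 - W y1 \<le> 4 * \<beta> * l + IS"
  proof (cases "y1 \<le> y0")
    case True
    have "integral {x1..x2} (\<lambda>x. V (x, y0) - V (x, y1)) = W y0 - W y1"
      unfolding W_def by (rule integral_diff) (use slx x12 y0 y1 c in auto)
    moreover have "integral (cbox (x1, y1) (x2, y0)) g \<le> IS"
      by (rule order_trans[OF subint IS]) (use x12 y0 y1 c in auto)
    moreover have "2 * \<beta> * (y0 - y1) \<le> 2 * \<beta> * (2 * l)" using \<beta>0 y0 y1 c by (intro mult_left_mono) auto
    ultimately show ?thesis using sweepy[of x1 x2 y1 y0] True x12 y0 y1 c by auto
  next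
    case False
    have "integral {x1..x2} (\<lambda>x. V (x, y1) - V (x, y0)) = W y1 - W y0"
      unfolding W_def by (rule integral_diff) (use slx x12 y0 y1 c in auto)
    moreover have "integral (cbox (x1, y0) (x2, y1)) g \<le> IS"
      by (rule order_trans[OF subint IS]) (use x12 y0 y1 c in auto)
    moreover have "2 * \<beta> * (y1 - y0) \<le> 2 * \<beta> * (2 * l)" using \<beta>0 y0 y1 c by (intro mult_left_mono) auto
    ultimately show ?thesis using sweepy[of x1 x2 y0 y1] False x12 y0 y1 c by auto
  qed
  then show ?thesis using Wy1 unfolding W_def by linarith
qed

subsection \<open>A cutoff function and the sub-mean value inequality\<close>

text \<open>The error of the difference quotient of \<open>h\<close> is at most the sum of the
  errors for \<open>f\<close> and \<open>g\<close>, whichever of the two formulas applies at the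
  nearby point.\<close>

lemma has_real_derivative_glue:
  fixes f g h :: "real \<Rightarrow> real"
  assumes "(f has_real_derivative D) (at x)" "(g has_real_derivative D) (at x)"
    and "f x = h x" "g x = h x"
    and "\<forall>\<^sub>F t in at x. h t = f t \<or> h t = g t"
  shows "(h has_real_derivative D) (at x)"
proof -
  let ?q = "\<lambda>f t. (f t - f x) / (t - x)"
  have "(?q f \<longlongrightarrow> D) (at x)" "(?q g \<longlongrightarrow> D) (at x)"
    using assms(1,2) by (simp_all add: has_field_derivative_iff)
  then have lim: "((\<lambda>t. \<bar>?q f t - D\<bar> + \<bar>?q g t - D\<bar>) \<longlongrightarrow> \<bar>D - D\<bar> + \<bar>D - D\<bar>) (at x)"
    by (intro tendsto_intros)
  have "(?q h \<longlongrightarrow> D) (at x)"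
  proof (rule Lim_transform)
    show "((\<lambda>t. D) \<longlongrightarrow> D) (at x)" by simp
    show "((\<lambda>t. ?q h t - D) \<longlongrightarrow> 0) (at x)"
    proof (rule Lim_null_comparison)
      show "\<forall>\<^sub>F t in at x. norm (?q h t - D) \<le> \<bar>?q f t - D\<bar> + \<bar>?q g t - D\<bar>"
        using assms(5) by eventually_elim (use assms(3,4) in auto)
    qed (use lim in simp)
  qed
  then show ?thesis by (simp add: has_field_derivative_iff)
qed

definition sstep :: "real \<Rightarrow> real" where
  "sstep s = (if s \<le> 0 then 0 else if s \<le> 1 then 3 * s\<^sup>2 - 2 * s ^ 3 else 1)"

definition sstep' :: "real \<Rightarrow> real" where
  "sstep' s = (if s \<le> 0 then 0 else if s \<le> 1 then 6 * s * (1 - s) else 0)"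

text \<open>Primitive of the cubic smoothstep \<open>sstep\<close>. As \<open>sstep\<close> is of
  class C^1, this is of class C^2, as a test function under the Laplacian must be; beyond 1 it is
  linear, so that composed with a logarithm it is harmonic there up to the regularisation.\<close>

definition sstepI :: "real \<Rightarrow> real" where
  "sstepI s = (if s \<le> 0 then 0 else if s \<le> 1 then s ^ 3 - s ^ 4 / 2 else s - 1/2)"

lemma has_real_derivative_three_pieces:
  fixes f h :: "real \<Rightarrow> real"
  assumes h: "\<And>s. h s = (if s \<le> 0 then c else if s \<le> 1 then f s else g s)"
    and h': "\<And>s. h' s = (if s \<le> 0 then 0 else if s \<le> 1 then f' s else g' s)"
    and f: "\<And>s. (f has_real_derivative f' s) (at s)" "f 0 = c" "f' 0 = 0"
    and g: "\<And>s. (g has_real_derivative g' s) (at s)" "g 1 = f 1" "g' 1 = f' 1"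
  shows "(h has_real_derivative h' s) (at s)"
proof -
  consider "s < 0" | "s = 0" | "0 < s" "s < 1" | "s = 1" | "s > 1" by linarith
  then show ?thesis
  proof cases
    case 1
    have "\<forall>\<^sub>F t in nhds s. h t = c"
      using eventually_nhds_in_open[of "{..<0}" s] 1 by (auto elim!: eventually_mono simp: h)
    moreover have "((\<lambda>_. c) has_real_derivative h' s) (at s)" using 1 by (simp add: h')
    ultimately show ?thesis by (subst DERIV_cong_ev[OF refl _ refl])
  next
    case 2
    show ?thesis
    proof (rule has_real_derivative_glue)
      show "((\<lambda>_. c) has_real_derivative h' s) (at s)" using 2 by (simp add: h')
      show "(f has_real_derivative h' s) (at s)" using 2 f(1)[of 0] f(3) by (simp add: h')
      show "\<forall>\<^sub>F t in at s. h t = c \<or> h t = f t"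
        using eventually_at_in_open'[of "{..<1}" s] 2 by (auto elim!: eventually_mono simp: h)
    qed (use 2 f in \<open>auto simp: h\<close>)
  next
    case 3
    have "\<forall>\<^sub>F t in nhds s. h t = f t"
      using eventually_nhds_in_open[of "{0<..<1}" s] 3 by (auto elim!: eventually_mono simp: h)
    moreover have "(f has_real_derivative h' s) (at s)" using 3 f(1)[of s] by (simp add: h')
    ultimately show ?thesis by (subst DERIV_cong_ev[OF refl _ refl])
  next
    case 4
    show ?thesis
    proof (rule has_real_derivative_glue)
      show "(f has_real_derivative h' s) (at s)" using 4 f(1)[of 1] by (simp add: h')
      show "(g has_real_derivative h' s) (at s)" using 4 g(1)[of 1] g(3) by (simp add: h')
      show "\<forall>\<^sub>F t in at s. h t = f t \<or> h t = g t"
        using eventually_at_in_open'[of "{0<..}" s] 4 by (auto elim!: eventually_mono simp: h)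
    qed (use 4 g in \<open>auto simp: h\<close>)
  next
    case 5
    have "\<forall>\<^sub>F t in nhds s. h t = g t"
      using eventually_nhds_in_open[of "{1<..}" s] 5 by (auto elim!: eventually_mono simp: h)
    moreover have "(g has_real_derivative h' s) (at s)" using 5 g(1)[of s] by (simp add: h')
    ultimately show ?thesis by (subst DERIV_cong_ev[OF refl _ refl])
  qed
qed

lemma DERIV_sstep: "(sstep has_real_derivative sstep' s) (at s)"
  by (rule has_real_derivative_three_pieces[OF sstep_def sstep'_def])
     (auto intro!: derivative_eq_intros simp: power2_eq_square algebra_simps)

lemma DERIV_sstepI: "(sstepI has_real_derivative sstep s) (at s)"
  by (rule has_real_derivative_three_pieces[OF sstepI_def sstep_def])
     (auto intro!: derivative_eq_intros simp: power2_eq_square power3_eq_cube field_simps)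

lemma continuous_on_sstep: "continuous_on S sstep"
  using DERIV_sstep by (intro DERIV_continuous_on[of _ _ sstep']) (auto intro: has_field_derivative_at_within)

lemma continuous_on_sstepI: "continuous_on S sstepI"
  using DERIV_sstepI by (intro DERIV_continuous_on[of _ _ sstep]) (auto intro: has_field_derivative_at_within)

lemma sstep'_eq: "sstep' s = 6 * max 0 (min 1 s) * (1 - max 0 (min 1 s))"
  by (auto simp: sstep'_def max_def min_def)

lemma continuous_on_sstep': "continuous_on S sstep'"
  unfolding sstep'_eq[abs_def] by (intro continuous_intros)

lemma sstep_bounds: "0 \<le> sstep s" "sstep s \<le> 1"
proof -
  have "0 \<le> 3 * s\<^sup>2 - 2 * s ^ 3 \<and> 3 * s\<^sup>2 - 2 * s ^ 3 \<le> 1" if "0 \<le> s" "s \<le> 1"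
  proof -
    have "3 * s\<^sup>2 - 2 * s ^ 3 = s\<^sup>2 * (3 - 2 * s)" by (simp add: power2_eq_square power3_eq_cube algebra_simps)
    moreover have "1 - (3 * s\<^sup>2 - 2 * s ^ 3) = (1 - s)\<^sup>2 * (1 + 2 * s)"
      by (simp add: power2_eq_square power3_eq_cube algebra_simps)
    moreover have "0 \<le> s\<^sup>2 * (3 - 2 * s)" "0 \<le> (1 - s)\<^sup>2 * (1 + 2 * s)" using that by auto
    ultimately show ?thesis by linarith
  qed
  then show "0 \<le> sstep s" "sstep s \<le> 1" by (auto simp: sstep_def)
qed

lemma sstep_simps: "s \<le> 0 \<Longrightarrow> sstep s = 0" "1 \<le> s \<Longrightarrow> sstep s = 1"
  by (auto simp: sstep_def)

lemma sstep'_simps: "s \<le> 0 \<Longrightarrow> sstep' s = 0" "1 \<le> s \<Longrightarrow> sstep' s = 0"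
  by (auto simp: sstep'_def)

lemma sstep'_bounds: "0 \<le> sstep' s" "sstep' s \<le> 3 / 2"
proof -
  have "6 * u * (1 - u) \<le> 3 / 2" for u :: real
    using zero_le_power2[of "u - 1/2"] by (simp add: power2_eq_square algebra_simps)
  then show "0 \<le> sstep' s" "sstep' s \<le> 3 / 2" by (auto simp: sstep'_def)
qed

lemma sstepI_simps: "s \<le> 0 \<Longrightarrow> sstepI s = 0"
  by (auto simp: sstepI_def)

lemma sstepI_nonneg: "0 \<le> sstepI s"
proof -
  have "0 \<le> s ^ 3 - s ^ 4 / 2" if "0 \<le> s" "s \<le> 1"
  proof -
    have "s ^ 3 - s ^ 4 / 2 = s ^ 3 * (1 - s / 2)" by (simp add: power_eq_if algebra_simps)
    then show ?thesis using that by auto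
  qed
  then show ?thesis by (auto simp: sstepI_def)
qed

lemma integral_rect_ftc_x_zero:
  fixes f :: "real \<times> real \<Rightarrow> real"
  assumes "a \<le> b" and "continuous_on (cbox (a, c) (b, d)) fx"
    and "\<And>x y. (x, y) \<in> cbox (a, c) (b, d) \<Longrightarrow>
           ((\<lambda>x. f (x, y)) has_real_derivative fx (x, y)) (at x)"
    and "\<And>y. y \<in> {c..d} \<Longrightarrow> f (a, y) = 0" "\<And>y. y \<in> {c..d} \<Longrightarrow> f (b, y) = 0"
  shows "integral (cbox (a, c) (b, d)) fx = 0"
proof -
  have "integral {c..d} (\<lambda>y. f (b, y) - f (a, y)) = integral {c..d} (\<lambda>y. 0)"
    by (rule integral_cong) (use assms in auto)
  then show ?thesis using integral_rect_ftc_x[OF assms(1-3)] by simp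
qed

lemma integral_rect_ftc_y_zero:
  fixes f :: "real \<times> real \<Rightarrow> real"
  assumes "c \<le> d" and "continuous_on (cbox (a, c) (b, d)) fy"
    and "\<And>x y. (x, y) \<in> cbox (a, c) (b, d) \<Longrightarrow>
           ((\<lambda>y. f (x, y)) has_real_derivative fy (x, y)) (at y)"
    and "\<And>x. x \<in> {a..b} \<Longrightarrow> f (x, c) = 0" "\<And>x. x \<in> {a..b} \<Longrightarrow> f (x, d) = 0"
  shows "integral (cbox (a, c) (b, d)) fy = 0"
proof -
  have "integral {a..b} (\<lambda>x. f (x, d) - f (x, c)) = integral {a..b} (\<lambda>x. 0)"
    by (rule integral_cong) (use assms in auto)
  then show ?thesis using integral_rect_ftc_y[OF assms(1-3)] by simp
qed

text \<open>Testing against \<open>E = sstepI (ln (\<delta>\<^sup>2 / \<rho>))\<close> with \<open>\<rho> = \<epsilon>\<^sup>2 + \<bar>z\<bar>\<^sup>2\<close>: this is a truncated and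
  regularised fundamental solution, whose Laplacian is concentrated near the origin up to a
  bounded positive part.\<close>

lemma submean_regularised:
  fixes V :: "real \<times> real \<Rightarrow> real"
  assumes \<delta>: "0 < \<delta>" and \<epsilon>: "0 < \<epsilon>" "\<epsilon> \<le> \<delta> / 3"
  defines "Q \<equiv> cbox (-\<delta>, -\<delta>) (\<delta>, \<delta>)"
  assumes cont: "continuous_on Q V" "continuous_on Q Vx" "continuous_on Q Vy"
      "continuous_on Q Vxx" "continuous_on Q Vyy"
    and Vx: "\<And>x y. (x, y) \<in> Q \<Longrightarrow> ((\<lambda>x. V (x, y)) has_real_derivative Vx (x, y)) (at x)"
    and Vy: "\<And>x y. (x, y) \<in> Q \<Longrightarrow> ((\<lambda>y. V (x, y)) has_real_derivative Vy (x, y)) (at y)"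
    and Vxx: "\<And>x y. (x, y) \<in> Q \<Longrightarrow> ((\<lambda>x. Vx (x, y)) has_real_derivative Vxx (x, y)) (at x)"
    and Vyy: "\<And>x y. (x, y) \<in> Q \<Longrightarrow> ((\<lambda>y. Vy (x, y)) has_real_derivative Vyy (x, y)) (at y)"
    and lap: "\<And>z. z \<in> Q \<Longrightarrow> 0 \<le> Vxx z + Vyy z"
    and V0: "\<And>z. z \<in> Q \<Longrightarrow> 0 \<le> V z"
    and v: "\<And>z. z \<in> cbox (-\<epsilon>, -\<epsilon>) (\<epsilon>, \<epsilon>) \<Longrightarrow> v \<le> V z"
  shows "16 / 9 * v \<le> 17 / \<delta>\<^sup>2 * integral Q V"
proof -
  define \<rho> where "\<rho> z = \<epsilon>\<^sup>2 + (fst z)\<^sup>2 + (snd z)\<^sup>2" for z :: "real \<times> real"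
  define s where "s z = ln (\<delta>\<^sup>2) - ln (\<rho> z)" for z
  define E where "E z = sstepI (s z)" for z
  define Ex where "Ex z = - (2 * fst z / \<rho> z) * sstep (s z)" for z
  define Ey where "Ey z = - (2 * snd z / \<rho> z) * sstep (s z)" for z
  define Exx where "Exx z = (2 * fst z / \<rho> z)\<^sup>2 * sstep' (s z)
      + (4 * (fst z)\<^sup>2 / (\<rho> z)\<^sup>2 - 2 / \<rho> z) * sstep (s z)" for z
  define Eyy where "Eyy z = (2 * snd z / \<rho> z)\<^sup>2 * sstep' (s z)
      + (4 * (snd z)\<^sup>2 / (\<rho> z)\<^sup>2 - 2 / \<rho> z) * sstep (s z)" for z
  have \<rho>pos: "\<rho> z > 0" for z using \<epsilon> by (simp add: \<rho>_def add_pos_nonneg)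
  have \<rho>ge: "\<epsilon>\<^sup>2 \<le> \<rho> z" for z by (simp add: \<rho>_def)
  have c\<rho>: "continuous_on S \<rho>" for S unfolding \<rho>_def by (intro continuous_intros)
  have cs: "continuous_on S s" for S
    unfolding s_def using \<rho>pos by (intro continuous_intros c\<rho>) (auto simp: less_imp_neq[symmetric])
  have cc: "continuous_on S (\<lambda>z. sstep (s z))" "continuous_on S (\<lambda>z. sstep' (s z))" "continuous_on S E" for S
    unfolding E_def using continuous_on_sstep continuous_on_sstep' continuous_on_sstepI cs
    by (auto intro: continuous_on_compose2[of UNIV _ S s])
  have \<rho>ne: "\<rho> z \<noteq> 0" for z using \<rho>pos[of z] by simp
  have cE: "continuous_on S Ex" "continuous_on S Ey" "continuous_on S Exx" "continuous_on S Eyy" for S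
    unfolding Ex_def Ey_def Exx_def Eyy_def
    by (intro continuous_intros cc c\<rho>; simp add: \<rho>ne)+
  have d\<rho>: "((\<lambda>x. \<rho> (x, y)) has_real_derivative 2 * x) (at x)"
           "((\<lambda>y. \<rho> (x, y)) has_real_derivative 2 * y) (at y)" for x y
    unfolding \<rho>_def by (auto intro!: derivative_eq_intros)
  have ds: "((\<lambda>x. s (x, y)) has_real_derivative - (2 * x / \<rho> (x, y))) (at x)"
           "((\<lambda>y. s (x, y)) has_real_derivative - (2 * y / \<rho> (x, y))) (at y)" for x y
    unfolding s_def using \<rho>pos[of "(x,y)"] by (auto intro!: derivative_eq_intros d\<rho>)
  have dE: "((\<lambda>x. E (x, y)) has_real_derivative Ex (x, y)) (at x)"
           "((\<lambda>y. E (x, y)) has_real_derivative Ey (x, y)) (at y)" for x y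
    unfolding E_def Ex_def Ey_def
    using DERIV_chain2[OF DERIV_sstepI ds(1)] DERIV_chain2[OF DERIV_sstepI ds(2)]
    by (simp_all add: mult.commute)
  have dS: "((\<lambda>x. sstep (s (x, y))) has_real_derivative sstep' (s (x, y)) * - (2 * x / \<rho> (x, y))) (at x)"
           "((\<lambda>y. sstep (s (x, y))) has_real_derivative sstep' (s (x, y)) * - (2 * y / \<rho> (x, y))) (at y)" for x y
    by (rule DERIV_chain2[OF DERIV_sstep ds(1)] DERIV_chain2[OF DERIV_sstep ds(2)])+
  have dq: "((\<lambda>x. - (2 * x / \<rho> (x, y))) has_real_derivative 4 * x\<^sup>2 / (\<rho> (x, y))\<^sup>2 - 2 / \<rho> (x, y)) (at x)"
           "((\<lambda>y. - (2 * y / \<rho> (x, y))) has_real_derivative 4 * y\<^sup>2 / (\<rho> (x, y))\<^sup>2 - 2 / \<rho> (x, y)) (at y)" for x y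
    using DERIV_minus[OF DERIV_divide[OF DERIV_cmult_Id[of 2] d\<rho>(1)[where x=x and y=y] \<rho>ne]]
          DERIV_minus[OF DERIV_divide[OF DERIV_cmult_Id[of 2] d\<rho>(2)[where x=x and y=y] \<rho>ne]]
    by (simp_all add: \<rho>ne power2_eq_square diff_divide_distrib)
  have mul_sq: "u * S + (S' * - q) * - q = q\<^sup>2 * S' + u * S" for u q S S' :: real
    by (simp add: power2_eq_square)
  have dEx: "((\<lambda>x. Ex (x, y)) has_real_derivative Exx (x, y)) (at x)" for x y
  proof -
    from DERIV_mult[OF dq(1)[where x=x and y=y] dS(1)[where x=x and y=y]]
    show ?thesis unfolding Ex_def Exx_def fst_conv snd_conv mul_sq .
  qed
  have dEy: "((\<lambda>y. Ey (x, y)) has_real_derivative Eyy (x, y)) (at y)" for x y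
  proof -
    from DERIV_mult[OF dq(2)[where x=x and y=y] dS(2)[where x=x and y=y]]
    show ?thesis unfolding Ey_def Eyy_def fst_conv snd_conv mul_sq .
  qed
  note dEE = dEx dEy
  have \<delta>\<rho>: "s z \<le> 0" if "\<delta>\<^sup>2 \<le> \<rho> z" for z
    using that \<delta> by (simp add: s_def ln_mono)
  \<comment> \<open>On the boundary of the square \<rho> is at least \<delta>^2, so the test
    function and its gradient vanish there and integration by parts leaves no boundary
    terms.\<close>
  have bdry: "E z = 0" "Ex z = 0" "Ey z = 0" if "\<bar>fst z\<bar> = \<delta> \<or> \<bar>snd z\<bar> = \<delta>" for z
  proof -
    have "\<delta>\<^sup>2 \<le> \<rho> z"
    proof -
      have "\<delta>\<^sup>2 = (fst z)\<^sup>2 \<or> \<delta>\<^sup>2 = (snd z)\<^sup>2" using that by (metis power2_abs)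
      then show ?thesis by (auto simp: \<rho>_def)
    qed
    then show "E z = 0" "Ex z = 0" "Ey z = 0"
      using \<delta>\<rho> by (auto simp: E_def Ex_def Ey_def sstepI_simps sstep_simps)
  qed
  have X: "integral Q (\<lambda>z. V z * Exx z - Vxx z * E z) = 0"
    unfolding Q_def
  proof (rule integral_rect_ftc_x_zero[where f = "\<lambda>z. V z * Ex z - Vx z * E z"])
    fix x y assume xy: "(x, y) \<in> cbox (- \<delta>, - \<delta>) (\<delta>, \<delta>)"
    show "((\<lambda>x. V (x, y) * Ex (x, y) - Vx (x, y) * E (x, y)) has_real_derivative
        V (x, y) * Exx (x, y) - Vxx (x, y) * E (x, y)) (at x)"
      using DERIV_diff[OF DERIV_mult[OF Vx[OF xy[folded Q_def]] dEx[where x=x and y=y]]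
            DERIV_mult[OF Vxx[OF xy[folded Q_def]] dE(1)[where x=x and y=y]]]
      by (simp add: algebra_simps)
  qed (use \<delta> cont cE cc bdry in \<open>auto simp: Q_def intro!: continuous_intros\<close>)
  have Y: "integral Q (\<lambda>z. V z * Eyy z - Vyy z * E z) = 0"
    unfolding Q_def
  proof (rule integral_rect_ftc_y_zero[where f = "\<lambda>z. V z * Ey z - Vy z * E z"])
    fix x y assume xy: "(x, y) \<in> cbox (- \<delta>, - \<delta>) (\<delta>, \<delta>)"
    show "((\<lambda>y. V (x, y) * Ey (x, y) - Vy (x, y) * E (x, y)) has_real_derivative
        V (x, y) * Eyy (x, y) - Vyy (x, y) * E (x, y)) (at y)"
      using DERIV_diff[OF DERIV_mult[OF Vy[OF xy[folded Q_def]] dEy[where x=x and y=y]]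
            DERIV_mult[OF Vyy[OF xy[folded Q_def]] dE(2)[where x=x and y=y]]]
      by (simp add: algebra_simps)
  qed (use \<delta> cont cE cc bdry in \<open>auto simp: Q_def intro!: continuous_intros\<close>)
  define T where "T z = V z * (sstep (s z) * (4 * \<epsilon>\<^sup>2 / (\<rho> z)\<^sup>2))" for z
  have cT: "continuous_on S T" if "S \<subseteq> Q" for S
    unfolding T_def using that cont(1)
    by (intro continuous_intros cc c\<rho>) (auto simp: \<rho>ne intro: continuous_on_subset)
  have T0: "0 \<le> T z" if "z \<in> Q" for z
    using V0[OF that] sstep_bounds by (simp add: T_def)
  have pt: "(V z * Exx z - Vxx z * E z) + (V z * Eyy z - Vyy z * E z) \<le> 17 / \<delta>\<^sup>2 * V z - T z"
    if "z \<in> Q" for z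
  proof -
    have r: "(fst z)\<^sup>2 + (snd z)\<^sup>2 = \<rho> z - \<epsilon>\<^sup>2" by (simp add: \<rho>_def)
    have "Exx z + Eyy z = 4 * ((fst z)\<^sup>2 + (snd z)\<^sup>2) / (\<rho> z)\<^sup>2 * sstep' (s z)
        + (4 * ((fst z)\<^sup>2 + (snd z)\<^sup>2) / (\<rho> z)\<^sup>2 - 4 / \<rho> z) * sstep (s z)"
      by (simp add: Exx_def Eyy_def power_divide power_mult_distrib add_divide_distrib algebra_simps)
    also have "4 * ((fst z)\<^sup>2 + (snd z)\<^sup>2) / (\<rho> z)\<^sup>2 - 4 / \<rho> z = - (4 * \<epsilon>\<^sup>2 / (\<rho> z)\<^sup>2)"
      unfolding r using \<rho>pos[of z] by (simp add: field_simps power2_eq_square)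
    finally have lapE: "Exx z + Eyy z = 4 * ((fst z)\<^sup>2 + (snd z)\<^sup>2) / (\<rho> z)\<^sup>2 * sstep' (s z)
        - (4 * \<epsilon>\<^sup>2 / (\<rho> z)\<^sup>2) * sstep (s z)" by simp
    \<comment> \<open>\<open>sstep'\<close> vanishes unless \<rho> > \<delta>^2 / e. Where it does
      not, the term is at most 6 / \<rho>, and 6 * 2.72 < 17.\<close>
    have "4 * ((fst z)\<^sup>2 + (snd z)\<^sup>2) / (\<rho> z)\<^sup>2 * sstep' (s z) \<le> 17 / \<delta>\<^sup>2"
    proof (cases "s z < 1")
      case True
      then have "ln (\<delta>\<^sup>2) < 1 + ln (\<rho> z)" by (simp add: s_def)
      then have "\<delta>\<^sup>2 < exp (1 + ln (\<rho> z))" using \<delta> by (metis exp_less_mono exp_ln zero_less_power)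
      also have "\<dots> = exp 1 * \<rho> z" using \<rho>pos[of z] by (simp add: exp_add)
      also have "\<dots> \<le> 272 / 100 * \<rho> z" using e_less_272 \<rho>pos[of z] by (intro mult_right_mono) auto
      finally have A: "\<delta>\<^sup>2 \<le> 272 / 100 * \<rho> z" by simp
      have "4 * ((fst z)\<^sup>2 + (snd z)\<^sup>2) / (\<rho> z)\<^sup>2 * sstep' (s z) \<le> 4 * \<rho> z / (\<rho> z)\<^sup>2 * (3 / 2)"
        by (intro mult_mono divide_right_mono) (use sstep'_bounds[of "s z"] \<rho>ge[of z] \<rho>pos[of z] in \<open>auto simp: r\<close>)
      also have "\<dots> = 6 / \<rho> z" using \<rho>pos[of z] by (simp add: power2_eq_square)
      also have "\<dots> \<le> 17 / \<delta>\<^sup>2" using A \<rho>pos[of z] \<delta> by (simp add: divide_simps)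
      finally show ?thesis .
    next
      case False
      then show ?thesis by (simp add: sstep'_simps)
    qed
    then have "Exx z + Eyy z \<le> 17 / \<delta>\<^sup>2 - (4 * \<epsilon>\<^sup>2 / (\<rho> z)\<^sup>2) * sstep (s z)" using lapE by linarith
    then have "V z * (Exx z + Eyy z) \<le> V z * (17 / \<delta>\<^sup>2 - (4 * \<epsilon>\<^sup>2 / (\<rho> z)\<^sup>2) * sstep (s z))"
      using V0[OF that] by (intro mult_left_mono)
    moreover have "0 \<le> (Vxx z + Vyy z) * E z"
      using lap[OF that] sstepI_nonneg by (simp add: E_def)
    ultimately show ?thesis by (simp add: T_def algebra_simps)
  qed
  have iV: "V integrable_on Q" and iT: "T integrable_on Q"
    using cont(1) cT[of Q] by (auto simp: Q_def intro: integrable_continuous)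
  have i17: "(\<lambda>z. 17 / \<delta>\<^sup>2 * V z) integrable_on Q" by (rule integrable_on_mult_right[OF iV])
  have i1: "(\<lambda>z. V z * Exx z - Vxx z * E z) integrable_on Q" "(\<lambda>z. V z * Eyy z - Vyy z * E z) integrable_on Q"
    using cont cE cc unfolding Q_def by (auto intro!: integrable_continuous continuous_intros)
  have "0 = integral Q (\<lambda>z. (V z * Exx z - Vxx z * E z) + (V z * Eyy z - Vyy z * E z))"
    using X Y i1 by (simp add: integral_add)
  also have "\<dots> \<le> integral Q (\<lambda>z. 17 / \<delta>\<^sup>2 * V z - T z)"
    by (intro integral_le integrable_add integrable_diff i1 i17 iT pt)
  also have "\<dots> = 17 / \<delta>\<^sup>2 * integral Q V - integral Q T"
    using i17 iT by (subst integral_diff) auto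
  finally have main: "integral Q T \<le> 17 / \<delta>\<^sup>2 * integral Q V" by simp
  let ?q = "cbox (-\<epsilon>, -\<epsilon>) (\<epsilon>, \<epsilon>)"
  have qQ: "?q \<subseteq> Q" unfolding Q_def by (rule rect_mono) (use \<epsilon> in auto)
  \<comment> \<open>On the inner square \<rho> <= 3 * \<epsilon>^2, so the negative part of the
    Laplacian has density at least 4 / (9 * \<epsilon>^2) there, and mass at least 16 / 9 over the
    area 4 * \<epsilon>^2. The condition \<epsilon> <= \<delta> / 3 ensures that the smoothstep
    equals 1 on it.\<close>
  have "16 / 9 * v = integral ?q (\<lambda>z. v * (4 / (9 * \<epsilon>\<^sup>2)))"
    using \<epsilon> by (simp add: content_Pair field_simps power2_eq_square)
  also have "\<dots> \<le> integral ?q T"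
  proof (rule integral_le)
    show "T integrable_on ?q" using cT[OF qQ] by (rule integrable_continuous)
    fix z assume z: "z \<in> ?q"
    have a: "(fst z)\<^sup>2 \<le> \<epsilon>\<^sup>2" "(snd z)\<^sup>2 \<le> \<epsilon>\<^sup>2"
      using z \<epsilon> by (cases z; auto simp: mem_rect abs_le_square_iff[symmetric])+
    then have r3: "\<rho> z \<le> 3 * \<epsilon>\<^sup>2" by (simp add: \<rho>_def)
    have "3 * \<epsilon>\<^sup>2 \<le> 3 * (\<delta> / 3)\<^sup>2" using \<epsilon> by (intro mult_left_mono power_mono) auto
    then have "3 * \<rho> z \<le> \<delta>\<^sup>2" using r3 by (simp add: power_divide)
    moreover have "exp 1 * \<rho> z \<le> 3 * \<rho> z" using e_less_272 \<rho>pos[of z] by (intro mult_right_mono) auto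
    ultimately have "exp 1 * \<rho> z \<le> \<delta>\<^sup>2" by linarith
    then have "ln (exp 1 * \<rho> z) \<le> ln (\<delta>\<^sup>2)" using \<rho>pos[of z] \<delta> by (subst ln_le_cancel_iff) auto
    then have "1 \<le> s z" using \<rho>pos[of z] by (simp add: s_def ln_mult)
    then have T: "T z = V z * (4 * \<epsilon>\<^sup>2 / (\<rho> z)\<^sup>2)" by (simp add: T_def sstep_simps)
    have "4 / (9 * \<epsilon>\<^sup>2) = 4 * \<epsilon>\<^sup>2 / (3 * \<epsilon>\<^sup>2)\<^sup>2" using \<epsilon> by (simp add: power2_eq_square field_simps)
    also have "\<dots> \<le> 4 * \<epsilon>\<^sup>2 / (\<rho> z)\<^sup>2"
      using r3 \<rho>pos[of z] \<epsilon> by (intro divide_left_mono power_mono) auto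
    finally have "4 / (9 * \<epsilon>\<^sup>2) \<le> 4 * \<epsilon>\<^sup>2 / (\<rho> z)\<^sup>2" .
    then have "V z * (4 / (9 * \<epsilon>\<^sup>2)) \<le> T z"
      unfolding T using V0[of z] z qQ by (intro mult_left_mono) auto
    moreover have "v * (4 / (9 * \<epsilon>\<^sup>2)) \<le> V z * (4 / (9 * \<epsilon>\<^sup>2))"
      using v[OF z] \<epsilon> by (intro mult_right_mono) auto
    ultimately show "v * (4 / (9 * \<epsilon>\<^sup>2)) \<le> T z" by linarith
  qed auto
  also have "\<dots> \<le> integral Q T"
    by (rule integral_subset_le) (use qQ T0 iT cT[OF qQ] in \<open>auto intro: integrable_continuous\<close>)
  finally show ?thesis using main by linarith
qed


text \<open>The regularised inequality, translated, with the inner square shrinking to the centre,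
  so that continuity replaces the lower bound \<open>v\<close> by the central value. The constant 10
  absorbs 17 * 9 / 16.\<close>

lemma submean_rect:
  fixes V :: "real \<times> real \<Rightarrow> real" and x0 y0 :: real
  assumes \<delta>: "0 < \<delta>"
  defines "Q \<equiv> cbox (x0 - \<delta>, y0 - \<delta>) (x0 + \<delta>, y0 + \<delta>)"
  assumes cont: "continuous_on Q V" "continuous_on Q Vx" "continuous_on Q Vy"
      "continuous_on Q Vxx" "continuous_on Q Vyy"
    and Vx: "\<And>x y. (x, y) \<in> Q \<Longrightarrow> ((\<lambda>x. V (x, y)) has_real_derivative Vx (x, y)) (at x)"
    and Vy: "\<And>x y. (x, y) \<in> Q \<Longrightarrow> ((\<lambda>y. V (x, y)) has_real_derivative Vy (x, y)) (at y)"
    and Vxx: "\<And>x y. (x, y) \<in> Q \<Longrightarrow> ((\<lambda>x. Vx (x, y)) has_real_derivative Vxx (x, y)) (at x)"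
    and Vyy: "\<And>x y. (x, y) \<in> Q \<Longrightarrow> ((\<lambda>y. Vy (x, y)) has_real_derivative Vyy (x, y)) (at y)"
    and lap: "\<And>z. z \<in> Q \<Longrightarrow> 0 \<le> Vxx z + Vyy z"
    and V0: "\<And>z. z \<in> Q \<Longrightarrow> 0 \<le> V z"
  shows "\<delta>\<^sup>2 * V (x0, y0) \<le> 10 * integral Q V"
proof -
  let ?Q0 = "cbox (-\<delta>, -\<delta>) (\<delta>, \<delta>)"
  let ?sh = "\<lambda>z. (x0, y0) + z :: real \<times> real"
  have img: "?sh ` ?Q0 = Q"
    using cbox_translation[of "(x0, y0)" "(-\<delta>, -\<delta>)" "(\<delta>, \<delta>)"] by (simp add: Q_def)
  have mem: "(x, y) \<in> ?Q0 \<Longrightarrow> (x0 + x, y0 + y) \<in> Q" for x y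
    by (auto simp: Q_def mem_rect)
  have mem': "z \<in> ?Q0 \<Longrightarrow> ?sh z \<in> Q" for z using img by blast
  have cc: "continuous_on ?Q0 (\<lambda>z. f (?sh z))" if "continuous_on Q f" for f :: "real \<times> real \<Rightarrow> real"
    by (rule continuous_on_compose2[OF that]) (use img in \<open>auto intro!: continuous_intros\<close>)
  have sx: "((\<lambda>x. f (x0 + x, y)) has_real_derivative D) (at x)"
    if "((\<lambda>x. f (x, y)) has_real_derivative D) (at (x0 + x))" for f :: "real \<times> real \<Rightarrow> real" and D x y
    using that DERIV_shift[of "\<lambda>x. f (x, y)" D x x0] unfolding add.commute[of x0] by blast
  have sy: "((\<lambda>y. f (x, y0 + y)) has_real_derivative D) (at y)"
    if "((\<lambda>y. f (x, y)) has_real_derivative D) (at (y0 + y))" for f :: "real \<times> real \<Rightarrow> real" and D x y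
    using that DERIV_shift[of "\<lambda>y. f (x, y)" D y y0] unfolding add.commute[of y0] by blast
  have int: "integral ?Q0 (\<lambda>z. V (?sh z)) = integral Q V"
  proof -
    have "((\<lambda>z. V (?sh z)) has_integral integral Q V) ?Q0"
    proof -
      have "(V has_integral integral Q V) (cbox (x0 - \<delta>, y0 - \<delta>) (x0 + \<delta>, y0 + \<delta>))"
        using cont(1) by (auto simp: Q_def intro: integrable_continuous integrable_integral)
      have shift_eq: "(\<lambda>z. z - (x0, y0)) = (\<lambda>z. z + (- x0, - y0))" by (auto simp: fun_eq_iff prod_eq_iff)
      note \<open>(V has_integral integral Q V) _\<close>
      from has_integral_affinity[OF this, of 1 "(x0, y0)"]
      have "((\<lambda>z. V (z + (x0, y0))) has_integral integral Q V)
         ((\<lambda>z. z - (x0, y0)) ` cbox (x0 - \<delta>, y0 - \<delta>) (x0 + \<delta>, y0 + \<delta>))"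
        unfolding shift_eq by simp
      moreover have "(\<lambda>z. z - (x0, y0)) ` cbox (x0 - \<delta>, y0 - \<delta>) (x0 + \<delta>, y0 + \<delta>) = ?Q0"
      proof -
        have "(\<lambda>z. z - (x0, y0)) ` Q = ?Q0" unfolding img[symmetric] image_image by simp
        then show ?thesis by (simp add: Q_def)
      qed
      ultimately show ?thesis by (simp add: add.commute)
    qed
    then show ?thesis by (rule integral_unique)
  qed
  have "V (x0, y0) - \<eta> \<le> 10 / \<delta>\<^sup>2 * integral Q V" if \<eta>: "\<eta> > 0" for \<eta>
  proof -
    have "(x0, y0) \<in> Q" using \<delta> by (auto simp: Q_def mem_rect)
    then obtain d where d: "d > 0" "\<And>z. z \<in> Q \<Longrightarrow> dist z (x0, y0) < d \<Longrightarrow> dist (V z) (V (x0, y0)) < \<eta>"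
      using cont(1) \<eta> unfolding continuous_on_iff by metis
    define \<epsilon> where "\<epsilon> = min (\<delta> / 3) (d / 3)"
    have \<epsilon>: "0 < \<epsilon>" "\<epsilon> \<le> \<delta> / 3" "3 * \<epsilon> \<le> d" using \<delta> d by (auto simp: \<epsilon>_def)
    have "16 / 9 * (V (x0, y0) - \<eta>) \<le> 17 / \<delta>\<^sup>2 * integral ?Q0 (\<lambda>z. V (?sh z))"
    proof (rule submean_regularised[OF \<delta> \<epsilon>(1,2) cc[OF cont(1)] cc[OF cont(2)] cc[OF cont(3)] cc[OF cont(4)] cc[OF cont(5)]])
      fix z assume z: "z \<in> cbox (-\<epsilon>, -\<epsilon>) (\<epsilon>, \<epsilon>)"
      then have "z \<in> ?Q0" using rect_mono[of "-\<delta>" "-\<epsilon>" \<epsilon> \<delta> "-\<delta>" "-\<epsilon>" \<epsilon> \<delta>] \<epsilon> \<delta> by auto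
      then have "?sh z \<in> Q" by (rule mem')
      moreover have "dist (?sh z) (x0, y0) < d"
      proof -
        have "norm z \<le> \<bar>fst z\<bar> + \<bar>snd z\<bar>" by (metis norm_Pair_le prod.collapse real_norm_def)
        also have "\<dots> \<le> 2 * \<epsilon>" using z by (cases z) (auto simp: mem_rect)
        also have "\<dots> < d" using \<epsilon> by linarith
        finally show ?thesis by (simp add: dist_norm)
      qed
      ultimately have "dist (V (?sh z)) (V (x0, y0)) < \<eta>" by (rule d(2))
      then show "V (x0, y0) - \<eta> \<le> V (?sh z)" by (simp add: dist_real_def)
    qed (use Vx Vy Vxx Vyy lap V0 mem mem' sx sy in auto)
    then have le: "16 / 9 * (V (x0, y0) - \<eta>) \<le> 17 / \<delta>\<^sup>2 * integral Q V" unfolding int .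
    have "0 \<le> integral Q V / \<delta>\<^sup>2"
      by (intro divide_nonneg_nonneg integral_nonneg) (use V0 cont(1) in \<open>auto simp: Q_def intro: integrable_continuous\<close>)
    then show ?thesis using le by simp
  qed
  then have "V (x0, y0) \<le> 10 / \<delta>\<^sup>2 * integral Q V" by (meson field_le_epsilon le_diff_eq diff_le_eq)
  then show ?thesis using \<delta> by (simp add: field_simps)
qed

subsection \<open>Auxiliary functions on the target plane\<close>

text \<open>On the half plane \<open>p \<le> 0\<close> the functions \<open>aV\<close> and \<open>aB\<close> are the real and imaginary part of
  \<open>Ln (1 - p - i q)\<close>. For \<open>p \<ge> 0\<close> they are continued in a \<open>C\<^sup>1\<close> way such that \<open>aB\<close> stays bounded,
  at the price of a defect in the Cauchy--Riemann equations that is supported on \<open>p > 0\<close>.\<close>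

definition aD :: "real \<Rightarrow> real \<Rightarrow> real" where "aD p q = (1 + \<bar>p\<bar>)\<^sup>2 + q\<^sup>2"
definition aV :: "real \<Rightarrow> real \<Rightarrow> real" where "aV p q = ln (aD p q) / 2 - 2 * max 0 p / aD p q"
definition aB :: "real \<Rightarrow> real \<Rightarrow> real" where
  "aB p q = - arctan (q / (1 + \<bar>p\<bar>)) - 2 * max 0 p * q / aD p q"
text \<open>Partial derivatives of \<open>aV\<close> and \<open>aB\<close>. Replacing p by |p| alone
  would reverse the derivative in p across p = 0; the terms with \<open>max 0 p\<close> in
  \<open>aV\<close> and \<open>aB\<close> vanish there and have one-sided slopes -2 /
  \<open>aD\<close> and -2 * q / \<open>aD\<close>, which restores it. Hence a single formula holds
  on both sides.\<close>

definition aVp :: "real \<Rightarrow> real \<Rightarrow> real" where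
  "aVp p q = - (1 + \<bar>p\<bar>) / aD p q + 2 * max 0 p / aD p q + 4 * max 0 p * (1 + max 0 p) / (aD p q)\<^sup>2"
definition aVq :: "real \<Rightarrow> real \<Rightarrow> real" where
  "aVq p q = q / aD p q + 4 * max 0 p * q / (aD p q)\<^sup>2"
definition aBp :: "real \<Rightarrow> real \<Rightarrow> real" where
  "aBp p q = - q / aD p q + 4 * max 0 p * q * (1 + max 0 p) / (aD p q)\<^sup>2"
definition aBq :: "real \<Rightarrow> real \<Rightarrow> real" where
  "aBq p q = - (1 + \<bar>p\<bar>) / aD p q - 2 * max 0 p / aD p q + 4 * max 0 p * q\<^sup>2 / (aD p q)\<^sup>2"

lemma aD_ge: "1 + p\<^sup>2 + q\<^sup>2 \<le> aD p q" and aD_ge1: "1 \<le> aD p q"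
  and aD_le: "aD p q \<le> 2 * (1 + p\<^sup>2 + q\<^sup>2)"
proof -
  define a where "a = \<bar>p\<bar>"
  have "aD p q = 1 + 2 * a + p\<^sup>2 + q\<^sup>2"
    by (simp add: aD_def a_def power2_eq_square algebra_simps)
  moreover have "2 * a \<le> 1 + p\<^sup>2"
    using zero_le_power2[of "a - 1"] by (simp add: a_def power2_diff)
  moreover have "0 \<le> a" "0 \<le> p\<^sup>2" "0 \<le> q\<^sup>2" by (auto simp: a_def)
  moreover note facts = calculation
  show "1 + p\<^sup>2 + q\<^sup>2 \<le> aD p q" using facts by linarith
  have "2 * (1 + p\<^sup>2 + q\<^sup>2) = 2 + 2 * p\<^sup>2 + 2 * q\<^sup>2" by (simp add: algebra_simps)
  then show "aD p q \<le> 2 * (1 + p\<^sup>2 + q\<^sup>2)" using facts by linarith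
  show "1 \<le> aD p q" using facts by linarith
qed

lemma aD_pos: "0 < aD p q" using aD_ge1[of p q] by simp

lemma aD_nz: "aD p q \<noteq> 0" using aD_pos[of p q] by simp

lemma continuous_on_aux:
  assumes "continuous_on S f" "continuous_on S g"
  shows "continuous_on S (\<lambda>z. aV (f z) (g z))" "continuous_on S (\<lambda>z. aB (f z) (g z))"
    "continuous_on S (\<lambda>z. aVp (f z) (g z))" "continuous_on S (\<lambda>z. aVq (f z) (g z))"
    "continuous_on S (\<lambda>z. aBp (f z) (g z))" "continuous_on S (\<lambda>z. aBq (f z) (g z))"
proof -
  have D: "continuous_on S (\<lambda>z. aD (f z) (g z))"
    unfolding aD_def by (intro continuous_intros assms)
  note nz = aD_nz
  have a: "1 + \<bar>f z\<bar> \<noteq> 0" for z using abs_ge_zero[of "f z"] by linarith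
  have pos: "0 < aD (f z) (g z)" for z by (rule aD_pos)
  show "continuous_on S (\<lambda>z. aV (f z) (g z))" unfolding aV_def by (intro continuous_intros assms D ballI nz; simp add: nz)
  show "continuous_on S (\<lambda>z. aB (f z) (g z))" unfolding aB_def by (intro continuous_intros assms D ballI nz a; simp add: nz a)
  show "continuous_on S (\<lambda>z. aVp (f z) (g z))" unfolding aVp_def by (intro continuous_intros assms D ballI nz; simp add: nz)
  show "continuous_on S (\<lambda>z. aVq (f z) (g z))" unfolding aVq_def by (intro continuous_intros assms D ballI nz; simp add: nz)
  show "continuous_on S (\<lambda>z. aBp (f z) (g z))" unfolding aBp_def by (intro continuous_intros assms D ballI nz; simp add: nz)
  show "continuous_on S (\<lambda>z. aBq (f z) (g z))" unfolding aBq_def by (intro continuous_intros assms D ballI nz; simp add: nz)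
qed

text \<open>At a zero of \<open>p\<close> the sign may change infinitely often, so the two formulas
  cannot be assigned to the two sides of the point; the gluing lemma only asks that each nearby
  point obeys one of them.\<close>

lemma has_real_derivative_sign_cases:
  fixes p :: "real \<Rightarrow> real"
  assumes p: "isCont p t"
    and neg: "p t \<le> 0 \<Longrightarrow> (f has_real_derivative D) (at t)"
    and pos: "p t \<ge> 0 \<Longrightarrow> (g has_real_derivative D) (at t)"
    and h: "\<And>s. p s \<le> 0 \<Longrightarrow> h s = f s" "\<And>s. p s \<ge> 0 \<Longrightarrow> h s = g s"
  shows "(h has_real_derivative D) (at t)"
proof -
  have lim: "(p \<longlongrightarrow> p t) (nhds t)" using p by (simp add: continuous_at_imp_continuous_within tendsto_nhds_iff isCont_def)
  consider "p t < 0" | "p t > 0" | "p t = 0" by linarith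
  then show ?thesis
  proof cases
    case 1
    have "\<forall>\<^sub>F s in nhds t. p s < 0" using order_tendstoD(2)[OF lim 1] .
    then have "\<forall>\<^sub>F s in nhds t. h s = f s" by eventually_elim (use h in auto)
    then show ?thesis using neg 1 by (subst DERIV_cong_ev[OF refl _ refl]) auto
  next
    case 2
    have "\<forall>\<^sub>F s in nhds t. p s > 0" using order_tendstoD(1)[OF lim 2] .
    then have "\<forall>\<^sub>F s in nhds t. h s = g s" by eventually_elim (use h in auto)
    then show ?thesis using pos 2 by (subst DERIV_cong_ev[OF refl _ refl]) auto
  next
    case 3
    have ev: "\<forall>\<^sub>F s in at t. h s = f s \<or> h s = g s"
      by (rule always_eventually) (use h in \<open>metis linear\<close>)
    show ?thesis
      by (rule has_real_derivative_glue[OF neg pos _ _ ev]) (use 3 h(1)[of t] h(2)[of t] in auto)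
  qed
qed

lemma DERIV_aV:
  assumes p: "(p has_real_derivative p') (at t)" and q: "(q has_real_derivative q') (at t)"
  shows "((\<lambda>t. aV (p t) (q t)) has_real_derivative aVp (p t) (q t) * p' + aVq (p t) (q t) * q') (at t)"
proof (rule has_real_derivative_sign_cases[where p = p])
  show "isCont p t" using p by (rule DERIV_isCont)
  let ?f = "\<lambda>t. ln ((1 - p t)\<^sup>2 + (q t)\<^sup>2) / 2"
  let ?D = "\<lambda>t. (1 + p t)\<^sup>2 + (q t)\<^sup>2"
  let ?g = "\<lambda>t. ln (?D t) / 2 - 2 * p t / ?D t"
  show "aV (p s) (q s) = ?f s" if "p s \<le> 0" for s using that by (simp add: aV_def aD_def max_def)
  show "aV (p s) (q s) = ?g s" if "p s \<ge> 0" for s using that by (simp add: aV_def aD_def max_def)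
  show "(?f has_real_derivative aVp (p t) (q t) * p' + aVq (p t) (q t) * q') (at t)" if "p t \<le> 0"
  proof -
    have D: "aD (p t) (q t) = (1 - p t)\<^sup>2 + (q t)\<^sup>2" using that by (simp add: aD_def)
    have "(?f has_real_derivative (2 * (1 - p t) * (- p') + 2 * q t * q') / aD (p t) (q t) / 2) (at t)"
    proof -
      have pos: "0 < (1 - p t)\<^sup>2 + (q t)\<^sup>2" using aD_pos[of "p t" "q t"] unfolding D .
      have "((\<lambda>t. (1 - p t)\<^sup>2 + (q t)\<^sup>2) has_real_derivative 2 * (1 - p t) * (- p') + 2 * q t * q') (at t)"
        by (auto intro!: derivative_eq_intros p q simp: power2_eq_square)
      from DERIV_cdivide[OF DERIV_chain2[OF DERIV_ln_divide[OF pos] this], of 2] show ?thesis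
        unfolding D by simp
    qed
    also have "(2 * (1 - p t) * (- p') + 2 * q t * q') / aD (p t) (q t) / 2
      = aVp (p t) (q t) * p' + aVq (p t) (q t) * q'"
      using that aD_pos[of "p t" "q t"] by (simp add: aVp_def aVq_def max_def field_simps)
    finally show ?thesis .
  qed
  show "(?g has_real_derivative aVp (p t) (q t) * p' + aVq (p t) (q t) * q') (at t)" if "p t \<ge> 0"
  proof -
    have D: "aD (p t) (q t) = ?D t" using that by (simp add: aD_def)
    have dD: "(?D has_real_derivative 2 * (1 + p t) * p' + 2 * q t * q') (at t)"
      by (auto intro!: derivative_eq_intros p q simp: power2_eq_square)
    have "(?g has_real_derivative (2 * (1 + p t) * p' + 2 * q t * q') / ?D t / 2
      - (2 * p' * ?D t - 2 * p t * (2 * (1 + p t) * p' + 2 * q t * q')) / (?D t * ?D t)) (at t)"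
    proof -
      have pos: "0 < ?D t" using aD_pos[of "p t" "q t"] unfolding D .
      from DERIV_cdivide[OF DERIV_chain2[OF DERIV_ln_divide[OF pos] dD], of 2]
      have "((\<lambda>t. ln (?D t) / 2) has_real_derivative (2 * (1 + p t) * p' + 2 * q t * q') / ?D t / 2) (at t)"
        by simp
      have ne: "?D t \<noteq> 0" using pos by (metis less_irrefl)
      from DERIV_diff[OF \<open>(_ has_real_derivative _ / ?D t / 2) (at t)\<close> DERIV_divide[OF DERIV_cmult[OF p, of 2] dD ne]]
      show ?thesis .
    qed
    also have "(2 * (1 + p t) * p' + 2 * q t * q') / ?D t / 2
      - (2 * p' * ?D t - 2 * p t * (2 * (1 + p t) * p' + 2 * q t * q')) / (?D t * ?D t)
      = aVp (p t) (q t) * p' + aVq (p t) (q t) * q'"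
    proof -
      have id: "(2 * (1 + P) * p' + 2 * Q * q') / D / 2 - (2 * p' * D - 2 * P * (2 * (1 + P) * p' + 2 * Q * q')) / (D * D)
        = (- (1 + P) / D + 2 * P / D + 4 * P * (1 + P) / D\<^sup>2) * p' + (Q / D + 4 * P * Q / D\<^sup>2) * q'"
        if "D > 0" for P Q D :: real
        using that by (simp add: field_simps power2_eq_square)
      show ?thesis unfolding D[symmetric] by (subst id[OF aD_pos]) (use that in \<open>simp add: aVp_def aVq_def max_def\<close>)
    qed
    finally show ?thesis .
  qed
qed

lemma DERIV_aB:
  assumes p: "(p has_real_derivative p') (at t)" and q: "(q has_real_derivative q') (at t)"
  shows "((\<lambda>t. aB (p t) (q t)) has_real_derivative aBp (p t) (q t) * p' + aBq (p t) (q t) * q') (at t)"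
proof (rule has_real_derivative_sign_cases[where p = p])
  show "isCont p t" using p by (rule DERIV_isCont)
  let ?f = "\<lambda>t. - arctan (q t / (1 - p t))"
  let ?D = "\<lambda>t. (1 + p t)\<^sup>2 + (q t)\<^sup>2"
  let ?g = "\<lambda>t. - arctan (q t / (1 + p t)) - 2 * p t * q t / ?D t"
  show "aB (p s) (q s) = ?f s" if "p s \<le> 0" for s using that by (simp add: aB_def aD_def max_def)
  show "aB (p s) (q s) = ?g s" if "p s \<ge> 0" for s using that by (simp add: aB_def aD_def max_def)
  have atan: "((\<lambda>t. arctan (q t / d t)) has_real_derivative (q' * d t - q t * d') / ((d t)\<^sup>2 + (q t)\<^sup>2)) (at t)"
    if "(d has_real_derivative d') (at t)" "d t > 0" for d d'
  proof -
    have "((\<lambda>t. arctan (q t / d t)) has_real_derivative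
        inverse (1 + (q t / d t)\<^sup>2) * ((q' * d t - q t * d') / (d t * d t))) (at t)"
      by (rule DERIV_chain2[OF DERIV_arctan DERIV_divide[OF q that(1)]]) (use that in simp)
    also have "inverse (1 + (q t / d t)\<^sup>2) * ((q' * d t - q t * d') / (d t * d t)) = (q' * d t - q t * d') / ((d t)\<^sup>2 + (q t)\<^sup>2)"
    proof -
      have "1 + (q t / d t)\<^sup>2 = ((d t)\<^sup>2 + (q t)\<^sup>2) / (d t * d t)"
        using that(2) by (simp add: power_divide add_divide_distrib power2_eq_square)
      then show ?thesis using that(2) by simp
    qed
    finally show ?thesis .
  qed
  show "(?f has_real_derivative aBp (p t) (q t) * p' + aBq (p t) (q t) * q') (at t)" if "p t \<le> 0"
  proof -
    have D: "aD (p t) (q t) = (1 - p t)\<^sup>2 + (q t)\<^sup>2" using that by (simp add: aD_def)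
    have d: "((\<lambda>t. 1 - p t) has_real_derivative - p') (at t)"
      by (auto intro!: derivative_eq_intros p)
    have "(?f has_real_derivative - ((q' * (1 - p t) - q t * (- p')) / aD (p t) (q t))) (at t)"
      unfolding D by (rule DERIV_minus[OF atan[OF d]]) (use that in auto)
    also have "- ((q' * (1 - p t) - q t * (- p')) / aD (p t) (q t))
      = aBp (p t) (q t) * p' + aBq (p t) (q t) * q'"
      using that aD_pos[of "p t" "q t"] by (simp add: aBp_def aBq_def max_def field_simps)
    finally show ?thesis .
  qed
  show "(?g has_real_derivative aBp (p t) (q t) * p' + aBq (p t) (q t) * q') (at t)" if "p t \<ge> 0"
  proof -
    have D: "aD (p t) (q t) = ?D t" using that by (simp add: aD_def)
    have d: "((\<lambda>t. 1 + p t) has_real_derivative p') (at t)"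
      by (auto intro!: derivative_eq_intros p)
    have dD: "(?D has_real_derivative 2 * (1 + p t) * p' + 2 * q t * q') (at t)"
      by (auto intro!: derivative_eq_intros p q simp: power2_eq_square)
    have dn: "((\<lambda>t. 2 * p t * q t) has_real_derivative 2 * (p' * q t + p t * q')) (at t)"
      by (auto intro!: derivative_eq_intros p q simp: algebra_simps)
    have "(?g has_real_derivative - ((q' * (1 + p t) - q t * p') / ?D t)
      - (2 * (p' * q t + p t * q') * ?D t - 2 * p t * q t * (2 * (1 + p t) * p' + 2 * q t * q')) / (?D t * ?D t)) (at t)"
      by (intro DERIV_diff DERIV_minus DERIV_divide[OF dn dD] atan d)
         (use that aD_nz[of "p t" "q t"] D in auto)
    also have "- ((q' * (1 + p t) - q t * p') / ?D t)
      - (2 * (p' * q t + p t * q') * ?D t - 2 * p t * q t * (2 * (1 + p t) * p' + 2 * q t * q')) / (?D t * ?D t)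
      = aBp (p t) (q t) * p' + aBq (p t) (q t) * q'"
    proof -
      have id: "- ((q' * (1 + P) - Q * p') / D)
          - (2 * (p' * Q + P * q') * D - 2 * P * Q * (2 * (1 + P) * p' + 2 * Q * q')) / (D * D)
        = (- Q / D + 4 * P * Q * (1 + P) / D\<^sup>2) * p' + (- (1 + P) / D - 2 * P / D + 4 * P * Q\<^sup>2 / D\<^sup>2) * q'"
        if "D > 0" for P Q D :: real
        using that by (simp add: field_simps power2_eq_square)
      show ?thesis unfolding D[symmetric] by (subst id[OF aD_pos]) (use that in \<open>simp add: aBp_def aBq_def max_def\<close>)
    qed
    finally show ?thesis .
  qed
qed

text \<open>In both combinations the terms without the factor max 0 p cancel, and the other factors
  in the numerators are at most \<open>aD\<close> in size. So the defect vanishes on p <= 0 and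
  decays like 1 / |F|, as the derivative of a logarithm does.\<close>

lemma aux_defect:
  "\<bar>aVp p q - aBq p q\<bar> \<le> 8 * max 0 p / (1 + (p\<^sup>2 + q\<^sup>2))"
  "\<bar>aVq p q + aBp p q\<bar> \<le> 4 * max 0 p / (1 + (p\<^sup>2 + q\<^sup>2))"
proof -
  define P where "P = max 0 p"
  define D where "D = aD p q"
  have P: "0 \<le> P" by (simp add: P_def)
  have Pp: "P * \<bar>p\<bar> = P * P" by (auto simp: P_def max_def)
  have D: "0 < D" using aD_pos by (simp add: D_def)
  have DP: "(1 + P)\<^sup>2 + q\<^sup>2 \<le> D" unfolding D_def aD_def P_def by (auto intro!: power_mono)
  have e1: "aVp p q - aBq p q = 4 * P / D + 4 * P * (1 + P - q\<^sup>2) / D\<^sup>2"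
    by (simp add: aVp_def aBq_def P_def[symmetric] D_def[symmetric] algebra_simps diff_divide_distrib add_divide_distrib)
  have e2: "aVq p q + aBp p q = 4 * P * q * (2 + P) / D\<^sup>2"
    by (simp add: aVq_def aBp_def P_def[symmetric] D_def[symmetric] algebra_simps diff_divide_distrib add_divide_distrib)
  have b1: "\<bar>1 + P - q\<^sup>2\<bar> \<le> D"
  proof -
    have "(1 + P)\<^sup>2 = 1 + P + P + P\<^sup>2" by (simp add: power2_eq_square algebra_simps)
    then show ?thesis using DP P zero_le_power2[of q] zero_le_power2[of P] by linarith
  qed
  have b2: "\<bar>q * (2 + P)\<bar> \<le> D"
  proof -
    have "0 \<le> ((1 + P) - \<bar>q\<bar>)\<^sup>2" by simp
    then have "2 * (\<bar>q\<bar> * (1 + P)) \<le> (1 + P)\<^sup>2 + q\<^sup>2" by (simp add: power2_eq_square algebra_simps)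
    moreover have "\<bar>q\<bar> * (2 + P) \<le> \<bar>q\<bar> * (2 * (1 + P))" using P by (intro mult_left_mono) auto
    moreover have "\<bar>q\<bar> * (2 * (1 + P)) = 2 * (\<bar>q\<bar> * (1 + P))" by simp
    moreover have "\<bar>q * (2 + P)\<bar> = \<bar>q\<bar> * (2 + P)" using P by (simp add: abs_mult)
    ultimately show ?thesis using DP by linarith
  qed
  have "\<bar>4 * P * (1 + P - q\<^sup>2) / D\<^sup>2\<bar> = 4 * P * \<bar>1 + P - q\<^sup>2\<bar> / D\<^sup>2"
    using P D by (simp add: abs_mult)
  also have "\<dots> \<le> 4 * P * D / D\<^sup>2" using P b1 by (intro divide_right_mono mult_left_mono) auto
  also have "\<dots> = 4 * P / D" using D by (simp add: power2_eq_square)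
  finally have "\<bar>4 * P * (1 + P - q\<^sup>2) / D\<^sup>2\<bar> \<le> 4 * P / D" .
  moreover have "8 * P / D = 4 * P / D + 4 * P / D" "0 \<le> 4 * P / D" using P D by simp_all
  ultimately have "\<bar>aVp p q - aBq p q\<bar> \<le> 8 * P / D" unfolding e1 by linarith
  also have "\<dots> \<le> 8 * P / (1 + (p\<^sup>2 + q\<^sup>2))"
    using aD_ge[of p q] P D_def by (intro divide_left_mono mult_pos_pos) (auto simp: add_pos_nonneg add.assoc aD_pos)
  finally show "\<bar>aVp p q - aBq p q\<bar> \<le> 8 * max 0 p / (1 + (p\<^sup>2 + q\<^sup>2))" by (simp add: P_def)
  have "\<bar>aVq p q + aBp p q\<bar> = 4 * P * \<bar>q * (2 + P)\<bar> / D\<^sup>2"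
    unfolding e2 using P D by (simp add: abs_mult)
  also have "\<dots> \<le> 4 * P * D / D\<^sup>2" using P b2 by (intro divide_right_mono mult_left_mono) auto
  also have "\<dots> = 4 * P / D" using D by (simp add: power2_eq_square)
  also have "\<dots> \<le> 4 * P / (1 + (p\<^sup>2 + q\<^sup>2))"
    using aD_ge[of p q] P D_def by (intro divide_left_mono mult_pos_pos) (auto simp: add_pos_nonneg add.assoc aD_pos)
  finally show "\<bar>aVq p q + aBp p q\<bar> \<le> 4 * max 0 p / (1 + (p\<^sup>2 + q\<^sup>2))" by (simp add: P_def)
qed

text \<open>The correction in \<open>aV\<close> is at most 1/2 since 4 * p <= (1 + p)^2, and ln
  \<open>aD\<close> exceeds ln (1 + p^2 + q^2) by at most ln 2. In \<open>aB\<close> the arctangent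
  contributes less than 2 and the correction at most 1.\<close>

lemma aux_size:
  "\<bar>aV p q - ln (1 + (p\<^sup>2 + q\<^sup>2)) / 2\<bar> \<le> 1" "\<bar>aB p q\<bar> \<le> 3"
proof -
  define P where "P = max 0 p"
  define D where "D = aD p q"
  have P: "0 \<le> P" by (simp add: P_def)
  have D: "0 < D" using aD_pos by (simp add: D_def)
  have DP: "(1 + P)\<^sup>2 + q\<^sup>2 \<le> D" unfolding D_def aD_def P_def by (auto intro!: power_mono)
  have P4: "4 * P \<le> D"
    
  proof -
    have "(1 + P)\<^sup>2 = (1 - P)\<^sup>2 + 4 * P" by (simp add: power2_eq_square algebra_simps)
    then show ?thesis using DP zero_le_power2[of "1 - P"] zero_le_power2[of q] by linarith
  qed
  have t: "0 \<le> 2 * P / D" "2 * P / D \<le> 1 / 2" using P D P4 by (simp_all add: field_simps)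
  have pos: "0 < 1 + (p\<^sup>2 + q\<^sup>2)" by (simp add: add_pos_nonneg)
  have l1: "ln (1 + (p\<^sup>2 + q\<^sup>2)) \<le> ln D" using aD_ge[of p q] pos by (intro ln_mono) (auto simp: D_def add.assoc)
  have "ln D \<le> ln (2 * (1 + (p\<^sup>2 + q\<^sup>2)))" using aD_le[of p q] D by (intro ln_mono) (auto simp: D_def add.assoc)
  also have "\<dots> = ln 2 + ln (1 + (p\<^sup>2 + q\<^sup>2))" using pos by (subst ln_mult) auto
  finally have l2: "ln D \<le> ln 2 + ln (1 + (p\<^sup>2 + q\<^sup>2))" .
  have "ln (2::real) \<le> 1" using ln_2_less_1 by simp
  then show "\<bar>aV p q - ln (1 + (p\<^sup>2 + q\<^sup>2)) / 2\<bar> \<le> 1"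
    unfolding aV_def P_def[symmetric] D_def[symmetric] using l1 l2 t by linarith
  have "2 * (P * \<bar>q\<bar>) \<le> D"
    using DP P zero_le_power2[of "P - \<bar>q\<bar>"] by (simp add: power2_eq_square algebra_simps)
  then have "\<bar>2 * P * q / D\<bar> \<le> 1" using D P by (simp add: abs_mult field_simps)
  moreover have "\<bar>arctan (q / (1 + \<bar>p\<bar>))\<bar> < pi / 2" using arctan_bounded[of "q / (1 + \<bar>p\<bar>)"] by linarith
  moreover have "pi / 2 < 2" using pi_less_4 by simp
  ultimately show "\<bar>aB p q\<bar> \<le> 3"
    unfolding aB_def P_def[symmetric] D_def[symmetric] by linarith
qed

subsection \<open>Energy estimates for a holomorphic function on a square\<close>

lemma DERIV_pos_part_power:
  assumes "(f has_real_derivative D) (at t)"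
  shows "((\<lambda>t. (max 0 (f t)) ^ Suc (Suc n)) has_real_derivative of_nat (Suc (Suc n)) * (max 0 (f t)) ^ Suc n * D) (at t)"
proof (rule has_real_derivative_sign_cases[where p = f])
  show "isCont f t" using assms by (rule DERIV_isCont)
  show "((\<lambda>_. 0) has_real_derivative of_nat (Suc (Suc n)) * (max 0 (f t)) ^ Suc n * D) (at t)" if "f t \<le> 0"
    using that by (simp add: max_def)
  show "((\<lambda>t. f t ^ Suc (Suc n)) has_real_derivative of_nat (Suc (Suc n)) * (max 0 (f t)) ^ Suc n * D) (at t)" if "f t \<ge> 0"
    using that DERIV_power[OF assms, of "Suc (Suc n)"] by (simp add: max_def mult_ac)
qed (auto simp: max_def)

abbreviation Q0 :: "(real \<times> real) set" where "Q0 \<equiv> cbox (-1/4, -1/4) (1/4, 1/4)"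

text \<open>\<open>p + i q\<close> is a holomorphic function with derivative \<open>a + i b\<close> and second derivative \<open>c + i d\<close>.\<close>

locale cr_square =
  fixes p q a b c d :: "real \<times> real \<Rightarrow> real"
  assumes px: "\<And>x y. (x, y) \<in> Q0 \<Longrightarrow> ((\<lambda>x. p (x, y)) has_real_derivative a (x, y)) (at x)"
    and py: "\<And>x y. (x, y) \<in> Q0 \<Longrightarrow> ((\<lambda>y. p (x, y)) has_real_derivative - b (x, y)) (at y)"
    and qx: "\<And>x y. (x, y) \<in> Q0 \<Longrightarrow> ((\<lambda>x. q (x, y)) has_real_derivative b (x, y)) (at x)"
    and qy: "\<And>x y. (x, y) \<in> Q0 \<Longrightarrow> ((\<lambda>y. q (x, y)) has_real_derivative a (x, y)) (at y)"
    and ax: "\<And>x y. (x, y) \<in> Q0 \<Longrightarrow> ((\<lambda>x. a (x, y)) has_real_derivative c (x, y)) (at x)"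
    and ay: "\<And>x y. (x, y) \<in> Q0 \<Longrightarrow> ((\<lambda>y. a (x, y)) has_real_derivative - d (x, y)) (at y)"
    and bx: "\<And>x y. (x, y) \<in> Q0 \<Longrightarrow> ((\<lambda>x. b (x, y)) has_real_derivative d (x, y)) (at x)"
    and b_y: "\<And>x y. (x, y) \<in> Q0 \<Longrightarrow> ((\<lambda>y. b (x, y)) has_real_derivative c (x, y)) (at y)"
    and cp: "continuous_on Q0 p" and cq: "continuous_on Q0 q" and ca: "continuous_on Q0 a"
    and cb: "continuous_on Q0 b" and cc: "continuous_on Q0 c" and cd: "continuous_on Q0 d"
begin

text \<open>Write F = p + i q. Then \<open>M1\<close>, \<open>M2\<close> are half the gradient of R
  = |F|^2, and \<open>M1x\<close>, \<open>M2y\<close> half its pure second derivatives. Twelve times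
  \<open>\<kappa>\<close> bounds the Cauchy-Riemann defect of \<open>aV\<close> and
  \<open>aB\<close> composed with F; like the defect it vanishes off p > 0, and it is at most |F'| /
  |F|.\<close>

definition R :: "real \<times> real \<Rightarrow> real" where "R z = (p z)\<^sup>2 + (q z)\<^sup>2"
definition W :: "real \<times> real \<Rightarrow> real" where "W z = ln (1 + R z)"
definition P :: "real \<times> real \<Rightarrow> real" where "P z = max 0 (p z)"
definition \<kappa> :: "real \<times> real \<Rightarrow> real" where "\<kappa> z = P z / (1 + R z) * sqrt ((a z)\<^sup>2 + (b z)\<^sup>2)"
definition M1 :: "real \<times> real \<Rightarrow> real" where "M1 z = p z * a z + q z * b z"
definition M2 :: "real \<times> real \<Rightarrow> real" where "M2 z = - p z * b z + q z * a z"
definition M1x :: "real \<times> real \<Rightarrow> real" where "M1x z = (a z)\<^sup>2 + (b z)\<^sup>2 + p z * c z + q z * d z"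
definition M2y :: "real \<times> real \<Rightarrow> real" where "M2y z = (a z)\<^sup>2 + (b z)\<^sup>2 - p z * c z - q z * d z"

lemma R_nonneg: "0 \<le> R z" and R1_pos: "0 < 1 + R z" and R1_nz: "1 + R z \<noteq> 0" and W_nonneg: "0 \<le> W z"
  and P_nonneg: "0 \<le> P z" and \<kappa>_nonneg: "0 \<le> \<kappa> z" and P_sq_le: "(P z)\<^sup>2 \<le> R z"
proof -
  show R: "0 \<le> R z" by (simp add: R_def)
  then show R1: "0 < 1 + R z" "1 + R z \<noteq> 0" by linarith+
  show "0 \<le> W z" using R by (simp add: W_def)
  show P: "0 \<le> P z" by (simp add: P_def)
  show "0 \<le> \<kappa> z" using P R1 by (simp add: \<kappa>_def)
  show "(P z)\<^sup>2 \<le> R z" by (auto simp: P_def R_def max_def)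
qed

lemma cQ:
  assumes "S \<subseteq> Q0"
  shows "continuous_on S p" "continuous_on S q" "continuous_on S a" "continuous_on S b"
    "continuous_on S c" "continuous_on S d" "continuous_on S R" "continuous_on S W"
    "continuous_on S P" "continuous_on S \<kappa>" "continuous_on S M1" "continuous_on S M2"
    "continuous_on S M1x" "continuous_on S M2y"
proof -
  show c: "continuous_on S p" "continuous_on S q" "continuous_on S a" "continuous_on S b"
    "continuous_on S c" "continuous_on S d"
    using assms cp cq ca cb cc cd by (auto intro: continuous_on_subset)
  show R: "continuous_on S R" unfolding R_def by (intro continuous_intros c)
  show "continuous_on S W" unfolding W_def
    by (intro continuous_intros R) (use R1_pos in \<open>auto simp: R1_nz\<close>)
  show P: "continuous_on S P" unfolding P_def by (intro continuous_intros c)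
  show "continuous_on S \<kappa>" unfolding \<kappa>_def
    by (intro continuous_intros R P c) (use R1_pos in \<open>auto simp: R1_nz\<close>)
  show "continuous_on S M1" "continuous_on S M2" "continuous_on S M1x" "continuous_on S M2y"
    unfolding M1_def M2_def M1x_def M2y_def by (intro continuous_intros c)+
qed

lemma D_R: assumes "(x, y) \<in> Q0"
  shows "((\<lambda>x. R (x, y)) has_real_derivative 2 * M1 (x, y)) (at x)"
    "((\<lambda>y. R (x, y)) has_real_derivative 2 * M2 (x, y)) (at y)"
  unfolding R_def M1_def M2_def
  by (auto intro!: derivative_eq_intros px py qx qy assms simp: algebra_simps)

lemma D_M: assumes "(x, y) \<in> Q0"
  shows "((\<lambda>x. M1 (x, y)) has_real_derivative M1x (x, y)) (at x)"
    "((\<lambda>y. M2 (x, y)) has_real_derivative M2y (x, y)) (at y)"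
  unfolding M1_def M2_def M1x_def M2y_def
  by (auto intro!: derivative_eq_intros px py qx qy ax ay bx b_y assms simp: algebra_simps power2_eq_square)

lemma M_sq: "(M1 z)\<^sup>2 + (M2 z)\<^sup>2 = R z * ((a z)\<^sup>2 + (b z)\<^sup>2)"
  by (simp add: M1_def M2_def R_def power2_eq_square algebra_simps)

lemma M_sum: "M1x z + M2y z = 2 * ((a z)\<^sup>2 + (b z)\<^sup>2)"
  by (simp add: M1x_def M2y_def)

section \<open>Sub-mean value inequalities for ln (1 + |F|^2) and for the positive part of Re
  F\<close>

lemma submean_W:
  assumes "0 < h" "cbox (x0 - h, y0 - h) (x0 + h, y0 + h) \<subseteq> Q0"
  shows "h\<^sup>2 * W (x0, y0) \<le> 10 * integral (cbox (x0 - h, y0 - h) (x0 + h, y0 + h)) W"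
proof (rule submean_rect[OF assms(1), where Vx = "\<lambda>z. 2 * M1 z / (1 + R z)" and Vy = "\<lambda>z. 2 * M2 z / (1 + R z)"
      and Vxx = "\<lambda>z. 2 * M1x z / (1 + R z) - 4 * (M1 z)\<^sup>2 / (1 + R z)\<^sup>2"
      and Vyy = "\<lambda>z. 2 * M2y z / (1 + R z) - 4 * (M2 z)\<^sup>2 / (1 + R z)\<^sup>2"])
  let ?B = "cbox (x0 - h, y0 - h) (x0 + h, y0 + h)"
  note c = cQ[OF assms(2)]
  show "continuous_on ?B W" by (rule c)
  show "continuous_on ?B (\<lambda>z. 2 * M1 z / (1 + R z))"
   "continuous_on ?B (\<lambda>z. 2 * M2 z / (1 + R z))"
   "continuous_on ?B (\<lambda>z. 2 * M1x z / (1 + R z) - 4 * (M1 z)\<^sup>2 / (1 + R z)\<^sup>2)"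
   "continuous_on ?B (\<lambda>z. 2 * M2y z / (1 + R z) - 4 * (M2 z)\<^sup>2 / (1 + R z)\<^sup>2)"
    by (intro continuous_intros c; simp add: R1_nz)+
  fix x y assume "(x, y) \<in> ?B"
  then have z: "(x, y) \<in> Q0" using assms(2) by blast
  have R1: "((\<lambda>x. 1 + R (x, y)) has_real_derivative 2 * M1 (x, y)) (at x)"
    "((\<lambda>y. 1 + R (x, y)) has_real_derivative 2 * M2 (x, y)) (at y)"
    using DERIV_add[OF DERIV_const[of 1] D_R(1)[OF z]] DERIV_add[OF DERIV_const[of 1] D_R(2)[OF z]] by simp_all
  show "((\<lambda>x. W (x, y)) has_real_derivative 2 * M1 (x, y) / (1 + R (x, y))) (at x)"
    "((\<lambda>y. W (x, y)) has_real_derivative 2 * M2 (x, y) / (1 + R (x, y))) (at y)"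
    unfolding W_def
    using DERIV_chain2[OF DERIV_ln_divide[OF R1_pos] R1(1)] DERIV_chain2[OF DERIV_ln_divide[OF R1_pos] R1(2)] by simp_all
  have alg: "(m' * r - m * n) / (r * r) = m' / r - m * n / r\<^sup>2" if "r \<noteq> 0" for m m' n r :: real
    using that by (simp add: power2_eq_square diff_divide_distrib)
  have sq: "2 * m * (2 * m) = 4 * m\<^sup>2" for m :: real by (simp add: power2_eq_square)
  show "((\<lambda>x. 2 * M1 (x, y) / (1 + R (x, y))) has_real_derivative
      2 * M1x (x, y) / (1 + R (x, y)) - 4 * (M1 (x, y))\<^sup>2 / (1 + R (x, y))\<^sup>2) (at x)"
    using DERIV_divide[OF DERIV_cmult[OF D_M(1)[OF z], of 2] R1(1) R1_nz] unfolding alg[OF R1_nz] sq .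
  show "((\<lambda>y. 2 * M2 (x, y) / (1 + R (x, y))) has_real_derivative
      2 * M2y (x, y) / (1 + R (x, y)) - 4 * (M2 (x, y))\<^sup>2 / (1 + R (x, y))\<^sup>2) (at y)"
    using DERIV_divide[OF DERIV_cmult[OF D_M(2)[OF z], of 2] R1(2) R1_nz] unfolding alg[OF R1_nz] sq .
next
  fix z
  define E where "E = (a z)\<^sup>2 + (b z)\<^sup>2"
  have "2 * M1x z / (1 + R z) - 4 * (M1 z)\<^sup>2 / (1 + R z)\<^sup>2 + (2 * M2y z / (1 + R z) - 4 * (M2 z)\<^sup>2 / (1 + R z)\<^sup>2)
    = 2 * (M1x z + M2y z) / (1 + R z) - 4 * ((M1 z)\<^sup>2 + (M2 z)\<^sup>2) / (1 + R z)\<^sup>2"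
    by (simp add: add_divide_distrib algebra_simps)
  \<comment> \<open>The classical identity: the Laplacian of ln (1 + |F|^2) is 4 * |F'|^2 / (1 +
    |F|^2)^2.\<close>
  also have "\<dots> = 4 * E / (1 + R z)\<^sup>2"
  proof -
    have "2 * (2 * E) / r - 4 * ((r - 1) * E) / r\<^sup>2 = 4 * E / r\<^sup>2" if "r > 0" for r
      using that by (simp add: field_simps power2_eq_square)
    from this[OF R1_pos[of z]] show ?thesis
      unfolding M_sum M_sq E_def[symmetric] by simp
  qed
  also have "\<dots> \<ge> 0" by (simp add: E_def)
  finally show "0 \<le> 2 * M1x z / (1 + R z) - 4 * (M1 z)\<^sup>2 / (1 + R z)\<^sup>2 + (2 * M2y z / (1 + R z) - 4 * (M2 z)\<^sup>2 / (1 + R z)\<^sup>2)" .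
  show "0 \<le> W z" by (rule W_nonneg)
qed

text \<open>The positive part of the harmonic function p is subharmonic but not smooth. Its cube is
  of class C^2, with Laplacian 6 * P * |F'|^2, because the terms with the second derivative of F
  cancel.\<close>

lemma submean_P3:
  assumes "0 < h" "cbox (x0 - h, y0 - h) (x0 + h, y0 + h) \<subseteq> Q0"
  shows "h\<^sup>2 * P (x0, y0) ^ 3 \<le> 10 * integral (cbox (x0 - h, y0 - h) (x0 + h, y0 + h)) (\<lambda>z. P z ^ 3)"
proof (rule submean_rect[OF assms(1), where Vx = "\<lambda>z. 3 * (P z)\<^sup>2 * a z" and Vy = "\<lambda>z. 3 * (P z)\<^sup>2 * - b z"
      and Vxx = "\<lambda>z. 6 * P z * (a z)\<^sup>2 + 3 * (P z)\<^sup>2 * c z"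
      and Vyy = "\<lambda>z. 6 * P z * (b z)\<^sup>2 - 3 * (P z)\<^sup>2 * c z"])
  let ?B = "cbox (x0 - h, y0 - h) (x0 + h, y0 + h)"
  note c = cQ[OF assms(2)]
  show "continuous_on ?B (\<lambda>z. P z ^ 3)"
   "continuous_on ?B (\<lambda>z. 3 * (P z)\<^sup>2 * a z)"
   "continuous_on ?B (\<lambda>z. 3 * (P z)\<^sup>2 * - b z)"
   "continuous_on ?B (\<lambda>z. 6 * P z * (a z)\<^sup>2 + 3 * (P z)\<^sup>2 * c z)"
   "continuous_on ?B (\<lambda>z. 6 * P z * (b z)\<^sup>2 - 3 * (P z)\<^sup>2 * c z)"
    by (intro continuous_intros c)+
  fix x y assume "(x, y) \<in> ?B"
  then have z: "(x, y) \<in> Q0" using assms(2) by blast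
  have P2: "((\<lambda>x. (P (x, y))\<^sup>2) has_real_derivative 2 * P (x, y) * a (x, y)) (at x)"
    "((\<lambda>y. (P (x, y))\<^sup>2) has_real_derivative 2 * P (x, y) * - b (x, y)) (at y)"
    using DERIV_pos_part_power[OF px[OF z], of 0] DERIV_pos_part_power[OF py[OF z], of 0]
    by (simp_all add: P_def numeral_2_eq_2)
  show "((\<lambda>x. P (x, y) ^ 3) has_real_derivative 3 * (P (x, y))\<^sup>2 * a (x, y)) (at x)"
    "((\<lambda>y. P (x, y) ^ 3) has_real_derivative 3 * (P (x, y))\<^sup>2 * - b (x, y)) (at y)"
    using DERIV_pos_part_power[OF px[OF z], of 1] DERIV_pos_part_power[OF py[OF z], of 1]
    by (simp_all add: P_def numeral_3_eq_3 numeral_2_eq_2)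
  show "((\<lambda>x. 3 * (P (x, y))\<^sup>2 * a (x, y)) has_real_derivative
      6 * P (x, y) * (a (x, y))\<^sup>2 + 3 * (P (x, y))\<^sup>2 * c (x, y)) (at x)"
    using DERIV_mult[OF DERIV_cmult[OF P2(1), of 3] ax[OF z]]
    by (rule DERIV_cong) (simp add: power2_eq_square)
  show "((\<lambda>y. 3 * (P (x, y))\<^sup>2 * - b (x, y)) has_real_derivative
      6 * P (x, y) * (b (x, y))\<^sup>2 - 3 * (P (x, y))\<^sup>2 * c (x, y)) (at y)"
    using DERIV_mult[OF DERIV_cmult[OF P2(2), of 3] DERIV_minus[OF b_y[OF z]]]
    by (rule DERIV_cong) (simp add: power2_eq_square)
next
  fix z
  have "6 * P z * (a z)\<^sup>2 + 3 * (P z)\<^sup>2 * c z + (6 * P z * (b z)\<^sup>2 - 3 * (P z)\<^sup>2 * c z)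
    = 6 * P z * (a z)\<^sup>2 + 6 * P z * (b z)\<^sup>2" by simp
  also have "\<dots> \<ge> 0" using P_nonneg by simp
  finally show "0 \<le> 6 * P z * (a z)\<^sup>2 + 3 * (P z)\<^sup>2 * c z + (6 * P z * (b z)\<^sup>2 - 3 * (P z)\<^sup>2 * c z)" .
  show "0 \<le> P z ^ 3" using P_nonneg by simp
qed

text \<open>The field Z = P^2 * \<Theta>(R) * grad R / 4 with \<Theta> = (1 + W) / (1 + R)^2 is
  designed to have divergence at least \<open>\<kappa>\<close>^2. The divergence of such a field is
  P^2 * |F'|^2 * (2 * \<Theta> + R * \<Theta>'); for \<Theta> = 1 / (1 + R)^2 the bracket cancels to
  leading order, and the logarithm in 1 + W leaves the required surplus.\<close>

definition Z1 :: "real \<times> real \<Rightarrow> real" where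
  "Z1 z = (P z)\<^sup>2 * ((1 + W z) / (1 + R z)\<^sup>2) * M1 z / 2"
definition Z2 :: "real \<times> real \<Rightarrow> real" where
  "Z2 z = (P z)\<^sup>2 * ((1 + W z) / (1 + R z)\<^sup>2) * M2 z / 2"
definition Z1x :: "real \<times> real \<Rightarrow> real" where
  "Z1x z = (2 * P z * a z * ((1 + W z) / (1 + R z)\<^sup>2) * M1 z
     + (P z)\<^sup>2 * ((- 1 - 2 * W z) / (1 + R z) ^ 3 * (2 * M1 z)) * M1 z
     + (P z)\<^sup>2 * ((1 + W z) / (1 + R z)\<^sup>2) * M1x z) / 2"
definition Z2y :: "real \<times> real \<Rightarrow> real" where
  "Z2y z = (2 * P z * - b z * ((1 + W z) / (1 + R z)\<^sup>2) * M2 z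
     + (P z)\<^sup>2 * ((- 1 - 2 * W z) / (1 + R z) ^ 3 * (2 * M2 z)) * M2 z
     + (P z)\<^sup>2 * ((1 + W z) / (1 + R z)\<^sup>2) * M2y z) / 2"

lemma cZ:
  assumes "S \<subseteq> Q0"
  shows "continuous_on S Z1" "continuous_on S Z2" "continuous_on S Z1x" "continuous_on S Z2y"
  unfolding Z1_def Z2_def Z1x_def Z2y_def
  by (intro continuous_intros cQ[OF assms]; simp add: R1_nz)+

lemma D_Theta:
  assumes "((\<lambda>t. R (f t)) has_real_derivative D) (at t)"
  shows "((\<lambda>t. (1 + W (f t)) / (1 + R (f t))\<^sup>2) has_real_derivative
    (- 1 - 2 * W (f t)) / (1 + R (f t)) ^ 3 * D) (at t)"
proof -
  have R1: "((\<lambda>t. 1 + R (f t)) has_real_derivative D) (at t)"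
    using DERIV_add[OF DERIV_const[of 1] assms] by simp
  have n: "((\<lambda>t. 1 + W (f t)) has_real_derivative 1 / (1 + R (f t)) * D) (at t)"
    unfolding W_def using DERIV_add[OF DERIV_const[of 1] DERIV_chain2[OF DERIV_ln_divide[OF R1_pos] R1]] by simp
  have s: "((\<lambda>t. (1 + R (f t))\<^sup>2) has_real_derivative 2 * (1 + R (f t)) * D) (at t)"
    using DERIV_power[OF R1, of 2] by (simp add: mult_ac)
  have nz: "(1 + R (f t))\<^sup>2 \<noteq> 0" using R1_nz by simp
  have alg: "(1 / r * D * r\<^sup>2 - (1 + w) * (2 * r * D)) / (r\<^sup>2 * r\<^sup>2) = (- 1 - 2 * w) / r ^ 3 * D"
    if "r > 0" for r w :: real
    using that by (simp add: field_simps power2_eq_square power3_eq_cube)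
  show ?thesis using DERIV_divide[OF n s nz] unfolding alg[OF R1_pos] .
qed

lemma D_Z:
  assumes "(x, y) \<in> Q0"
  shows "((\<lambda>x. Z1 (x, y)) has_real_derivative Z1x (x, y)) (at x)"
    "((\<lambda>y. Z2 (x, y)) has_real_derivative Z2y (x, y)) (at y)"
proof -
  have P2: "((\<lambda>x. (P (x, y))\<^sup>2) has_real_derivative 2 * P (x, y) * a (x, y)) (at x)"
    "((\<lambda>y. (P (x, y))\<^sup>2) has_real_derivative 2 * P (x, y) * - b (x, y)) (at y)"
    using DERIV_pos_part_power[OF px[OF assms], of 0] DERIV_pos_part_power[OF py[OF assms], of 0]
    by (simp_all add: P_def numeral_2_eq_2)
  have alg: "((A' * T + T' * A) * m + m' * (A * T)) / 2 = (A' * T * m + A * T' * m + A * T * m') / 2"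
    for A A' T T' m m' :: real by (simp add: algebra_simps)
  show "((\<lambda>x. Z1 (x, y)) has_real_derivative Z1x (x, y)) (at x)"
    unfolding Z1_def Z1x_def
    using DERIV_cdivide[OF DERIV_mult[OF DERIV_mult[OF P2(1) D_Theta[OF D_R(1)[OF assms]]] D_M(1)[OF assms]], of 2]
    unfolding alg .
  show "((\<lambda>y. Z2 (x, y)) has_real_derivative Z2y (x, y)) (at y)"
    unfolding Z2_def Z2y_def
    using DERIV_cdivide[OF DERIV_mult[OF DERIV_mult[OF P2(2) D_Theta[OF D_R(2)[OF assms]]] D_M(2)[OF assms]], of 2]
    unfolding alg .
qed

lemma \<kappa>_sq: "(\<kappa> z)\<^sup>2 = (P z)\<^sup>2 * ((a z)\<^sup>2 + (b z)\<^sup>2) / (1 + R z)\<^sup>2"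
  by (simp add: \<kappa>_def power_mult_distrib power_divide)

lemma div_Z: "(\<kappa> z)\<^sup>2 \<le> Z1x z + Z2y z"
proof -
  define E where "E = (a z)\<^sup>2 + (b z)\<^sup>2"
  define r where "r = 1 + R z"
  have r: "r > 0" using R1_pos by (simp add: r_def)
  have E: "0 \<le> E" by (simp add: E_def)
  have p1: "M1 z * a z - M2 z * b z = p z * E"
    by (simp add: M1_def M2_def E_def power2_eq_square algebra_simps)
  have Pp: "P z * p z = (P z)\<^sup>2" by (auto simp: P_def max_def power2_eq_square)
  have "Z1x z + Z2y z = (2 * P z * ((1 + W z) / r\<^sup>2) * (M1 z * a z - M2 z * b z)
     + (P z)\<^sup>2 * ((- 1 - 2 * W z) / r ^ 3) * 2 * ((M1 z)\<^sup>2 + (M2 z)\<^sup>2)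
     + (P z)\<^sup>2 * ((1 + W z) / r\<^sup>2) * (M1x z + M2y z)) / 2"
    unfolding Z1x_def Z2y_def r_def[symmetric] power2_eq_square[of "M1 z"] power2_eq_square[of "M2 z"]
    by (simp only: distrib_left distrib_right right_diff_distrib add_divide_distrib diff_divide_distrib mult_ac mult_minus_right minus_mult_right[symmetric] mult_minus_left)
  also have "\<dots> = (2 * (P z * p z) * ((1 + W z) / r\<^sup>2) * E
     + (P z)\<^sup>2 * ((- 1 - 2 * W z) / r ^ 3) * 2 * (R z * E)
     + (P z)\<^sup>2 * ((1 + W z) / r\<^sup>2) * (2 * E)) / 2"
    unfolding p1 M_sq M_sum E_def[symmetric] by (simp add: mult_ac)
  also have "\<dots> = (P z)\<^sup>2 * E * (2 * (1 + W z) / r\<^sup>2 + R z * (- 1 - 2 * W z) / r ^ 3)"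
    unfolding Pp by (simp add: algebra_simps)
  also have "2 * (1 + W z) / r\<^sup>2 + R z * (- 1 - 2 * W z) / r ^ 3 = (2 * (1 + W z) * r + R z * (- 1 - 2 * W z)) / r ^ 3"
    using r by (simp add: field_simps power2_eq_square power3_eq_cube)
  \<comment> \<open>The products of W and R cancel, and the surviving R is the gain from
    differentiating the logarithm.\<close>
  also have "2 * (1 + W z) * r + R z * (- 1 - 2 * W z) = 2 * (1 + W z) + R z"
    by (simp add: r_def algebra_simps)
  finally have eq: "Z1x z + Z2y z = (P z)\<^sup>2 * E * ((2 * (1 + W z) + R z) / r ^ 3)" .
  have "1 / r\<^sup>2 = r / r ^ 3" using r by (simp add: power2_eq_square power3_eq_cube)
  also have "\<dots> \<le> (2 * (1 + W z) + R z) / r ^ 3"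
    using r W_nonneg[of z] by (intro divide_right_mono) (auto simp: r_def)
  finally have "1 / r\<^sup>2 \<le> (2 * (1 + W z) + R z) / r ^ 3" .
  then have "(P z)\<^sup>2 * E * (1 / r\<^sup>2) \<le> (P z)\<^sup>2 * E * ((2 * (1 + W z) + R z) / r ^ 3)"
    using E by (intro mult_left_mono) auto
  then show ?thesis unfolding eq \<kappa>_sq E_def r_def by simp
qed

text \<open>One factor P together with |F'| / (1 + R) forms \<open>\<kappa>\<close>; the other one,
  times |F| from the gradient of R, is absorbed by the remaining 1 + R. The bound is linear in
  \<open>\<kappa>\<close>, so that a quadratic term can absorb it later.\<close>

lemma Z_bound: "\<bar>Z1 z\<bar> \<le> (1 + W z) * \<kappa> z / 2" "\<bar>Z2 z\<bar> \<le> (1 + W z) * \<kappa> z / 2"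
proof -
  define e where "e = sqrt ((a z)\<^sup>2 + (b z)\<^sup>2)"
  have e0: "0 \<le> e" by (simp add: e_def)
  have m: "\<bar>M\<bar> \<le> sqrt (R z) * e" if "M\<^sup>2 \<le> R z * ((a z)\<^sup>2 + (b z)\<^sup>2)" for M
    using real_sqrt_le_mono[OF that] by (simp add: real_sqrt_mult e_def)
  have M: "\<bar>M1 z\<bar> \<le> sqrt (R z) * e" "\<bar>M2 z\<bar> \<le> sqrt (R z) * e"
    by (rule m; use M_sq[of z] zero_le_power2[of "M1 z"] zero_le_power2[of "M2 z"] in linarith)+
  have PR: "P z \<le> sqrt (R z)" using real_sqrt_le_mono[OF P_sq_le[of z]] P_nonneg[of z] by simp
  have key: "\<bar>(P z)\<^sup>2 * ((1 + W z) / (1 + R z)\<^sup>2) * M / 2\<bar> \<le> (1 + W z) * \<kappa> z / 2" if "\<bar>M\<bar> \<le> sqrt (R z) * e" for M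
  proof -
    have W0: "0 \<le> 1 + W z" using W_nonneg[of z] by simp
    have r0: "0 \<le> 1 + R z" using R1_pos[of z] by simp
    have "\<bar>(P z)\<^sup>2 * ((1 + W z) / (1 + R z)\<^sup>2) * M / 2\<bar> = (P z)\<^sup>2 * ((1 + W z) / (1 + R z)\<^sup>2) * \<bar>M\<bar> / 2"
      using W0 by (simp add: abs_mult)
    also have "\<dots> \<le> (P z)\<^sup>2 * ((1 + W z) / (1 + R z)\<^sup>2) * (sqrt (R z) * e) / 2"
      using that W0 by (intro divide_right_mono mult_left_mono mult_nonneg_nonneg divide_nonneg_nonneg) auto
    also have "\<dots> = (1 + W z) * (P z / (1 + R z) * e) * (P z * sqrt (R z) / (1 + R z)) / 2"
      by (simp add: power2_eq_square)
    also have "\<dots> \<le> (1 + W z) * (P z / (1 + R z) * e) * 1 / 2"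
    proof (intro divide_right_mono mult_left_mono mult_nonneg_nonneg divide_nonneg_nonneg)
      have "P z * sqrt (R z) \<le> sqrt (R z) * sqrt (R z)" using PR R_nonneg[of z] by (intro mult_right_mono) auto
      then have "P z * sqrt (R z) \<le> 1 + R z" using R_nonneg[of z] by simp
      then show "P z * sqrt (R z) / (1 + R z) \<le> 1" using R1_pos[of z] by simp
    qed (use W0 P_nonneg e0 r0 in auto)
    finally show ?thesis by (simp add: \<kappa>_def e_def)
  qed
  show "\<bar>Z1 z\<bar> \<le> (1 + W z) * \<kappa> z / 2" unfolding Z1_def by (rule key[OF M(1)])
  show "\<bar>Z2 z\<bar> \<le> (1 + W z) * \<kappa> z / 2" unfolding Z2_def by (rule key[OF M(2)])
qed

text \<open>By the sub-mean value property W at a point is bounded by its integral over a box of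
  side 2 * h, and W <= 2 * V + 2 for V = \<open>aV\<close> composed with F. At every height the
  integral of V over the full width 4 * h of the strip is controlled by the approximate conjugate,
  with \<beta> = 3 and defect at most 8 + 4 = 12 times \<open>\<kappa>\<close>.\<close>

lemma strip_bound_x:
  assumes h: "0 < h" and c: "0 < c0" "c0 \<le> l" "l \<le> 1/4" and x1: "-l \<le> x1" "x1 + 4 * h \<le> l"
    and v0: "\<And>y. \<bar>y\<bar> \<le> c0 \<Longrightarrow> aV (p (0, y)) (q (0, y)) \<le> v0"
    and IQ: "integral (cbox (-l, -l) (l, l)) (\<lambda>z. 12 * \<kappa> z) \<le> IQ"
    and IS: "integral (cbox (x1, -l) (x1 + 4 * h, l)) (\<lambda>z. 12 * \<kappa> z) \<le> IS"
    and z0: "x1 + h \<le> x0" "x0 \<le> x1 + 3 * h" "\<bar>y0\<bar> \<le> l - h"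
  shows "W (x0, y0) \<le> 160 * (v0 + (3 * l + IQ / 2) / c0) + (480 * l + 40 * IS) / h + 160"
proof -
  let ?Q = "cbox (-l, -l) (l, l)"
  have QQ: "?Q \<subseteq> Q0" using rect_mono[of "-1/4" "-l" l "1/4" "-1/4" "-l" l "1/4"] c by simp
  define BD where "BD = (x1 + 4 * h - x1) * (v0 + (3 * l + IQ / 2) / c0) + (4 * 3 * l + IS)"
  let ?V = "\<lambda>z. aV (p z) (q z)"
  have defect: "\<bar>s * A + t * B\<bar> \<le> 12 * \<kappa> z"
    if s: "\<bar>s\<bar> \<le> 8 * P z / (1 + R z)" and t: "\<bar>t\<bar> \<le> 4 * P z / (1 + R z)" and AB: "A\<^sup>2 + B\<^sup>2 = (a z)\<^sup>2 + (b z)\<^sup>2" for s t A B z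
  proof -
    define e where "e = sqrt ((a z)\<^sup>2 + (b z)\<^sup>2)"
    have A: "\<bar>A\<bar> \<le> e" unfolding e_def AB[symmetric] by (rule real_le_rsqrt) simp
    have B: "\<bar>B\<bar> \<le> e" unfolding e_def AB[symmetric] by (rule real_le_rsqrt) simp
    have "\<bar>s * A + t * B\<bar> \<le> \<bar>s\<bar> * \<bar>A\<bar> + \<bar>t\<bar> * \<bar>B\<bar>" by (metis abs_mult abs_triangle_ineq)
    also have "\<dots> \<le> 8 * P z / (1 + R z) * e + 4 * P z / (1 + R z) * e"
      using s t A B by (intro add_mono mult_mono) auto
    also have "\<dots> = 12 * \<kappa> z" by (simp add: \<kappa>_def e_def)
    finally show ?thesis .
  qed
  have strip: "integral {x1..x1 + 4 * h} (\<lambda>x. ?V (x, y)) \<le> BD" if "y \<in> {-l..l}" for y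
    unfolding BD_def
  proof (rule conjugate_strip_bound[where V = ?V and B = "\<lambda>z. aB (p z) (q z)"
        and Vx = "\<lambda>z. aVp (p z) (q z) * a z + aVq (p z) (q z) * b z"
        and Vy = "\<lambda>z. aVp (p z) (q z) * - b z + aVq (p z) (q z) * a z"
        and Bx = "\<lambda>z. aBp (p z) (q z) * a z + aBq (p z) (q z) * b z"
        and By = "\<lambda>z. aBp (p z) (q z) * - b z + aBq (p z) (q z) * a z"
        and g = "\<lambda>z. 12 * \<kappa> z" and l = l])
    note cc = cQ[OF QQ] and cA = continuous_on_aux[OF cQ(1,2)[OF QQ]]
    show "continuous_on ?Q ?V" "continuous_on ?Q (\<lambda>z. aB (p z) (q z))"
      "continuous_on ?Q (\<lambda>z. aVp (p z) (q z) * a z + aVq (p z) (q z) * b z)"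
      "continuous_on ?Q (\<lambda>z. aVp (p z) (q z) * - b z + aVq (p z) (q z) * a z)"
      "continuous_on ?Q (\<lambda>z. aBp (p z) (q z) * a z + aBq (p z) (q z) * b z)"
      "continuous_on ?Q (\<lambda>z. aBp (p z) (q z) * - b z + aBq (p z) (q z) * a z)"
      "continuous_on ?Q (\<lambda>z. 12 * \<kappa> z)"
      by (intro continuous_intros cc cA)+
    fix x y assume "(x, y) \<in> ?Q"
    then have z: "(x, y) \<in> Q0" using QQ by blast
    show "((\<lambda>x. ?V (x, y)) has_real_derivative aVp (p (x, y)) (q (x, y)) * a (x, y) + aVq (p (x, y)) (q (x, y)) * b (x, y)) (at x)"
      by (rule DERIV_aV[OF px[OF z] qx[OF z]])
    show "((\<lambda>y. ?V (x, y)) has_real_derivative aVp (p (x, y)) (q (x, y)) * - b (x, y) + aVq (p (x, y)) (q (x, y)) * a (x, y)) (at y)"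
      by (rule DERIV_aV[OF py[OF z] qy[OF z]])
    show "((\<lambda>x. aB (p (x, y)) (q (x, y))) has_real_derivative aBp (p (x, y)) (q (x, y)) * a (x, y) + aBq (p (x, y)) (q (x, y)) * b (x, y)) (at x)"
      by (rule DERIV_aB[OF px[OF z] qx[OF z]])
    show "((\<lambda>y. aB (p (x, y)) (q (x, y))) has_real_derivative aBp (p (x, y)) (q (x, y)) * - b (x, y) + aBq (p (x, y)) (q (x, y)) * a (x, y)) (at y)"
      by (rule DERIV_aB[OF py[OF z] qy[OF z]])
  next
    fix z
    note D = aux_defect[of "p z" "q z", folded R_def P_def]
    show "\<bar>aVp (p z) (q z) * a z + aVq (p z) (q z) * b z - (aBp (p z) (q z) * - b z + aBq (p z) (q z) * a z)\<bar> \<le> 12 * \<kappa> z"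
      using defect[OF D, of "a z" "b z"] by (simp add: algebra_simps)
    show "\<bar>aVp (p z) (q z) * - b z + aVq (p z) (q z) * a z + (aBp (p z) (q z) * a z + aBq (p z) (q z) * b z)\<bar> \<le> 12 * \<kappa> z"
      using defect[OF D, of "- b z" "a z"] by (simp add: algebra_simps)
  qed (use assms that aux_size in auto)
  let ?B = "cbox (x0 - h, y0 - h) (x0 + h, y0 + h)"
  \<comment> \<open>The bound for V concerns only segments across the whole strip. The box is
    therefore widened to \<open>?S\<close> while the integrand is still W >= 0, since V may be
    negative.\<close>
  let ?S = "cbox (x1, y0 - h) (x1 + 4 * h, y0 + h)"
  have sub: "?B \<subseteq> ?S" "?S \<subseteq> Q0" by (rule rect_mono; use z0 c x1 h in auto)+
  have W_le: "W z \<le> 2 * ?V z + 2" for z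
    using aux_size(1)[of "p z" "q z", folded R_def W_def] by (simp add: W_def abs_le_iff)
  have cV: "continuous_on S ?V" if "S \<subseteq> Q0" for S
    by (rule continuous_on_aux[OF cQ(1,2)[OF that]])
  have "integral ?B W \<le> integral ?S W"
    by (rule integral_subset_le) (use sub cQ(8) W_nonneg in \<open>auto intro: integrable_continuous\<close>)
  also have "\<dots> \<le> integral ?S (\<lambda>z. 2 * ?V z + 2)"
    by (intro integral_le integrable_continuous continuous_intros cV cQ(8) sub W_le)
  also have "\<dots> = integral {y0 - h..y0 + h} (\<lambda>y. integral {x1..x1 + 4 * h} (\<lambda>x. 2 * ?V (x, y) + 2))"
    by (rule integral_rect_y) (intro continuous_intros cV sub)
  also have "\<dots> \<le> integral {y0 - h..y0 + h} (\<lambda>y. 2 * BD + 8 * h)"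
  proof (rule integral_le)
    have "continuous_on (cbox (y0 - h) (y0 + h)) (\<lambda>y. integral (cbox x1 (x1 + 4 * h)) (\<lambda>x. 2 * ?V (x, y) + 2))"
    proof (rule integral_continuous_on_param)
      show "continuous_on (cbox (y0 - h) (y0 + h) \<times> cbox x1 (x1 + 4 * h)) (\<lambda>(y, x). 2 * ?V (x, y) + 2)"
        unfolding case_prod_unfold
        by (intro continuous_intros continuous_on_compose2[OF cV[OF sub(2)]]) (auto simp: mem_rect)
    qed
    then show "(\<lambda>y. integral {x1..x1 + 4 * h} (\<lambda>x. 2 * ?V (x, y) + 2)) integrable_on {y0 - h..y0 + h}"
      using integrable_continuous_real by fastforce
    fix y assume "y \<in> {y0 - h..y0 + h}"
    then have y: "y \<in> {-l..l}" using z0 by auto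
    have i: "(\<lambda>x. ?V (x, y)) integrable_on {x1..x1 + 4 * h}"
      by (rule integrable_continuous_real, rule continuous_on_subset[OF continuous_on_slice_x[OF cV[OF QQ] y]])
         (use x1 in auto)
    have "integral {x1..x1 + 4 * h} (\<lambda>x. 2 * ?V (x, y) + 2) = 2 * integral {x1..x1 + 4 * h} (\<lambda>x. ?V (x, y)) + 8 * h"
      using h by (subst integral_add) (auto intro: i integrable_on_mult_right)
    then show "integral {x1..x1 + 4 * h} (\<lambda>x. 2 * ?V (x, y) + 2) \<le> 2 * BD + 8 * h"
      using strip[OF y] by simp
  qed auto
  also have "\<dots> = 2 * h * (2 * BD + 8 * h)" using h by simp
  finally have "h\<^sup>2 * W (x0, y0) \<le> 10 * (2 * h * (2 * BD + 8 * h))"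
    using submean_W[OF h, of x0 y0] sub by (meson order_trans mult_left_mono zero_le_numeral)
  then have "h * (h * W (x0, y0)) \<le> h * (40 * BD + 160 * h)" by (simp add: power2_eq_square algebra_simps)
  then have "h * W (x0, y0) \<le> 40 * BD + 160 * h" using h by simp
  then have "W (x0, y0) \<le> (40 * BD + 160 * h) / h" using h by (simp add: field_simps)
  also have "\<dots> = 160 * (v0 + (3 * l + IQ / 2) / c0) + (480 * l + 40 * IS) / h + 160"
    using h c by (simp add: BD_def field_simps)
  finally show ?thesis .
qed

end

section \<open>Reflection in the diagonal, and energy localised to the set\<close>

lemma has_integral_indicator_cbox:
  assumes "N \<in> lmeasurable"
  shows "((indicat_real N) has_integral measure lebesgue (N \<inter> cbox a b)) (cbox a b)"
proof -
  have "N \<inter> cbox a b \<in> lmeasurable"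
    using assms by (intro fmeasurable_Int_fmeasurable) (auto simp: fmeasurableD)
  then have "((indicat_real (N \<inter> cbox a b)) has_integral measure lebesgue (N \<inter> cbox a b)) UNIV"
    by (simp add: lmeasurable_iff_has_integral)
  also have "indicat_real (N \<inter> cbox a b) = (\<lambda>x. if x \<in> cbox a b then indicat_real N x else 0)"
    by (auto simp: fun_eq_iff indicator_def)
  finally show ?thesis by (simp only: has_integral_restrict_UNIV)
qed

lemma continuous_on_swap:
  fixes f :: "real \<times> real \<Rightarrow> real"
  assumes "continuous_on (cbox (c, a) (d, b)) f"
  shows "continuous_on (cbox (a, c) (b, d)) (\<lambda>z. f (prod.swap z))"
  by (rule continuous_on_compose2[OF assms])
     (auto simp: mem_rect prod.swap_def intro!: continuous_intros)

lemma integral_rect_swap: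
  fixes f :: "real \<times> real \<Rightarrow> real"
  assumes "continuous_on (cbox (c, a) (d, b)) f"
  shows "integral (cbox (a, c) (b, d)) (\<lambda>z. f (prod.swap z)) = integral (cbox (c, a) (d, b)) f"
proof -
  have "integral (cbox (a, c) (b, d)) (\<lambda>z. f (prod.swap z))
      = integral {c..d} (\<lambda>y. integral {a..b} (\<lambda>x. f (y, x)))"
    using integral_rect_y[OF continuous_on_swap[OF assms]] by simp
  also have "\<dots> = integral (cbox (c, a) (d, b)) f"
    by (rule integral_rect_x[OF assms, symmetric])
  finally show ?thesis .
qed

text \<open>Exchanging the coordinates maps z to i times its conjugate, so the conjugate of F
  composed with it is holomorphic again. This turns bounds for vertical strips into bounds for
  horizontal ones: \<open>W\<close> and \<open>\<kappa>\<close> are merely transported, and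
  \<open>aV\<close> is even in its second argument.\<close>

lemma (in cr_square) cr_square_swap:
  "cr_square (\<lambda>z. p (prod.swap z)) (\<lambda>z. - q (prod.swap z)) (\<lambda>z. - b (prod.swap z))
     (\<lambda>z. - a (prod.swap z)) (\<lambda>z. - c (prod.swap z)) (\<lambda>z. d (prod.swap z))"
proof
  have mem: "(y, x) \<in> Q0" if "(x, y) \<in> Q0" for x y using that by (auto simp: mem_rect)
  fix x y assume "(x, y) \<in> Q0"
  note z = mem[OF this]
  show "((\<lambda>x. p (prod.swap (x, y))) has_real_derivative - b (prod.swap (x, y))) (at x)"
    using py[OF z] by simp
  show "((\<lambda>y. p (prod.swap (x, y))) has_real_derivative - (- a (prod.swap (x, y)))) (at y)"
    using px[OF z] by simp
  show "((\<lambda>x. - q (prod.swap (x, y))) has_real_derivative - a (prod.swap (x, y))) (at x)"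
    using DERIV_minus[OF qy[OF z]] by simp
  show "((\<lambda>y. - q (prod.swap (x, y))) has_real_derivative - b (prod.swap (x, y))) (at y)"
    using DERIV_minus[OF qx[OF z]] by simp
  show "((\<lambda>x. - b (prod.swap (x, y))) has_real_derivative - c (prod.swap (x, y))) (at x)"
    using DERIV_minus[OF b_y[OF z]] by simp
  show "((\<lambda>y. - b (prod.swap (x, y))) has_real_derivative - d (prod.swap (x, y))) (at y)"
    using DERIV_minus[OF bx[OF z]] by simp
  show "((\<lambda>x. - a (prod.swap (x, y))) has_real_derivative d (prod.swap (x, y))) (at x)"
    using DERIV_minus[OF ay[OF z]] by simp
  show "((\<lambda>y. - a (prod.swap (x, y))) has_real_derivative - c (prod.swap (x, y))) (at y)"
    using DERIV_minus[OF ax[OF z]] by simp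
qed (intro continuous_intros continuous_on_swap cp cq ca cb cc cd)+

context cr_square
begin

lemma strip_bound_y:
  assumes h: "0 < h" and c: "0 < c0" "c0 \<le> l" "l \<le> 1/4" and y1: "-l \<le> y1" "y1 + 4 * h \<le> l"
    and v0: "\<And>x. \<bar>x\<bar> \<le> c0 \<Longrightarrow> aV (p (x, 0)) (q (x, 0)) \<le> v0"
    and IQ: "integral (cbox (-l, -l) (l, l)) (\<lambda>z. 12 * \<kappa> z) \<le> IQ"
    and IS: "integral (cbox (-l, y1) (l, y1 + 4 * h)) (\<lambda>z. 12 * \<kappa> z) \<le> IS"
    and z0: "y1 + h \<le> y0" "y0 \<le> y1 + 3 * h" "\<bar>x0\<bar> \<le> l - h"
  shows "W (x0, y0) \<le> 160 * (v0 + (3 * l + IQ / 2) / c0) + (480 * l + 40 * IS) / h + 160"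
proof -
  interpret s: cr_square "\<lambda>z. p (prod.swap z)" "\<lambda>z. - q (prod.swap z)" "\<lambda>z. - b (prod.swap z)"
     "\<lambda>z. - a (prod.swap z)" "\<lambda>z. - c (prod.swap z)" "\<lambda>z. d (prod.swap z)"
    by (rule cr_square_swap)
  have R: "s.R z = R (prod.swap z)" for z by (simp add: s.R_def R_def)
  have W: "s.W z = W (prod.swap z)" for z by (simp add: s.W_def W_def R)
  have \<kappa>: "s.\<kappa> z = \<kappa> (prod.swap z)" for z by (simp add: s.\<kappa>_def \<kappa>_def R s.P_def P_def add.commute)
  have aV: "aV s (- t) = aV s t" for s t by (simp add: aV_def aD_def)
  have cont: "continuous_on (cbox (a', b') (c', d')) (\<lambda>z. 12 * \<kappa> z)"
    if "-1/4 \<le> a'" "-1/4 \<le> b'" "c' \<le> 1/4" "d' \<le> 1/4" for a' b' c' d'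
    by (intro continuous_intros cQ rect_mono) (use that in auto)
  have "s.W (y0, x0) \<le> 160 * (v0 + (3 * l + IQ / 2) / c0) + (480 * l + 40 * IS) / h + 160"
  proof (rule s.strip_bound_x[OF h c y1])
    show "integral (cbox (-l, -l) (l, l)) (\<lambda>z. 12 * s.\<kappa> z) \<le> IQ"
      unfolding \<kappa> by (subst integral_rect_swap[where f = "\<lambda>z. 12 * \<kappa> z"]) (use IQ c in \<open>auto intro!: cont\<close>)
    show "integral (cbox (y1, -l) (y1 + 4 * h, l)) (\<lambda>z. 12 * s.\<kappa> z) \<le> IS"
      unfolding \<kappa> by (subst integral_rect_swap[where f = "\<lambda>z. 12 * \<kappa> z"]) (use IS c y1 in \<open>auto intro!: cont\<close>)
  qed (use z0 v0 aV in auto)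
  then show ?thesis by (simp add: W)
qed

text \<open>The divergence of u^2 * Z integrates to zero for a cutoff u that is 1 on the inner
  square. As div Z >= \<open>\<kappa>\<close>^2, the energy is controlled by the term with grad u,
  which lives where both grad u and P are nonzero. So the bound involves only the area of the set in
  the transition frame and the size of W on it.\<close>

lemma caccioppoli:
  assumes t: "0 < t" "0 < \<delta>" "t + \<delta> \<le> 1/4" and b: "0 \<le> B"
    and N: "N \<in> lmeasurable"
    and PN: "\<And>x y. (x, y) \<in> cbox (-(t + \<delta>), -(t + \<delta>)) (t + \<delta>, t + \<delta>) \<Longrightarrow> t \<le> \<bar>x\<bar> \<or> t \<le> \<bar>y\<bar> \<Longrightarrow>
      0 < p (x, y) \<Longrightarrow> (x, y) \<in> N \<and> 1 + W (x, y) \<le> B"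
  shows "integral (cbox (-t, -t) (t, t)) (\<lambda>z. (\<kappa> z)\<^sup>2) \<le> 36 * B\<^sup>2 / \<delta>\<^sup>2 * measure lebesgue N"
proof -
  define T where "T = t + \<delta>"
  let ?Q = "cbox (-T, -T) (T, T)"
  have QQ: "?Q \<subseteq> Q0" by (rule rect_mono) (use t in \<open>auto simp: T_def\<close>)
  define \<phi> where "\<phi> x = sstep ((T - x) / \<delta>) * sstep ((T + x) / \<delta>)" for x
  define \<phi>' where "\<phi>' x = (sstep ((T - x) / \<delta>) * sstep' ((T + x) / \<delta>) - sstep' ((T - x) / \<delta>) * sstep ((T + x) / \<delta>)) / \<delta>" for x
  have d\<phi>: "(\<phi> has_real_derivative \<phi>' x) (at x)" for x
  proof -
    have l1: "((\<lambda>x. (T - x) / \<delta>) has_real_derivative - 1 / \<delta>) (at x)"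
      using t by (auto intro!: derivative_eq_intros)
    have l2: "((\<lambda>x. (T + x) / \<delta>) has_real_derivative 1 / \<delta>) (at x)"
      using t by (auto intro!: derivative_eq_intros)
    show ?thesis
      unfolding \<phi>_def[abs_def] \<phi>'_def
      by (rule DERIV_cong[OF DERIV_mult[OF DERIV_chain2[OF DERIV_sstep l1] DERIV_chain2[OF DERIV_sstep l2]]])
         (simp add: diff_divide_distrib)
  qed
  have \<phi>01: "0 \<le> \<phi> x" "\<phi> x \<le> 1" for x
    using sstep_bounds by (auto simp: \<phi>_def intro: mult_le_one)
  have \<phi>'b: "\<bar>\<phi>' x\<bar> \<le> 3 / \<delta>" for x
  proof -
    have "0 \<le> sstep u * sstep' v \<and> sstep u * sstep' v \<le> 1 * (3 / 2)" for u v
      using sstep_bounds[of u] sstep'_bounds[of v] mult_mono[of "sstep u" 1 "sstep' v" "3 / 2"] by auto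
    from this[of "(T - x) / \<delta>" "(T + x) / \<delta>"] this[of "(T + x) / \<delta>" "(T - x) / \<delta>"]
    have "\<bar>sstep ((T - x) / \<delta>) * sstep' ((T + x) / \<delta>) - sstep' ((T - x) / \<delta>) * sstep ((T + x) / \<delta>)\<bar> \<le> 3"
      by (simp add: mult.commute abs_le_iff)
    then show ?thesis using t by (simp add: \<phi>'_def divide_right_mono)
  qed
  have \<phi>1: "\<phi> x = 1" "\<phi>' x = 0" if "\<bar>x\<bar> \<le> t" for x
  proof -
    have "1 \<le> (T - x) / \<delta>" "1 \<le> (T + x) / \<delta>" using that t by (auto simp: T_def field_simps)
    then show "\<phi> x = 1" "\<phi>' x = 0" by (auto simp: \<phi>_def \<phi>'_def sstep_simps sstep'_simps)
  qed
  have \<phi>0: "\<phi> T = 0" "\<phi> (- T) = 0" by (auto simp: \<phi>_def sstep_simps)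
  have c\<phi>: "continuous_on S (\<lambda>z. \<phi> (f z))" "continuous_on S (\<lambda>z. \<phi>' (f z))" if "continuous_on S f" for S and f :: "real \<times> real \<Rightarrow> real"
    unfolding \<phi>_def \<phi>'_def
    by (intro continuous_intros continuous_on_compose2[OF continuous_on_sstep[of UNIV]] continuous_on_compose2[OF continuous_on_sstep'[of UNIV]] that; use t in simp)+
  define u where "u z = \<phi> (fst z) * \<phi> (snd z)" for z
  define ux where "ux z = \<phi>' (fst z) * \<phi> (snd z)" for z
  define uy where "uy z = \<phi> (fst z) * \<phi>' (snd z)" for z
  have cu: "continuous_on S u" "continuous_on S ux" "continuous_on S uy" for S
    unfolding u_def ux_def uy_def by (intro continuous_intros c\<phi>)+
  have du: "((\<lambda>x. u (x, y)) has_real_derivative ux (x, y)) (at x)" "((\<lambda>y. u (x, y)) has_real_derivative uy (x, y)) (at y)" for x y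
    unfolding u_def ux_def uy_def
    using DERIV_cmult_right[OF d\<phi>[of x], of "\<phi> y"] DERIV_cmult[OF d\<phi>[of y], of "\<phi> x"] by simp_all
  have du2: "((\<lambda>x. (u (x, y))\<^sup>2) has_real_derivative 2 * u (x, y) * ux (x, y)) (at x)"
    "((\<lambda>y. (u (x, y))\<^sup>2) has_real_derivative 2 * u (x, y) * uy (x, y)) (at y)" for x y
    using DERIV_power[OF du(1)[of y x], of 2] DERIV_power[OF du(2)[of x y], of 2] by (simp_all add: mult_ac)
  define FX where "FX z = 2 * u z * ux z * Z1 z + Z1x z * (u z)\<^sup>2" for z
  define FY where "FY z = 2 * u z * uy z * Z2 z + Z2y z * (u z)\<^sup>2" for z
  have cF: "continuous_on ?Q FX" "continuous_on ?Q FY"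
    unfolding FX_def FY_def by (intro continuous_intros cu cZ[OF QQ])+
  have X: "integral ?Q FX = 0"
  proof (rule integral_rect_ftc_x_zero[where f = "\<lambda>z. (u z)\<^sup>2 * Z1 z"])
    fix x y assume "(x, y) \<in> ?Q"
    then have z: "(x, y) \<in> Q0" using QQ by blast
    show "((\<lambda>x. (u (x, y))\<^sup>2 * Z1 (x, y)) has_real_derivative FX (x, y)) (at x)"
      unfolding FX_def by (rule DERIV_mult[OF du2(1) D_Z(1)[OF z]])
  qed (use t cF in \<open>auto simp: T_def[symmetric] u_def \<phi>0\<close>, simp add: T_def)
  have Y: "integral ?Q FY = 0"
  proof (rule integral_rect_ftc_y_zero[where f = "\<lambda>z. (u z)\<^sup>2 * Z2 z"])
    fix x y assume "(x, y) \<in> ?Q"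
    then have z: "(x, y) \<in> Q0" using QQ by blast
    show "((\<lambda>y. (u (x, y))\<^sup>2 * Z2 (x, y)) has_real_derivative FY (x, y)) (at y)"
      unfolding FY_def by (rule DERIV_mult[OF du2(2) D_Z(2)[OF z]])
  qed (use t cF in \<open>auto simp: T_def[symmetric] u_def \<phi>0\<close>, simp add: T_def)
  define C where "C = 18 * B\<^sup>2 / \<delta>\<^sup>2"
  have C: "0 \<le> C" by (simp add: C_def)
  have pt: "(u z)\<^sup>2 * (\<kappa> z)\<^sup>2 / 2 \<le> FX z + FY z + C * indicat_real N z" if zQ: "z \<in> ?Q" for z
  proof -
    have u0: "0 \<le> u z" using \<phi>01 by (simp add: u_def)
    have "(u z)\<^sup>2 * (\<kappa> z)\<^sup>2 \<le> (u z)\<^sup>2 * (Z1x z + Z2y z)" using div_Z by (intro mult_left_mono) auto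
    also have "\<dots> = FX z + FY z - 2 * u z * (ux z * Z1 z + uy z * Z2 z)" by (simp add: FX_def FY_def algebra_simps)
    finally have 1: "(u z)\<^sup>2 * (\<kappa> z)\<^sup>2 \<le> FX z + FY z - 2 * u z * (ux z * Z1 z + uy z * Z2 z)" .
    have 2: "- 2 * u z * (ux z * Z1 z + uy z * Z2 z) \<le> (u z)\<^sup>2 * (\<kappa> z)\<^sup>2 / 2 + C * indicat_real N z"
    proof (cases "0 < p z \<and> (t \<le> \<bar>fst z\<bar> \<or> t \<le> \<bar>snd z\<bar>)")
      case True
      then have zN: "z \<in> N" and W: "1 + W z \<le> B" using PN[of "fst z" "snd z"] zQ by (auto simp: T_def)
      have ub: "\<bar>ux z\<bar> \<le> 3 / \<delta>" "\<bar>uy z\<bar> \<le> 3 / \<delta>"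
      proof -
        have m: "\<bar>r\<bar> * s \<le> 3 / \<delta>" if "\<bar>r\<bar> \<le> 3 / \<delta>" "0 \<le> s" "s \<le> 1" for r s
          using mult_mono[of "\<bar>r\<bar>" "3 / \<delta>" s 1] that t by simp
        show "\<bar>ux z\<bar> \<le> 3 / \<delta>" "\<bar>uy z\<bar> \<le> 3 / \<delta>"
          using m[OF \<phi>'b \<phi>01, of "fst z" "snd z"] m[OF \<phi>'b \<phi>01, of "snd z" "fst z"] \<phi>01
          by (simp_all add: ux_def uy_def abs_mult mult.commute)
      qed
      have Zb: "\<bar>Z1 z\<bar> \<le> B * \<kappa> z / 2" "\<bar>Z2 z\<bar> \<le> B * \<kappa> z / 2"
        using Z_bound[of z] mult_right_mono[OF W \<kappa>_nonneg[of z]] by linarith+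
      have "\<bar>ux z * Z1 z + uy z * Z2 z\<bar> \<le> \<bar>ux z\<bar> * \<bar>Z1 z\<bar> + \<bar>uy z\<bar> * \<bar>Z2 z\<bar>" by (metis abs_mult abs_triangle_ineq)
      also have "\<dots> \<le> 3 / \<delta> * (B * \<kappa> z / 2) + 3 / \<delta> * (B * \<kappa> z / 2)"
        using ub Zb t by (intro add_mono mult_mono) auto
      also have "\<dots> = 3 * B / \<delta> * \<kappa> z" by simp
      finally have "\<bar>ux z * Z1 z + uy z * Z2 z\<bar> \<le> 3 * B / \<delta> * \<kappa> z" .
      then have "- (ux z * Z1 z + uy z * Z2 z) \<le> 3 * B / \<delta> * \<kappa> z" by (simp add: abs_le_iff)
      then have "2 * u z * (- (ux z * Z1 z + uy z * Z2 z)) \<le> 2 * u z * (3 * B / \<delta> * \<kappa> z)"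
        using u0 by (intro mult_left_mono) auto
      moreover have "2 * u z * (3 * B / \<delta> * \<kappa> z) \<le> (u z)\<^sup>2 * (\<kappa> z)\<^sup>2 / 2 + C"
      proof -
        \<comment> \<open>The weights let half of u^2 * \<open>\<kappa>\<close>^2 be absorbed on the
          left; the other term, 2 * (3 * B / \<delta>)^2, is \<open>C\<close>.\<close>
        have amgm: "2 * (s * r) \<le> s\<^sup>2 / 2 + 2 * r\<^sup>2" for s r :: real
          using zero_le_power2[of "s - 2 * r"] by (simp add: power2_eq_square algebra_simps)
        show ?thesis using amgm[of "u z * \<kappa> z" "3 * B / \<delta>"]
          by (simp add: C_def power_mult_distrib power_divide mult_ac)
      qed
      ultimately show ?thesis using zN by (simp add: algebra_simps)
    next
      case False
      have "ux z * Z1 z + uy z * Z2 z = 0"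
      proof (cases "0 < p z")
        case True
        then have "\<bar>fst z\<bar> \<le> t" "\<bar>snd z\<bar> \<le> t" using False by auto
        then show ?thesis by (simp add: ux_def uy_def \<phi>1)
      next
        case False
        then show ?thesis by (simp add: Z1_def Z2_def P_def)
      qed
      then show ?thesis using C by simp
    qed
    show ?thesis using 1 2 by linarith
  qed
  have iN: "(\<lambda>z. C * indicat_real N z) integrable_on ?Q" "integral ?Q (indicat_real N) \<le> measure lebesgue N"
  proof -
    note h = has_integral_indicator_cbox[OF N, of "(-T, -T)" "(T, T)"]
    show "(\<lambda>z. C * indicat_real N z) integrable_on ?Q"
      by (rule integrable_on_mult_right[OF has_integral_integrable[OF h]])
    have "measure lebesgue (N \<inter> ?Q) \<le> measure lebesgue N"
      by (rule measure_mono_fmeasurable) (use N in \<open>auto simp: fmeasurableD\<close>)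
    then show "integral ?Q (indicat_real N) \<le> measure lebesgue N" using h by (simp add: integral_unique)
  qed
  have iF: "FX integrable_on ?Q" "FY integrable_on ?Q" using cF by (auto intro: integrable_continuous)
  have cuk: "continuous_on S (\<lambda>z. (u z)\<^sup>2 * (\<kappa> z)\<^sup>2 / 2)" if "S \<subseteq> Q0" for S
    by (intro continuous_intros cu cQ that) simp
  have sub: "cbox (-t, -t) (t, t) \<subseteq> ?Q" by (rule rect_mono) (use t in \<open>auto simp: T_def\<close>)
  have iu: "(\<lambda>z. (u z)\<^sup>2 * (\<kappa> z)\<^sup>2 / 2) integrable_on cbox (-t, -t) (t, t)"
    "(\<lambda>z. (u z)\<^sup>2 * (\<kappa> z)\<^sup>2 / 2) integrable_on ?Q"
    by (intro integrable_continuous cuk QQ subset_trans[OF sub QQ])+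
  have "integral (cbox (-t, -t) (t, t)) (\<lambda>z. (\<kappa> z)\<^sup>2 / 2) = integral (cbox (-t, -t) (t, t)) (\<lambda>z. (u z)\<^sup>2 * (\<kappa> z)\<^sup>2 / 2)"
    by (rule integral_cong) (auto simp: u_def mem_rect \<phi>1)
  also have "\<dots> \<le> integral ?Q (\<lambda>z. (u z)\<^sup>2 * (\<kappa> z)\<^sup>2 / 2)"
    by (rule integral_subset_le[OF sub iu(1,2)]) auto
  also have "\<dots> \<le> integral ?Q (\<lambda>z. FX z + FY z + C * indicat_real N z)"
    by (intro integral_le iu integrable_add iF iN pt)
  also have "\<dots> = C * integral ?Q (indicat_real N)"
    using iF iN X Y by (simp add: integral_add integrable_add)
  also have "\<dots> \<le> C * measure lebesgue N" using iN(2) C by (intro mult_left_mono)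
  finally show ?thesis by (simp add: C_def)
qed

text \<open>Cauchy-Schwarz on the part of the box in N, off which \<open>\<kappa>\<close> vanishes,
  written with a free weight: 2 * \<open>\<kappa>\<close> <= \<mu> + \<open>\<kappa>\<close>^2 /
  \<mu>. The weight is for balancing area against energy.\<close>

lemma kappa_integral_bound:
  assumes "cbox a' b' \<subseteq> Q0" and N: "N \<in> lmeasurable" and PN: "\<And>z. z \<in> cbox a' b' \<Longrightarrow> 0 < p z \<Longrightarrow> z \<in> N"
    and \<mu>: "0 < \<mu>" and m: "measure lebesgue N \<le> m" and E: "integral (cbox a' b') (\<lambda>z. (\<kappa> z)\<^sup>2) \<le> E"
  shows "integral (cbox a' b') (\<lambda>z. 12 * \<kappa> z) \<le> 6 * (\<mu> * m + E / \<mu>)"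
proof -
  let ?Q = "cbox a' b'"
  note h = has_integral_indicator_cbox[OF N, of a' b']
  have "measure lebesgue (N \<inter> ?Q) \<le> measure lebesgue N"
    by (rule measure_mono_fmeasurable) (use N in \<open>auto simp: fmeasurableD\<close>)
  then have m': "integral ?Q (indicat_real N) \<le> m" using h m by (simp add: integral_unique)
  have i\<kappa>: "(\<lambda>z. 12 * \<kappa> z) integrable_on ?Q" "(\<lambda>z. 6 / \<mu> * (\<kappa> z)\<^sup>2) integrable_on ?Q"
    by (intro integrable_continuous continuous_intros cQ assms(1))+
  have iN: "(\<lambda>z. 6 * \<mu> * indicat_real N z) integrable_on ?Q"
    by (rule integrable_on_mult_right[OF has_integral_integrable[OF h]])
  have "integral ?Q (\<lambda>z. 12 * \<kappa> z) \<le> integral ?Q (\<lambda>z. 6 * \<mu> * indicat_real N z + 6 / \<mu> * (\<kappa> z)\<^sup>2)"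
  proof (rule integral_le)
    fix z assume z: "z \<in> ?Q"
    show "12 * \<kappa> z \<le> 6 * \<mu> * indicat_real N z + 6 / \<mu> * (\<kappa> z)\<^sup>2"
    proof (cases "0 < p z")
      case True
      have "0 \<le> (\<mu> - \<kappa> z)\<^sup>2" by simp
      then have "2 * (\<kappa> z * \<mu>) \<le> \<mu> * \<mu> + (\<kappa> z)\<^sup>2" by (simp add: power2_eq_square algebra_simps)
      then have "2 * \<kappa> z \<le> \<mu> + (\<kappa> z)\<^sup>2 / \<mu>" using \<mu> by (simp add: field_simps)
      then show ?thesis using PN[OF z True] by simp
    next
      case False
      then show ?thesis using \<mu> by (simp add: \<kappa>_def P_def max_def)
    qed
  qed (use i\<kappa> iN in \<open>auto intro: integrable_add\<close>)
  also have "\<dots> = 6 * \<mu> * integral ?Q (indicat_real N) + 6 / \<mu> * integral ?Q (\<lambda>z. (\<kappa> z)\<^sup>2)"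
    using iN i\<kappa>(2) by (subst integral_add) auto
  also have "\<dots> \<le> 6 * \<mu> * m + 6 / \<mu> * E"
    using m' E \<mu> by (intro add_mono mult_left_mono) auto
  finally show ?thesis by (simp add: algebra_simps)
qed

end

section \<open>Square annuli and a single step of growth\<close>

definition cross_strip :: "real \<Rightarrow> real \<Rightarrow> (real \<times> real) set" where
  "cross_strip h r = {z. \<bar>fst z\<bar> \<in> {r - 2 * h..r + 2 * h} \<or> \<bar>snd z\<bar> \<in> {r - 2 * h..r + 2 * h}}"

definition square_annulus :: "real \<Rightarrow> real \<Rightarrow> (real \<times> real) set" where
  "square_annulus h r = {z. \<bar>fst z\<bar> \<le> r + h \<and> \<bar>snd z\<bar> \<le> r + h \<and> (r - h \<le> \<bar>fst z\<bar> \<or> r - h \<le> \<bar>snd z\<bar>)}"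

definition square_frontier :: "real \<Rightarrow> (real \<times> real) set" where
  "square_frontier r = {z. max \<bar>fst z\<bar> \<bar>snd z\<bar> = r}"

lemma square_frontier_subset_annulus: "0 \<le> h \<Longrightarrow> square_frontier r \<subseteq> square_annulus h r"
  by (auto simp: square_frontier_def square_annulus_def max_def split: if_splits)

lemma cross_strip_lmeasurable:
  assumes "S \<in> lmeasurable" shows "S \<inter> cross_strip h r \<in> lmeasurable"
proof -
  have "closed (cross_strip h r)"
    unfolding cross_strip_def atLeastAtMost_iff
    by (intro closed_Collect_disj closed_Collect_conj closed_Collect_le continuous_intros)
  then show ?thesis using assms by (intro fmeasurable_Int_fmeasurable) auto
qed

context cr_square
begin

text \<open>The frame at r is the transition zone of the Caccioppoli inequality, so the energy
  inside is at most 9 * B^2 / k^2, without h, because the area h^2 / k^2 cancels the squared slope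
  of the cutoff. This energy feeds the strip bounds along the four sides of the smaller frame at r',
  and for large k the coefficient of B falls below 1/4.\<close>

lemma annulus_step:
  assumes h: "0 < h" and r': "1/8 \<le> r' - 2 * h" "r' + 2 * h \<le> r - h" and r: "r + h \<le> 1/4"
    and S: "S \<in> lmeasurable" "measure lebesgue S \<le> 1" and pS: "\<And>z. z \<in> Q0 \<Longrightarrow> 0 < p z \<Longrightarrow> z \<in> S"
    and k: "10 ^ 6 \<le> k"
    and thin: "measure lebesgue (S \<inter> cross_strip h r) \<le> h\<^sup>2 / k\<^sup>2"
    and thin': "measure lebesgue (S \<inter> cross_strip h r') \<le> h\<^sup>2 / k\<^sup>2"
    and B: "1 \<le> B" "\<And>z. z \<in> square_annulus h r \<Longrightarrow> 1 + W z \<le> B"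
    and v0: "\<And>t. \<bar>t\<bar> \<le> 1/16 \<Longrightarrow> aV (p (0, t)) (q (0, t)) \<le> v0" "\<And>t. \<bar>t\<bar> \<le> 1/16 \<Longrightarrow> aV (p (t, 0)) (q (t, 0)) \<le> v0"
    and z: "z \<in> square_annulus h r'"
  shows "1 + W z \<le> 160 * v0 + 2081 + 120 / h + B / 4"
proof -
  define l where "l = r' + 2 * h"
  have l: "1/16 \<le> l" "l \<le> 1/4" using h r' r by (auto simp: l_def)
  have kpos: "0 < k" using k by simp
  define E where "E = 9 * B\<^sup>2 / k\<^sup>2"
  let ?Qr = "cbox (-(r - h), -(r - h)) (r - h, r - h)"
  let ?Ql = "cbox (-l, -l) (l, l)"
  have QlQr: "?Ql \<subseteq> ?Qr" by (rule rect_mono) (use r' in \<open>auto simp: l_def\<close>)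
  have QrQ0: "?Qr \<subseteq> Q0" by (rule rect_mono) (use r h in auto)
  have Er: "integral ?Qr (\<lambda>z. (\<kappa> z)\<^sup>2) \<le> E"
  proof -
    have "integral ?Qr (\<lambda>z. (\<kappa> z)\<^sup>2) \<le> 36 * B\<^sup>2 / (2 * h)\<^sup>2 * measure lebesgue (S \<inter> cross_strip h r)"
    proof (rule caccioppoli)
      fix x y assume xy: "(x, y) \<in> cbox (- (r - h + 2 * h), - (r - h + 2 * h)) (r - h + 2 * h, r - h + 2 * h)"
        "r - h \<le> \<bar>x\<bar> \<or> r - h \<le> \<bar>y\<bar>" "0 < p (x, y)"
      then have "(x, y) \<in> square_annulus h r" by (auto simp: square_annulus_def mem_rect)
      moreover have "(x, y) \<in> cross_strip h r" using xy h by (auto simp: cross_strip_def mem_rect)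
      moreover have "(x, y) \<in> Q0" using xy r by (auto simp: mem_rect)
      ultimately show "(x, y) \<in> S \<inter> cross_strip h r \<and> 1 + W (x, y) \<le> B" using pS xy B by auto
    qed (use h r r' B S in \<open>auto intro: cross_strip_lmeasurable\<close>)
    also have "\<dots> \<le> 36 * B\<^sup>2 / (2 * h)\<^sup>2 * (h\<^sup>2 / k\<^sup>2)" using thin by (intro mult_left_mono) auto
    also have "\<dots> = E" using h by (simp add: E_def power_mult_distrib)
    finally show ?thesis .
  qed
  have E: "integral R' (\<lambda>z. (\<kappa> z)\<^sup>2) \<le> E" if "R' = cbox a' b'" "R' \<subseteq> ?Ql" for R' a' b'
  proof -
    have "R' \<subseteq> Q0" "R' \<subseteq> ?Qr" using that QlQr QrQ0 by auto
    then have "integral R' (\<lambda>z. (\<kappa> z)\<^sup>2) \<le> integral ?Qr (\<lambda>z. (\<kappa> z)\<^sup>2)"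
      unfolding that(1) using QrQ0
      by (intro integral_subset_le) (auto intro!: integrable_continuous continuous_intros cQ)
    then show ?thesis using Er by simp
  qed
  have inS: "z \<in> S" if "z \<in> ?Ql" "0 < p z" for z
    using pS[of z] that QlQr QrQ0 by blast
  define IQ where "IQ = 36 * B / k"
  define IS where "IS = 36 * B * h / k\<^sup>2"
  have IQ: "integral ?Ql (\<lambda>z. 12 * \<kappa> z) \<le> IQ"
  proof -
    \<comment> \<open>The weight 3 * B / k makes both terms equal, for area at most 1 and energy 9 *
      B^2 / k^2.\<close>
    have "integral ?Ql (\<lambda>z. 12 * \<kappa> z) \<le> 6 * (3 * B / k * 1 + E / (3 * B / k))"
      by (rule kappa_integral_bound[OF _ S(1)]) (use QlQr QrQ0 inS S B kpos E[OF refl] in auto)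
    also have "\<dots> = IQ" using B kpos by (simp add: IQ_def E_def power2_eq_square field_simps)
    finally show ?thesis .
  qed
  \<comment> \<open>Here the small area is used a second time: with weight 3 * B / h both terms
    equal 3 * B * h / k^2, so that after division by h no factor 1 / h multiplies B. Thinness is
    required of the strips in their full length, because the sweep runs along them from near a
    coordinate axis up to the corners.\<close>
  have IS: "integral (cbox a' b') (\<lambda>z. 12 * \<kappa> z) \<le> IS"
    if "cbox a' b' \<subseteq> ?Ql" "cbox a' b' \<subseteq> cross_strip h r'" for a' b'
  proof -
    have "integral (cbox a' b') (\<lambda>z. 12 * \<kappa> z) \<le> 6 * (3 * B / h * (h\<^sup>2 / k\<^sup>2) + E / (3 * B / h))"
    proof (rule kappa_integral_bound[OF _ cross_strip_lmeasurable[OF S(1)] _ _ thin'])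
      show "cbox a' b' \<subseteq> Q0" using that(1) QlQr QrQ0 by blast
      show "z \<in> S \<inter> cross_strip h r'" if "z \<in> cbox a' b'" "0 < p z" for z
        using that inS \<open>cbox a' b' \<subseteq> ?Ql\<close> \<open>cbox a' b' \<subseteq> cross_strip h r'\<close> by blast
      show "integral (cbox a' b') (\<lambda>z. (\<kappa> z)\<^sup>2) \<le> E" by (rule E[OF refl that(1)])
    qed (use B h in auto)
    also have "\<dots> = IS" using B h kpos by (simp add: IS_def E_def power2_eq_square field_simps)
    finally show ?thesis .
  qed
  have W: "W z \<le> 160 * (v0 + (3 * l + IQ / 2) / (1/16)) + (480 * l + 40 * IS) / h + 160"
  proof -
    obtain x y where xy: "z = (x, y)" by (cases z)
    have b: "\<bar>x\<bar> \<le> l - h" "\<bar>y\<bar> \<le> l - h" using z by (auto simp: xy square_annulus_def l_def)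
    have sx: "cbox (x1, -l) (x1 + 4 * h, l) \<subseteq> ?Ql" "cbox (x1, -l) (x1 + 4 * h, l) \<subseteq> cross_strip h r'"
      "cbox (-l, x1) (l, x1 + 4 * h) \<subseteq> ?Ql" "cbox (-l, x1) (l, x1 + 4 * h) \<subseteq> cross_strip h r'"
      if "x1 = r' - 2 * h \<or> x1 = - r' - 2 * h" for x1
    proof -
      show "cbox (x1, -l) (x1 + 4 * h, l) \<subseteq> ?Ql" "cbox (-l, x1) (l, x1 + 4 * h) \<subseteq> ?Ql"
        by (rule rect_mono; use that r' h in \<open>auto simp: l_def\<close>)+
      show "cbox (x1, -l) (x1 + 4 * h, l) \<subseteq> cross_strip h r'" "cbox (-l, x1) (l, x1 + 4 * h) \<subseteq> cross_strip h r'"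
        using that h r' by (auto simp: cross_strip_def cbox_Pair_eq)
    qed
    let ?b = "160 * (v0 + (3 * l + IQ / 2) / (1/16)) + (480 * l + 40 * IS) / h + 160"
    have X: "W (x, y) \<le> ?b" if "x1 = r' - 2 * h \<or> x1 = - r' - 2 * h" "x1 + h \<le> x" "x \<le> x1 + 3 * h" for x1
    proof (rule strip_bound_x[OF h])
      show "integral (cbox (x1, - l) (x1 + 4 * h, l)) (\<lambda>z. 12 * \<kappa> z) \<le> IS"
        by (rule IS) (rule sx[OF that(1)])+
      show "integral ?Ql (\<lambda>z. 12 * \<kappa> z) \<le> IQ" by (rule IQ)
    qed (use that l b r' h v0(1) in \<open>auto simp: l_def\<close>)
    have Y: "W (x, y) \<le> ?b" if "x1 = r' - 2 * h \<or> x1 = - r' - 2 * h" "x1 + h \<le> y" "y \<le> x1 + 3 * h" for x1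
    proof (rule strip_bound_y[OF h])
      show "integral (cbox (- l, x1) (l, x1 + 4 * h)) (\<lambda>z. 12 * \<kappa> z) \<le> IS"
        by (rule IS) (rule sx[OF that(1)])+
      show "integral ?Ql (\<lambda>z. 12 * \<kappa> z) \<le> IQ" by (rule IQ)
    qed (use that l b r' h v0(2) in \<open>auto simp: l_def\<close>)
    have "r' - h \<le> x \<or> x \<le> - (r' - h) \<or> r' - h \<le> y \<or> y \<le> - (r' - h)"
      using z by (auto simp: xy square_annulus_def)
    then show ?thesis unfolding xy
      using X[of "r' - 2 * h"] X[of "- r' - 2 * h"] Y[of "r' - 2 * h"] Y[of "- r' - 2 * h"] b
      by (auto simp: l_def)
  qed
  have 1: "480 * l / h \<le> 120 / h" using l h by (intro divide_right_mono) auto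
  have 2: "40 * IS / h = 1440 * B / k\<^sup>2" using h by (simp add: IS_def)
  have "1280 * IQ = 46080 * B / k" by (simp add: IQ_def)
  also have "\<dots> \<le> 46080 * B / 10 ^ 6" using k kpos B by (intro divide_left_mono) auto
  finally have 3: "1280 * IQ \<le> 46080 * B / 10 ^ 6" .
  have "(10 ^ 6)\<^sup>2 \<le> k\<^sup>2" using k by (intro power_mono) auto
  then have 4: "1440 * B / k\<^sup>2 \<le> 1440 * B / (10 ^ 6)\<^sup>2" using B by (intro divide_left_mono) (auto intro: mult_pos_pos kpos)
  have "W z \<le> 160 * v0 + 7680 * l + 1280 * IQ + 480 * l / h + 40 * IS / h + 160"
    using W by (simp add: add_divide_distrib algebra_simps)
  then show ?thesis using 1 2 3 4 l B by simp
qed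

text \<open>If p stayed below L * p z near z, the cube of its positive part would be at most (L * p
  z)^3 on a set of area at most h^2 / k^2 and zero elsewhere in the box around z. The sub-mean value
  inequality would bound the cube of p z by 10 * L^3 / k^2 < 1 times itself.\<close>

lemma growth_step:
  assumes h: "0 < h" and r: "0 < r" "r + h \<le> 1/4"
    and S: "S \<in> lmeasurable" and pS: "\<And>z. z \<in> Q0 \<Longrightarrow> 0 < p z \<Longrightarrow> z \<in> S"
    and L: "0 < L" "10 * L ^ 3 < k\<^sup>2"
    and thin: "measure lebesgue (S \<inter> cross_strip h r) \<le> h\<^sup>2 / k\<^sup>2"
    and z: "z \<in> square_frontier r" "0 < p z"
  shows "\<exists>z'. \<bar>fst z'\<bar> \<le> r + h \<and> \<bar>snd z'\<bar> \<le> r + h \<and> L * p z \<le> p z'"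
proof (rule ccontr)
  assume "\<not> ?thesis"
  then have lt: "p z' < L * p z" if "\<bar>fst z'\<bar> \<le> r + h" "\<bar>snd z'\<bar> \<le> r + h" for z'
    using that by force
  obtain x y where xy: "z = (x, y)" by (cases z)
  have xyr: "\<bar>x\<bar> \<le> r" "\<bar>y\<bar> \<le> r" "\<bar>x\<bar> = r \<or> \<bar>y\<bar> = r"
    using z by (auto simp: xy square_frontier_def max_def split: if_splits)
  let ?B = "cbox (x - h, y - h) (x + h, y + h)"
  have BQ: "?B \<subseteq> Q0" by (rule rect_mono) (use xyr r in auto)
  have Bs: "?B \<subseteq> cross_strip h r" using xyr h by (auto simp: cross_strip_def cbox_Pair_eq)
  define N where "N = S \<inter> cross_strip h r"
  have N: "N \<in> lmeasurable" unfolding N_def by (rule cross_strip_lmeasurable[OF S])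
  define Y where "Y = (L * p z) ^ 3"
  have Y: "0 < Y" using L z by (simp add: Y_def)
  note hi = has_integral_indicator_cbox[OF N, of "(x - h, y - h)" "(x + h, y + h)"]
  have "integral ?B (\<lambda>z. P z ^ 3) \<le> integral ?B (\<lambda>z. Y * indicat_real N z)"
  proof (rule integral_le)
    show "(\<lambda>z. P z ^ 3) integrable_on ?B" by (intro integrable_continuous continuous_intros cQ BQ)
    show "(\<lambda>z. Y * indicat_real N z) integrable_on ?B"
      by (rule integrable_on_mult_right[OF has_integral_integrable[OF hi]])
    fix w assume w: "w \<in> ?B"
    show "P w ^ 3 \<le> Y * indicat_real N w"
    proof (cases "0 < p w")
      case True
      moreover have "w \<in> Q0" "w \<in> cross_strip h r" using w BQ Bs by blast+
      ultimately have "w \<in> N" using pS[of w] by (simp add: N_def)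
      have "p w \<le> L * p z"
      proof -
        have "\<bar>fst w\<bar> \<le> r + h" "\<bar>snd w\<bar> \<le> r + h" using w xyr(1,2) by (cases w; auto simp: mem_rect)+
        then show ?thesis by (rule less_imp_le[OF lt])
      qed
      then have "P w ^ 3 \<le> Y" unfolding Y_def using True by (intro power_mono) (auto simp: P_def max_def)
      then show ?thesis using \<open>w \<in> N\<close> by simp
    next
      case False
      then show ?thesis using Y by (simp add: P_def max_def)
    qed
  qed
  also have "\<dots> = Y * measure lebesgue (N \<inter> ?B)" using integral_unique[OF hi] by simp
  also have "\<dots> \<le> Y * (h\<^sup>2 / k\<^sup>2)"
  proof -
    have "measure lebesgue (N \<inter> ?B) \<le> measure lebesgue N"
      by (rule measure_mono_fmeasurable) (use N in \<open>auto simp: fmeasurableD\<close>)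
    then show ?thesis using thin Y by (intro mult_left_mono) (auto simp: N_def)
  qed
  finally have "h\<^sup>2 * P (x, y) ^ 3 \<le> 10 * (Y * (h\<^sup>2 / k\<^sup>2))" using submean_P3[OF h BQ] by linarith
  then have "h\<^sup>2 * (p z) ^ 3 \<le> h\<^sup>2 * (10 * L ^ 3 / k\<^sup>2 * (p z) ^ 3)"
    using z by (simp add: xy Y_def P_def max_def power_mult_distrib mult_ac)
  then have "(p z) ^ 3 \<le> 10 * L ^ 3 / k\<^sup>2 * (p z) ^ 3"
    by (rule mult_left_le_imp_le) (use h in simp)
  moreover have "10 * L ^ 3 / k\<^sup>2 < 1" using L by (simp add: divide_less_eq)
  then have "10 * L ^ 3 / k\<^sup>2 * (p z) ^ 3 < 1 * (p z) ^ 3" using z by (intro mult_strict_right_mono) auto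
  ultimately show False by simp
qed

end

section \<open>Counting thin annuli and iterating the steps\<close>

lemma sum_measure_disjoint_le:
  assumes S: "S \<in> lmeasurable" and fin: "finite I"
    and m: "\<And>i. i \<in> I \<Longrightarrow> V i \<in> sets lebesgue" and d: "disjoint_family_on V I"
  shows "(\<Sum>i\<in>I. measure lebesgue (S \<inter> V i)) \<le> measure lebesgue S"
proof -
  have f: "S \<inter> V i \<in> lmeasurable" if "i \<in> I" for i
    using S m[OF that] by (rule fmeasurable_Int_fmeasurable)
  have "(\<Sum>i\<in>I. measure lebesgue (S \<inter> V i)) = measure lebesgue (\<Union>i\<in>I. S \<inter> V i)"
  proof (rule measure_finite_Union[symmetric])
    show "emeasure lebesgue (S \<inter> V i) \<noteq> \<infinity>" if "i \<in> I" for i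
      using fmeasurableD2[OF f[OF that]] by simp
  qed (use fin f d in \<open>auto simp: fmeasurableD disjoint_family_on_def\<close>)
  also have "\<dots> \<le> measure lebesgue S"
  proof (rule measure_mono_fmeasurable)
    show "(\<Union>i\<in>I. S \<inter> V i) \<in> sets lebesgue"
      using fin f fmeasurableD by (intro sets.finite_UN) blast+
  qed (use S in auto)
  finally show ?thesis .
qed

text \<open>The radii are more than 4 * h apart, so a point lies in at most one strip for each of
  its two coordinates; hence the factor 2.\<close>

lemma sum_measure_cross_strip_le:
  assumes S: "S \<in> lmeasurable" and fin: "finite I" and h: "0 < h"
    and sep: "\<And>i j. i \<in> I \<Longrightarrow> j \<in> I \<Longrightarrow> i \<noteq> j \<Longrightarrow> 4 * h < \<bar>r i - r j\<bar>"
  shows "(\<Sum>i\<in>I. measure lebesgue (S \<inter> cross_strip h (r i))) \<le> 2 * measure lebesgue S"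
proof -
  define V where "V f i = {z :: real \<times> real. r i - 2 * h \<le> \<bar>f z\<bar> \<and> \<bar>f z\<bar> \<le> r i + 2 * h}" for f :: "real \<times> real \<Rightarrow> real" and i
  have disj: "disjoint_family_on (V f) I" for f
    unfolding disjoint_family_on_def
  proof (intro ballI impI)
    fix i j assume "i \<in> I" "j \<in> I" "i \<noteq> j"
    from sep[OF this] show "V f i \<inter> V f j = {}"
      unfolding V_def by (auto simp: abs_if split: if_splits)
  qed
  have V: "V fst i \<in> sets lebesgue" "V snd i \<in> sets lebesgue" for i
  proof -
    have "closed (V fst i)" "closed (V snd i)"
      unfolding V_def by (intro closed_Collect_conj closed_Collect_le continuous_intros)+
    then show "V fst i \<in> sets lebesgue" "V snd i \<in> sets lebesgue" by auto
  qed
  have "measure lebesgue (S \<inter> cross_strip h (r i)) \<le> measure lebesgue (S \<inter> V fst i) + measure lebesgue (S \<inter> V snd i)" for i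
  proof -
    have "S \<inter> cross_strip h (r i) = (S \<inter> V fst i) \<union> (S \<inter> V snd i)"
      by (auto simp: cross_strip_def V_def)
    then show ?thesis
      using S V by (simp add: measure_Un_le fmeasurableD sets.Int)
  qed
  then have "(\<Sum>i\<in>I. measure lebesgue (S \<inter> cross_strip h (r i)))
      \<le> (\<Sum>i\<in>I. measure lebesgue (S \<inter> V fst i)) + (\<Sum>i\<in>I. measure lebesgue (S \<inter> V snd i))"
    by (simp add: sum_mono flip: sum.distrib)
  also have "\<dots> \<le> measure lebesgue S + measure lebesgue S"
    by (intro add_mono sum_measure_disjoint_le S fin V disj)
  finally show ?thesis by simp
qed

lemma square_annulus_compact: "compact (square_annulus h r)"
proof -
  have "closed (square_annulus h r)"
    unfolding square_annulus_def
    by (intro closed_Collect_disj closed_Collect_conj closed_Collect_le continuous_intros)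
  moreover have "square_annulus h r \<subseteq> cbox (-(r + h), -(r + h)) (r + h, r + h)"
    by (auto simp: square_annulus_def mem_rect)
  then have "bounded (square_annulus h r)" by (rule bounded_subset[OF bounded_cbox])
  ultimately show ?thesis by (simp add: compact_eq_bounded_closed)
qed

text \<open>Among about 1 / (64 * h) radii between 1/8 and 1/4 at most about a quarter fail to be
  thin. On the others p grows by factors L until ln (1 + |F|^2) passes 9000 / h; from there on 1 + W
  at least doubles. At least 1 / (200 * h) doublings remain, and their result is bounded by
  \<open>Bmax\<close>.\<close>

lemma (in cr_square) double_exponential_growth:
  fixes A Bmax :: real
  defines "k \<equiv> exp (2 * 10 ^ 6 :: real)"
  defines "h \<equiv> 512 * A * k\<^sup>2"
  assumes A: "0 < A" and h2000: "h \<le> 1 / 2000"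
    and S: "S \<in> lmeasurable" "measure lebesgue S \<le> A" and pS: "\<And>z. z \<in> Q0 \<Longrightarrow> 0 < p z \<Longrightarrow> z \<in> S"
    and v0: "\<And>t. \<bar>t\<bar> \<le> 1/16 \<Longrightarrow> aV (p (0, t)) (q (0, t)) \<le> 14" "\<And>t. \<bar>t\<bar> \<le> 1/16 \<Longrightarrow> aV (p (t, 0)) (q (t, 0)) \<le> 14"
    and base: "\<bar>fst z0\<bar> \<le> 1/8" "\<bar>snd z0\<bar> \<le> 1/8" "1 \<le> p z0"
    and maxp: "\<And>r z. 0 < r \<Longrightarrow> r \<le> 1/4 \<Longrightarrow> \<bar>fst z\<bar> \<le> r \<Longrightarrow> \<bar>snd z\<bar> \<le> r \<Longrightarrow> \<exists>z'\<in>square_frontier r. p z \<le> p z'"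
    and bnd: "\<And>z. z \<in> Q0 \<Longrightarrow> 1 + W z \<le> Bmax"
  shows "2 powr (1 / (200 * h)) \<le> Bmax"
proof -
  have k: "10 ^ 6 \<le> k" "1 \<le> k" unfolding k_def using exp_ge_add_one_self[of "2 * 10 ^ 6 :: real"] by simp_all
  have h: "0 < h" using A k by (simp add: h_def)
  \<comment> \<open>Spacing 8 * h separates neighbouring strips of width 4 * h, leaves room for the
    cutoff between them, and fits n radii into an interval of length 1/8.\<close>
  define n where "n = nat \<lfloor>1 / (64 * h)\<rfloor>"
  have n: "real n \<le> 1 / (64 * h)" "1 / (64 * h) - 1 \<le> real n"
    using h by (auto simp: n_def intro: of_nat_floor)
  define r where "r i = 1/8 + 2 * h + 8 * h * real i" for i
  have rb: "1/8 \<le> r i - 2 * h" "r i + 2 * h \<le> 1/4" if "i < n" for i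
  proof -
    have "8 * h * (real i + 1) \<le> 8 * h * (1 / (64 * h))"
      using that n h by (intro mult_left_mono) auto
    also have "\<dots> = 1/8" using h by simp
    finally show "r i + 2 * h \<le> 1/4" using h by (simp add: r_def algebra_simps)
    show "1/8 \<le> r i - 2 * h" using h by (simp add: r_def)
  qed
  have rsep: "r i + 8 * h \<le> r j" if "i < j" for i j
  proof -
    have "8 * h * (real i + 1) \<le> 8 * h * real j" using that h by (intro mult_left_mono) auto
    then show ?thesis by (simp add: r_def algebra_simps)
  qed
  define \<mu> where "\<mu> i = measure lebesgue (S \<inter> cross_strip h (r i))" for i
  define \<tau> where "\<tau> = h\<^sup>2 / k\<^sup>2"
  have \<tau>: "0 < \<tau>" using h k by (simp add: \<tau>_def)
  define good where "good = {i \<in> {..<n}. \<mu> i \<le> \<tau>}"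
  define bad where "bad = {i \<in> {..<n}. \<not> \<mu> i \<le> \<tau>}"
  have card_gb: "card good + card bad = n"
  proof -
    have "card (good \<union> bad) = card good + card bad"
      by (rule card_Un_disjoint) (auto simp: good_def bad_def)
    moreover have "good \<union> bad = {..<n}" by (auto simp: good_def bad_def)
    ultimately show ?thesis by simp
  qed
  have "real (card bad) * \<tau> = (\<Sum>i\<in>bad. \<tau>)" by simp
  also have "\<dots> \<le> (\<Sum>i\<in>bad. \<mu> i)" by (rule sum_mono) (auto simp: bad_def)
  also have "\<dots> \<le> (\<Sum>i<n. \<mu> i)" by (rule sum_mono2) (auto simp: bad_def \<mu>_def)
  also have "\<dots> \<le> 2 * measure lebesgue S"
    unfolding \<mu>_def
  proof (rule sum_measure_cross_strip_le[OF S(1) _ h])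
    fix i j :: nat assume "i \<noteq> j"
    then show "4 * h < \<bar>r i - r j\<bar>" using rsep[of i j] rsep[of j i] h by (cases "i < j") auto
  qed simp
  also have "\<dots> \<le> 2 * A" using S by simp
  finally have "real (card bad) \<le> 2 * A / \<tau>" using \<tau> by (simp add: field_simps)
  \<comment> \<open>The factor 512 in \<open>h\<close> is chosen for this: 2 * A * k^2 = h /
    256.\<close>
  also have "\<dots> = 1 / (256 * h)"
    using k A by (simp add: \<tau>_def h_def power2_eq_square field_simps)
  finally have badle: "real (card bad) \<le> 1 / (256 * h)" .
  define N where "N = card good"
  have Nge: "3 / (256 * h) - 1 \<le> real N"
  proof -
    have "real N = real n - real (card bad)" using card_gb by (simp add: N_def)
    moreover have "1 / (64 * h) = 4 / (256 * h)" by simp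
    moreover have "3 / (256 * h) = 4 / (256 * h) - 1 / (256 * h)" by (simp add: diff_divide_distrib[symmetric])
    ultimately show ?thesis using n badle by linarith
  qed
  define g where "g = sorted_list_of_set good"
  have fg: "finite good" by (simp add: good_def)
  have g: "length g = N" "set g = good" "sorted_wrt (<) g"
    using fg by (auto simp: g_def N_def)
  define \<rho> where "\<rho> j = r (g ! j)" for j
  have gj: "g ! j \<in> good" if "j < N" for j using that g by (metis nth_mem)
  have \<rho>b: "1/8 \<le> \<rho> j - 2 * h" "\<rho> j + 2 * h \<le> 1/4" "measure lebesgue (S \<inter> cross_strip h (\<rho> j)) \<le> h\<^sup>2 / k\<^sup>2"
    if "j < N" for j
    using gj[OF that] rb unfolding \<rho>_def good_def \<mu>_def \<tau>_def by auto
  have \<rho>sep: "\<rho> j + 8 * h \<le> \<rho> (Suc j)" if "Suc j < N" for j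
    unfolding \<rho>_def by (rule rsep) (use g that in \<open>auto simp: sorted_wrt_iff_nth_less\<close>)
  \<comment> \<open>L^4 = k^2, so that L > 10 yields the condition 10 * L^3 < k^2 of a growth
    step.\<close>
  define L where "L = exp (10 ^ 6 :: real)"
  have L: "0 < L" "1 \<le> L" "10 * L ^ 3 < k\<^sup>2"
  proof -
    have "10 < L" unfolding L_def using exp_ge_add_one_self[of "10 ^ 6 :: real"] by simp
    moreover have "k\<^sup>2 = L * L ^ 3" by (simp add: k_def L_def flip: exp_add exp_of_nat_mult exp_double)
    ultimately show "0 < L" "1 \<le> L" "10 * L ^ 3 < k\<^sup>2" by simp_all
  qed
  have growth: "\<exists>z\<in>square_frontier (\<rho> j). L ^ j \<le> p z" if "j < N" for j
    using that
  proof (induction j)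
    case 0
    have "0 < \<rho> 0" "\<rho> 0 \<le> 1/4" "1/8 \<le> \<rho> 0" using \<rho>b[OF 0] h by auto
    then obtain z' where "z' \<in> square_frontier (\<rho> 0)" "p z0 \<le> p z'"
      using maxp[of "\<rho> 0" z0] base by auto
    then show ?case using base(3) by (intro bexI[of _ z']) auto
  next
    case (Suc j)
    then obtain z where z: "z \<in> square_frontier (\<rho> j)" "L ^ j \<le> p z" by auto
    have pz: "0 < p z" using z(2) L(1) by (meson less_le_trans zero_less_power)
    have j: "j < N" using Suc.prems by simp
    have rr: "0 < \<rho> j" "\<rho> j + h \<le> 1/4" using \<rho>b[OF j] h by auto
    \<comment> \<open>The growth step finds a larger value slightly outside the current frontier;
      the maximum principle moves it onto the frontier at the next thin radius, however many radii
      have been skipped in between.\<close>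
    obtain z' where z': "\<bar>fst z'\<bar> \<le> \<rho> j + h" "\<bar>snd z'\<bar> \<le> \<rho> j + h" "L * p z \<le> p z'"
      using growth_step[OF h rr S(1) pS L(1,3) \<rho>b(3)[OF j] z(1) pz] by blast
    have "0 < \<rho> (Suc j)" "\<rho> (Suc j) \<le> 1/4" "\<bar>fst z'\<bar> \<le> \<rho> (Suc j)" "\<bar>snd z'\<bar> \<le> \<rho> (Suc j)"
      using \<rho>b[OF Suc.prems] \<rho>sep[OF Suc.prems] h z' by auto
    then obtain z'' where "z'' \<in> square_frontier (\<rho> (Suc j))" "p z' \<le> p z''" using maxp by blast
    moreover have "L ^ Suc j \<le> L * p z" using z(2) L by simp
    ultimately show ?case using z'(3) by force
  qed
  \<comment> \<open>After j0 steps ln (p^2) >= 2 * j0 * 10^6 >= 9000 / h, twice the loss 4500 / h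
    that a doubling step allows.\<close>
  define j0 where "j0 = nat \<lceil>4500 / (h * 10 ^ 6)\<rceil>"
  have j0: "4500 / (h * 10 ^ 6) \<le> real j0" "real j0 \<le> 4500 / (h * 10 ^ 6) + 1"
  proof -
    show "4500 / (h * 10 ^ 6) \<le> real j0" unfolding j0_def by (rule real_nat_ceiling_ge)
    have "0 \<le> 4500 / (h * 10 ^ 6)" using h by simp
    then show "real j0 \<le> 4500 / (h * 10 ^ 6) + 1" unfolding j0_def by linarith
  qed
  have hinv: "2000 \<le> 1 / h" using h h2000 by (simp add: field_simps)
  have e1: "3 / (256 * h) = 3 / 256 * (1 / h)" "4500 / (h * 10 ^ 6) = 45 / 10000 * (1 / h)" "1 / (200 * h) = 1 / 200 * (1 / h)"
    using h by simp_all
  \<comment> \<open>3/256 - 45/10000 exceeds 1/200 by more than 2/1000, and 1 / h >= 2000 makes this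
    surplus outweigh the rounding errors.\<close>
  have Nj0: "1 / (200 * h) \<le> real N - 1 - real j0"
    using Nge j0(2) hinv unfolding e1 by linarith
  then have j0N: "j0 < N" using h by (smt (verit) divide_pos_pos of_nat_less_iff)
  have doubling: "\<exists>z\<in>square_annulus h (\<rho> (j0 + i)). 2 ^ i * (9000 / h) \<le> 1 + W z" if "j0 + i < N" for i
    using that
  proof (induction i)
    case 0
    obtain z where z: "z \<in> square_frontier (\<rho> j0)" "L ^ j0 \<le> p z" using growth[of j0] 0 by auto
    have "9000 / h \<le> 2 * (real j0 * 10 ^ 6)" using j0(1) h by (simp add: field_simps)
    also have "\<dots> = ln ((L ^ j0)\<^sup>2)" by (simp add: L_def ln_realpow)
    also have "\<dots> \<le> ln (1 + R z)"
    proof -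
      have "(L ^ j0)\<^sup>2 \<le> (p z)\<^sup>2" using z(2) L by (intro power_mono) auto
      also have "\<dots> \<le> 1 + R z" by (simp add: R_def)
      finally show ?thesis using L R1_pos[of z] by (intro ln_mono) auto
    qed
    finally have "9000 / h \<le> 1 + W z" by (simp add: W_def)
    then show ?case using z(1) square_frontier_subset_annulus[of h "\<rho> j0"] h by auto
  next
    case (Suc i)
    define j where "j = j0 + i"
    have j: "j < N" "Suc j < N" using Suc.prems by (auto simp: j_def)
    obtain z where z: "z \<in> square_annulus h (\<rho> j)" "2 ^ i * (9000 / h) \<le> 1 + W z"
      using Suc by (auto simp: j_def)
    let ?A = "square_annulus h (\<rho> (Suc j))"
    have AQ: "?A \<subseteq> Q0" using \<rho>b[OF j(2)] h by (auto simp: square_annulus_def mem_rect)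
    have "?A \<noteq> {}"
    proof -
      have "(\<rho> (Suc j), 0) \<in> ?A" using \<rho>b(1)[OF j(2)] h by (auto simp: square_annulus_def)
      then show ?thesis by blast
    qed
    then obtain zm where zm: "zm \<in> ?A" "\<And>z. z \<in> ?A \<Longrightarrow> W z \<le> W zm"
      using continuous_attains_sup[OF square_annulus_compact _ cQ(8)[OF AQ]] by blast
    \<comment> \<open>The step bounds the inner annulus by the outer one; read backwards, a large
      value at j forces a larger one at Suc j.\<close>
    have "1 + W z \<le> 160 * 14 + 2081 + 120 / h + (1 + W zm) / 4"
    proof (rule annulus_step[OF h _ _ _ S(1) _ pS k(1) \<rho>b(3)[OF j(2)] \<rho>b(3)[OF j(1)] _ _ v0 z(1)])
      have "A \<le> h" using A one_le_power[OF k(2), of 2] by (simp add: h_def)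
      then show "measure lebesgue S \<le> 1" using S h2000 by linarith
    qed (use \<rho>b[OF j(1)] \<rho>b[OF j(2)] \<rho>sep[OF j(2)] h zm W_nonneg in \<open>auto simp: j_def\<close>)
    also have "160 * 14 + 2081 + 120 / h \<le> 4500 / h" using h h2000 by (simp add: field_simps)
    finally have *: "2 ^ i * (9000 / h) \<le> 4500 / h + (1 + W zm) / 4" using z(2) by simp
    have "1 * (9000 / h) \<le> 2 ^ i * (9000 / h)" using h by (intro mult_right_mono) auto
    then have "2 * b \<le> 1 + W zm" if "b = 2 ^ i * (9000 / h)" "a = 9000 / h" for a b
    proof -
      have "a \<le> b" "b \<le> a / 2 + (1 + W zm) / 4" using * \<open>1 * _ \<le> _\<close> that by auto
      then show ?thesis by argo
    qed
    then have "2 * (2 ^ i * (9000 / h)) \<le> 1 + W zm" by blast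
    then show ?case using zm(1) by (auto simp: j_def)
  qed
  define i where "i = N - 1 - j0"
  have i: "j0 + i < N" "1 / (200 * h) \<le> real i" using j0N Nj0 by (auto simp: i_def of_nat_diff)
  obtain z where z: "z \<in> square_annulus h (\<rho> (j0 + i))" "2 ^ i * (9000 / h) \<le> 1 + W z"
    using doubling[OF i(1)] by blast
  have zQ: "z \<in> Q0" using \<rho>b[OF i(1)] h z(1) by (cases z) (auto simp: square_annulus_def mem_rect)
  have "2 powr (1 / (200 * h)) \<le> 2 powr (real i)" using i(2) by simp
  also have "\<dots> = 2 ^ i * 1" by (simp add: powr_realpow)
  also have "\<dots> \<le> 2 ^ i * (9000 / h)" using h h2000 by (intro mult_left_mono) (auto simp: field_simps)
  also have "\<dots> \<le> Bmax" using z(2) bnd[OF zQ] by linarith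
  finally show ?thesis .
qed

subsection \<open>Sets on which the real part is nonnegative have large area\<close>

lemma measurable_Complex_pair:
  "(\<lambda>z. Complex (fst z) (snd z)) \<in> (lborel :: (real \<times> real) measure) \<rightarrow>\<^sub>M borel"
proof -
  have "(\<lambda>z. Complex (fst z) (snd z)) \<in> borel_measurable (borel :: (real \<times> real) measure)"
    by (intro borel_measurable_continuous_onI) (auto simp: Complex_eq intro!: continuous_intros)
  then show ?thesis by simp
qed

text \<open>Areas are taken in the complex plane, while Fubini is applied to pairs of reals. Boxes
  correspond to boxes of equal area, and this determines Lebesgue measure.\<close>

lemma lborel_complex_eq_distr:
  "distr (lborel :: (real \<times> real) measure) borel (\<lambda>z. Complex (fst z) (snd z)) = (lborel :: complex measure)"
proof (rule lborel_eqI[symmetric])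
  note m = measurable_Complex_pair
  fix l u :: complex
  assume lu: "\<And>b. b \<in> Basis \<Longrightarrow> l \<bullet> b \<le> u \<bullet> b"
  have le: "Re l \<le> Re u" "Im l \<le> Im u" using lu[of 1] lu[of \<i>] by (auto simp: Basis_complex_def)
  have "(\<lambda>z. Complex (fst z) (snd z)) -` box l u = box (Re l, Im l) (Re u, Im u)"
    by (auto simp: in_box_complex_iff mem_box Basis_prod_def)
  then have "emeasure (distr lborel borel (\<lambda>z. Complex (fst z) (snd z))) (box l u)
      = emeasure lborel (box (Re l, Im l) (Re u, Im u))"
    by (subst emeasure_distr[OF m]) auto
  also have "\<dots> = ennreal ((Re u - Re l) * (Im u - Im l))"
    using le by (subst emeasure_lborel_box) (auto simp: Basis_prod_def)
  also have "(Re u - Re l) * (Im u - Im l) = (\<Prod>b\<in>Basis. (u - l) \<bullet> b)"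
    by (simp add: Basis_complex_def)
  finally show "emeasure (distr lborel borel (\<lambda>z. Complex (fst z) (snd z))) (box l u) = ennreal (\<Prod>b\<in>Basis. (u - l) \<bullet> b)" .
qed simp

lemma emeasure_lborel_complex:
  assumes "X \<in> sets borel"
  shows "emeasure lborel X = emeasure lborel {z :: real \<times> real. Complex (fst z) (snd z) \<in> X}"
    and "{z :: real \<times> real. Complex (fst z) (snd z) \<in> X} \<in> sets borel"
proof -
  note m = measurable_Complex_pair
  have "emeasure lborel X = emeasure (distr (lborel :: (real \<times> real) measure) borel (\<lambda>z. Complex (fst z) (snd z))) X"
    by (simp add: lborel_complex_eq_distr)
  also have "\<dots> = emeasure lborel ((\<lambda>z. Complex (fst z) (snd z)) -` X \<inter> space (lborel :: (real \<times> real) measure))"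
    by (rule emeasure_distr[OF m assms])
  also have "(\<lambda>z. Complex (fst z) (snd z)) -` X \<inter> space (lborel :: (real \<times> real) measure)
      = {z. Complex (fst z) (snd z) \<in> X}" by auto
  finally show "emeasure lborel X = emeasure lborel {z :: real \<times> real. Complex (fst z) (snd z) \<in> X}" .
  show "{z :: real \<times> real. Complex (fst z) (snd z) \<in> X} \<in> sets borel"
    using measurable_sets[OF m assms] by (simp add: vimage_def)
qed

lemma has_field_derivative_Re_Im:
  assumes "(G has_field_derivative D) (at (Complex x y))"
  shows "((\<lambda>x. Re (G (Complex x y))) has_real_derivative Re D) (at x)"
    "((\<lambda>x. Im (G (Complex x y))) has_real_derivative Im D) (at x)"
    "((\<lambda>y. Re (G (Complex x y))) has_real_derivative - Im D) (at y)"
    "((\<lambda>y. Im (G (Complex x y))) has_real_derivative Re D) (at y)"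
proof -
  have c1: "((\<lambda>x. Complex x y) has_vector_derivative 1) (at x)"
    unfolding has_vector_derivative_complex_iff by simp
  have c2: "((\<lambda>y. Complex x y) has_vector_derivative \<i>) (at y)"
    unfolding has_vector_derivative_complex_iff by simp
  have "((\<lambda>x. G (Complex x y)) has_vector_derivative 1 * D) (at x)"
    using field_vector_diff_chain_at[OF c1 assms] by (simp add: o_def)
  then show "((\<lambda>x. Re (G (Complex x y))) has_real_derivative Re D) (at x)"
    "((\<lambda>x. Im (G (Complex x y))) has_real_derivative Im D) (at x)"
    unfolding has_vector_derivative_complex_iff by simp_all
  have "((\<lambda>y. G (Complex x y)) has_vector_derivative \<i> * D) (at y)"
    using field_vector_diff_chain_at[OF c2 assms] by (simp add: o_def)
  then show "((\<lambda>y. Re (G (Complex x y))) has_real_derivative - Im D) (at y)"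
    "((\<lambda>y. Im (G (Complex x y))) has_real_derivative Re D) (at y)"
    unfolding has_vector_derivative_complex_iff by simp_all
qed

lemma Q0_in_ball:
  assumes "(x, y) \<in> Q0" shows "Complex x y \<in> ball 0 (1/2)"
proof -
  have "x\<^sup>2 \<le> (1/4)\<^sup>2" "y\<^sup>2 \<le> (1/4)\<^sup>2"
    using assms by (auto simp: mem_rect abs_le_square_iff[symmetric])
  then have "sqrt (x\<^sup>2 + y\<^sup>2) < 1/2" by (intro real_less_lsqrt) (auto simp: power2_eq_square)
  then show ?thesis by (simp add: complex_norm)
qed

lemma cr_square_holomorphic:
  assumes G: "G holomorphic_on ball 0 (1/2)"
  shows "cr_square (\<lambda>z. Re (G (Complex (fst z) (snd z)))) (\<lambda>z. Im (G (Complex (fst z) (snd z))))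
    (\<lambda>z. Re (deriv G (Complex (fst z) (snd z)))) (\<lambda>z. Im (deriv G (Complex (fst z) (snd z))))
    (\<lambda>z. Re (deriv (deriv G) (Complex (fst z) (snd z)))) (\<lambda>z. Im (deriv (deriv G) (Complex (fst z) (snd z))))"
proof -
  let ?B = "ball (0::complex) (1/2)"
  have G': "deriv G holomorphic_on ?B" by (rule holomorphic_deriv[OF G]) simp
  have G'': "deriv (deriv G) holomorphic_on ?B" by (rule holomorphic_deriv[OF G']) simp
  have d: "(f has_field_derivative deriv f (Complex x y)) (at (Complex x y))"
    if "f holomorphic_on ?B" "(x, y) \<in> Q0" for f x y
    by (rule holomorphic_derivI[OF that(1) open_ball Q0_in_ball[OF that(2)]])
  have c: "continuous_on Q0 (\<lambda>z. f (Complex (fst z) (snd z)))" if "f holomorphic_on ?B" for f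
    by (rule continuous_on_compose2[OF holomorphic_on_imp_continuous_on[OF that]])
       (use Q0_in_ball in \<open>force simp: Complex_eq intro!: continuous_intros\<close>)+
  show ?thesis
    by unfold_locales
       (auto simp: has_field_derivative_Re_Im[OF d[OF G]] has_field_derivative_Re_Im[OF d[OF G']]
         intro!: continuous_on_Re continuous_on_Im c[OF G, simplified] c[OF G', simplified] c[OF G'', simplified])
qed

lemma real_part_maximum_square:
  assumes G: "G holomorphic_on ball 0 (1/2)" and r: "0 < r" "r \<le> 1/4"
    and z: "\<bar>fst z\<bar> \<le> r" "\<bar>snd z\<bar> \<le> r"
  shows "\<exists>z'\<in>square_frontier r. Re (G (Complex (fst z) (snd z))) \<le> Re (G (Complex (fst z') (snd z')))"
proof -
  let ?p = "\<lambda>z. Re (G (Complex (fst z) (snd z)))"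
  let ?S = "cbox (Complex (-r) (-r)) (Complex r r)"
  have SB: "?S \<subseteq> ball 0 (1/2)"
  proof
    fix w assume "w \<in> ?S"
    then have "(Re w, Im w) \<in> Q0" using r by (auto simp: in_cbox_complex_iff mem_rect)
    then show "w \<in> ball 0 (1/2)" using Q0_in_ball by fastforce
  qed
  have fQ: "square_frontier r \<subseteq> Q0" using r by (auto simp: square_frontier_def mem_rect max_def split: if_splits)
  have "closed (square_frontier r)" unfolding square_frontier_def
    by (intro closed_Collect_eq continuous_intros)
  then have comp: "compact (square_frontier r)"
    using bounded_subset[OF bounded_cbox fQ] by (simp add: compact_eq_bounded_closed)
  have ne: "square_frontier r \<noteq> {}"
  proof -
    have "(r, 0) \<in> square_frontier r" using r by (simp add: square_frontier_def)
    then show ?thesis by blast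
  qed
  interpret cr_square ?p "\<lambda>z. Im (G (Complex (fst z) (snd z)))"
    "\<lambda>z. Re (deriv G (Complex (fst z) (snd z)))" "\<lambda>z. Im (deriv G (Complex (fst z) (snd z)))"
    "\<lambda>z. Re (deriv (deriv G) (Complex (fst z) (snd z)))" "\<lambda>z. Im (deriv (deriv G) (Complex (fst z) (snd z)))"
    by (rule cr_square_holomorphic[OF G])
  obtain zm where zm: "zm \<in> square_frontier r" "\<And>z. z \<in> square_frontier r \<Longrightarrow> ?p z \<le> ?p zm"
    using continuous_attains_sup[OF comp ne cQ(1)[OF fQ]] by blast
  have "?p z \<le> ?p zm"
  proof (rule maximum_real_frontier[where S = ?S and f = G])
    show "G holomorphic_on interior ?S"
      by (rule holomorphic_on_subset[OF G]) (use SB interior_subset in blast)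
    show "continuous_on (closure ?S) G"
      by (rule holomorphic_on_imp_continuous_on, rule holomorphic_on_subset[OF G]) (use SB in simp)
    fix w assume "w \<in> frontier ?S"
    then have "(Re w, Im w) \<in> square_frontier r"
      using r by (auto simp: frontier_cbox in_cbox_complex_iff in_box_complex_iff square_frontier_def)
    from zm(2)[OF this] show "Re (G w) \<le> ?p zm" by simp
  qed (use z in \<open>auto simp: in_cbox_complex_iff\<close>)
  then show ?thesis using zm(1) by blast
qed

text \<open>The Borel-Caratheodory inequality at half the radius. For g = G - G 0, rescaled to the
  unit disc, Re g < 1 makes g / (2 - g) a map of the unit disc into itself that fixes 0, and
  Schwarz's lemma gives |g| <= (2 + |g|) / 2, that is |g| <= 2.\<close>

lemma borel_caratheodory_quarter:
  assumes G: "G holomorphic_on ball 0 \<rho>" and \<rho>: "0 < \<rho>" and le: "\<And>z. z \<in> ball 0 \<rho> \<Longrightarrow> Re (G z) \<le> 1"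
    and G0: "G 0 = of_real c" "0 < c" "c \<le> 1" and z: "cmod z \<le> \<rho> / 2"
  shows "cmod (G z) \<le> 3"
proof -
  define g where "g w = G (of_real \<rho> * w) - G 0" for w
  have inb: "of_real \<rho> * w \<in> ball 0 \<rho>" if "cmod w < 1" for w
    using that \<rho> by (simp add: norm_mult)
  have Re_g: "Re (g w) < 1" if "cmod w < 1" for w
    using le[OF inb[OF that]] G0 by (simp add: g_def)
  have g: "g holomorphic_on ball 0 1"
    unfolding g_def
    by (intro holomorphic_intros holomorphic_on_compose_gen[OF _ G, unfolded o_def]) (use inb in auto)
  have ne: "2 - g w \<noteq> 0" if "cmod w < 1" for w
  proof
    assume "2 - g w = 0"
    then have "g w = 2" by simp
    then show False using Re_g[OF that] by simp
  qed
  have lt: "cmod (g w) < cmod (2 - g w)" if "cmod w < 1" for w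
  proof -
    have "(cmod (2 - g w))\<^sup>2 = (cmod (g w))\<^sup>2 + 4 * (1 - Re (g w))"
      unfolding cmod_power2 by (simp add: power2_eq_square algebra_simps)
    then have "(cmod (g w))\<^sup>2 < (cmod (2 - g w))\<^sup>2" using Re_g[OF that] by simp
    then show ?thesis by (rule power_less_imp_less_base) simp
  qed
  define w where "w = z / of_real \<rho>"
  have w: "cmod w \<le> 1/2" using z \<rho> by (simp add: w_def norm_divide field_simps)
  have "cmod (g w / (2 - g w)) \<le> cmod w"
  proof (rule Schwarz_Lemma(1)[where f = "\<lambda>w. g w / (2 - g w)"])
    show "(\<lambda>w. g w / (2 - g w)) holomorphic_on ball 0 1"
      by (intro holomorphic_intros g) (use ne in auto)
    show "g 0 / (2 - g 0) = 0" by (simp add: g_def)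
    show "cmod (g v / (2 - g v)) < 1" if "cmod v < 1" for v
      using lt[OF that] ne[OF that] by (simp add: norm_divide)
  qed (use w in auto)
  then have "cmod (g w) \<le> cmod w * cmod (2 - g w)"
    using w ne[of w] by (simp add: norm_divide field_simps)
  also have "\<dots> \<le> 1/2 * cmod (2 - g w)" using w by (intro mult_right_mono) auto
  also have "cmod (2 - g w) \<le> 2 + cmod (g w)" by (metis norm_numeral norm_triangle_ineq4)
  finally have "cmod (g w) \<le> 2" by simp
  moreover have "G z = g w + of_real c" using \<rho> by (simp add: g_def w_def G0)
  ultimately show ?thesis using G0 norm_triangle_ineq[of "g w" "of_real c"] by simp
qed

text \<open>F is divided by its largest real part m on the disc of radius 1/8. The quotient has real
  part 1 at some point of that disc, where the growth argument starts, and by Borel-Caratheodory it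
  is at most 3 in modulus on half the radius, so that the initial bound for \<open>aV\<close> is an
  absolute constant. The sign of the real part, and with it the set, is unchanged.\<close>

lemma area_lower_bound:
  fixes A M :: real
  defines "k \<equiv> exp (2 * 10 ^ 6 :: real)"
  defines "h \<equiv> 512 * A * k\<^sup>2"
  assumes A: "0 < A" and h: "h \<le> 1 / 2000"
    and F: "F holomorphic_on ball 0 (1/2)" "F 0 = 1" and M: "\<And>z. z \<in> ball 0 (1/2) \<Longrightarrow> cmod (F z) \<le> M"
    and X: "X \<in> sets borel" "emeasure lborel X \<le> ennreal A"
    and FX: "\<And>z. z \<in> ball 0 (1/2) \<Longrightarrow> 0 \<le> Re (F z) \<Longrightarrow> z \<in> X"
  shows "2 powr (1 / (200 * h)) \<le> 1 + ln (1 + M\<^sup>2)"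
proof -
  let ?S = "{z :: real \<times> real. Complex (fst z) (snd z) \<in> X}"
  have Sb: "?S \<in> sets borel" and Se: "emeasure lborel ?S \<le> ennreal A"
    using emeasure_lborel_complex[OF X(1)] X(2) by auto
  have S: "?S \<in> lmeasurable" "measure lebesgue ?S \<le> A"
  proof -
    have e: "emeasure lebesgue ?S \<le> ennreal A" using Se Sb by simp
    then have "emeasure lebesgue ?S < \<infinity>" by (rule le_less_trans) simp
    then show "?S \<in> lmeasurable" using Sb by (intro fmeasurableI) auto
    show "measure lebesgue ?S \<le> A" using e A by (simp add: measure_def enn2real_leI)
  qed
  have "compact (cball (0::complex) (1/8))" by simp
  moreover have "continuous_on (cball (0::complex) (1/8)) (\<lambda>z. Re (F z))"
    by (intro continuous_intros holomorphic_on_imp_continuous_on holomorphic_on_subset[OF F(1)]) auto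
  ultimately obtain w0 where w0: "w0 \<in> cball 0 (1/8)" "\<And>z. z \<in> cball 0 (1/8) \<Longrightarrow> Re (F z) \<le> Re (F w0)"
    using continuous_attains_sup[of "cball (0::complex) (1/8)" "\<lambda>z. Re (F z)"] by auto
  define m where "m = Re (F w0)"
  have m: "1 \<le> m" using w0(2)[of 0] F(2) by (simp add: m_def)
  define G where "G z = F z / of_real m" for z
  have G: "G holomorphic_on ball 0 (1/2)" unfolding G_def by (intro holomorphic_intros F) (use m in auto)
  have ReG: "Re (G z) = Re (F z) / m" for z using m by (simp add: G_def)
  interpret cr_square "\<lambda>z. Re (G (Complex (fst z) (snd z)))" "\<lambda>z. Im (G (Complex (fst z) (snd z)))"
    "\<lambda>z. Re (deriv G (Complex (fst z) (snd z)))" "\<lambda>z. Im (deriv G (Complex (fst z) (snd z)))"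
    "\<lambda>z. Re (deriv (deriv G) (Complex (fst z) (snd z)))" "\<lambda>z. Im (deriv (deriv G) (Complex (fst z) (snd z)))"
    by (rule cr_square_holomorphic[OF G])
  have R: "R z = (cmod (G (Complex (fst z) (snd z))))\<^sup>2" for z by (simp add: R_def cmod_power2)
  have G3: "cmod (G z) \<le> 3" if "cmod z \<le> 1/16" for z
  proof (rule borel_caratheodory_quarter[where G = G and z = z and \<rho> = "1/8" and c = "1 / m"])
    show "G holomorphic_on ball 0 (1/8)" by (rule holomorphic_on_subset[OF G]) auto
    show "Re (G w) \<le> 1" if "w \<in> ball 0 (1/8)" for w
      using w0(2)[of w] that m by (simp add: ReG m_def[symmetric])
    show "G 0 = complex_of_real (1 / m)" by (simp add: G_def F)
  qed (use that m in auto)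
  have v0: "aV (Re (G w)) (Im (G w)) \<le> 14" if "cmod w \<le> 1/16" for w
  proof -
    have "(Re (G w))\<^sup>2 + (Im (G w))\<^sup>2 \<le> 3\<^sup>2"
      using power_mono[OF G3[OF that], of 2] by (simp add: cmod_power2)
    moreover have "ln (1 + ((Re (G w))\<^sup>2 + (Im (G w))\<^sup>2)) \<le> (Re (G w))\<^sup>2 + (Im (G w))\<^sup>2"
      by (rule ln_add_one_self_le_self) simp
    ultimately show ?thesis using aux_size(1)[of "Re (G w)" "Im (G w)"] by simp
  qed
  show ?thesis
    unfolding h_def k_def
  proof (rule double_exponential_growth[OF A _ S])
    show "512 * A * (exp (2 * 10 ^ 6))\<^sup>2 \<le> 1 / 2000" using h by (simp add: h_def k_def)
  next
    fix z assume z: "z \<in> Q0" "0 < Re (G (Complex (fst z) (snd z)))"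
    then have "0 \<le> Re (F (Complex (fst z) (snd z)))" using m by (simp add: ReG zero_less_divide_iff)
    moreover have "Complex (fst z) (snd z) \<in> ball 0 (1/2)" using z(1) Q0_in_ball[of "fst z" "snd z"] by simp
    ultimately show "z \<in> ?S" using FX by simp
  next
    show "aV (Re (G (Complex (fst (0, t)) (snd (0, t))))) (Im (G (Complex (fst (0, t)) (snd (0, t))))) \<le> 14" if "\<bar>t\<bar> \<le> 1/16" for t
      using v0[of "Complex 0 t"] that by (simp add: complex_norm)
    show "aV (Re (G (Complex (fst (t, 0)) (snd (t, 0))))) (Im (G (Complex (fst (t, 0)) (snd (t, 0))))) \<le> 14" if "\<bar>t\<bar> \<le> 1/16" for t
      using v0[of "Complex t 0"] that by (simp add: complex_norm)
  next
    show "\<bar>fst (Re w0, Im w0)\<bar> \<le> 1/8" "\<bar>snd (Re w0, Im w0)\<bar> \<le> 1/8"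
      using w0(1) abs_Re_le_cmod[of w0] abs_Im_le_cmod[of w0] by auto
    show "1 \<le> Re (G (Complex (fst (Re w0, Im w0)) (snd (Re w0, Im w0))))"
      using m by (simp add: ReG m_def[symmetric])
  next
    fix r :: real and z :: "real \<times> real"
    assume "0 < r" "r \<le> 1/4" "\<bar>fst z\<bar> \<le> r" "\<bar>snd z\<bar> \<le> r"
    then show "\<exists>z'\<in>square_frontier r. Re (G (Complex (fst z) (snd z))) \<le> Re (G (Complex (fst z') (snd z')))"
      by (rule real_part_maximum_square[OF G])
  next
    fix z assume "z \<in> Q0"
    then have b: "Complex (fst z) (snd z) \<in> ball 0 (1/2)" using Q0_in_ball[of "fst z" "snd z"] by simp
    have "cmod (G (Complex (fst z) (snd z))) \<le> cmod (F (Complex (fst z) (snd z)))"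
      using m by (simp add: G_def norm_divide divide_le_eq mult_le_cancel_left1)
    also have "\<dots> \<le> M" by (rule M[OF b])
    finally have "R z \<le> M\<^sup>2" unfolding R by (intro power_mono) auto
    then show "1 + W z \<le> 1 + ln (1 + M\<^sup>2)"
      unfolding W_def using R1_pos[of z] by simp
  qed
qed

subsection \<open>The lower bound for zeros on the circle\<close>

lemma sublevel_set_borel: "sublevel_set p t \<in> sets borel"
proof -
  have "closed (sublevel_set p t)"
    unfolding sublevel_set_def by (intro closed_Collect_le continuous_intros)
  then show ?thesis by simp
qed

lemma monic_poly_roots:
  assumes "p \<in> monic_polys_zeros_in n K"
  obtains a where "\<And>z. poly p z = (\<Prod>i<n. (z - a i))" "\<And>i. i < n \<Longrightarrow> a i \<in> K"
proof -
  have n: "degree p = n" "lead_coeff p = 1" "\<And>z. poly p z = 0 \<Longrightarrow> z \<in> K"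
    using assms by (auto simp: monic_polys_zeros_in_def)
  obtain a where "smult (lead_coeff p) (\<Prod>i<degree p. [:- a i, 1:]) = p"
    by (rule complex_poly_decompose')
  then have p: "p = (\<Prod>i<n. [:- a i, 1:])" using n by simp
  have eq: "poly p z = (\<Prod>i<n. (z - a i))" for z
    unfolding p by (simp add: poly_prod)
  have "a i \<in> K" if "i < n" for i
    using that by (intro n(3)) (auto simp: eq)
  then show ?thesis using that eq by blast
qed

text \<open>Zeros on the circle make the product of the - a i unimodular, so on the disc of radius
  1/2 ln |p| is the real part of a sum of n principal logarithms, each of modulus at most 1. This
  bounds |F| by 1 + n / ln t, and Re F >= 0 means |p| <= t there.\<close>

lemma sublevel_area_ge:
  fixes t A :: real
  defines "k \<equiv> exp (2 * 10 ^ 6 :: real)"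
  defines "h \<equiv> 512 * A * k\<^sup>2"
  assumes t: "1 < t" and A: "0 < A" "h \<le> 1 / 2000" and p: "p \<in> monic_polys_zeros_in n (sphere 0 1)"
    and area: "emeasure lborel (sublevel_set p t) \<le> ennreal A"
  shows "2 powr (1 / (200 * h)) \<le> 1 + ln (1 + (1 + real n / ln t)\<^sup>2)"
proof -
  obtain a where a: "\<And>z. poly p z = (\<Prod>i<n. (z - a i))" "\<And>i. i < n \<Longrightarrow> cmod (a i) = 1"
    using monic_poly_roots[OF p] by (metis dist_0_norm mem_sphere)
  have L: "0 < ln t" using t by simp
  define f where "f z = (\<Sum>i<n. Ln (1 + - (z / a i)))" for z
  define F where "F z = 1 - f z / of_real (ln t)" for z
  have small: "cmod (- (z / a i)) < 1/2" "1 + - (z / a i) \<notin> \<real>\<^sub>\<le>\<^sub>0" if "z \<in> ball 0 (1/2)" "i < n" for z i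
  proof -
    show s: "cmod (- (z / a i)) < 1/2" using that a by (simp add: norm_divide)
    have "\<bar>Re (- (z / a i))\<bar> < 1/2" using s abs_Re_le_cmod le_less_trans by blast
    then show "1 + - (z / a i) \<notin> \<real>\<^sub>\<le>\<^sub>0" by (auto simp: complex_nonpos_Reals_iff)
  qed
  have ai: "a i \<noteq> 0" if "i < n" for i using a(2)[OF that] by auto
  have expf: "exp (f z) * (\<Prod>i<n. - a i) = poly p z" if z: "z \<in> ball 0 (1/2)" for z
  proof -
    have "exp (f z) = (\<Prod>i<n. 1 + - (z / a i))"
      unfolding f_def exp_sum[OF finite_lessThan]
      by (intro prod.cong refl exp_Ln) (use small(2)[OF z] in force)
    then have "exp (f z) * (\<Prod>i<n. - a i) = (\<Prod>i<n. (1 + - (z / a i)) * - a i)"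
      by (simp only: prod.distrib)
    also have "\<dots> = (\<Prod>i<n. (z - a i))"
      by (intro prod.cong refl) (use ai in \<open>auto simp: field_simps\<close>)
    finally show ?thesis by (simp add: a(1))
  qed
  have normp: "cmod (poly p z) = exp (Re (f z))" if z: "z \<in> ball 0 (1/2)" for z
  proof -
    have "cmod (\<Prod>i<n. - a i) = 1" by (simp add: prod_norm[symmetric] a(2))
    then show ?thesis unfolding expf[OF z, symmetric] by (simp add: norm_mult)
  qed
  show ?thesis
    unfolding h_def k_def
  proof (rule area_lower_bound[OF A(1), where F = F and X = "sublevel_set p t"])
    show "512 * A * (exp (2 * 10 ^ 6))\<^sup>2 \<le> 1 / 2000" using A by (simp add: h_def k_def)
    show "F holomorphic_on ball 0 (1/2)"
      unfolding F_def f_def by (intro holomorphic_intros) (use small ai L in auto)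
    show "F 0 = 1" by (simp add: F_def f_def)
    fix z :: complex assume z: "z \<in> ball 0 (1/2)"
    have "cmod (f z) \<le> (\<Sum>i<n. 1)"
      unfolding f_def
    proof (rule sum_norm_le)
      fix i assume "i \<in> {..<n}"
      then have "i < n" by simp
      from norm_Ln_le[OF small(1)[OF z this]] small(1)[OF z this] show "cmod (Ln (1 + - (z / a i))) \<le> 1" by linarith
    qed
    then have fn: "cmod (f z) \<le> real n" by simp
    have "cmod (F z) \<le> 1 + cmod (f z / of_real (ln t))"
      unfolding F_def by (metis norm_one norm_triangle_ineq4)
    also have "\<dots> \<le> 1 + real n / ln t" using fn L by (simp add: norm_divide divide_right_mono)
    finally show "cmod (F z) \<le> 1 + real n / ln t" .
    assume "0 \<le> Re (F z)"
    then have "Re (f z) \<le> ln t" using L by (simp add: F_def field_simps)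
    then have "exp (Re (f z)) \<le> t" using t by (metis exp_le_cancel_iff exp_ln less_trans zero_less_one)
    then show "z \<in> sublevel_set p t" using normp[OF z] by (simp add: sublevel_set_def)
  qed (use area sublevel_set_borel in auto)
qed

lemma kappa_sphere_lower:
  fixes t :: real
  assumes t: "1 < t"
  shows "\<exists>c>0. \<forall>\<^sub>F n in sequentially. ennreal (c / ln (ln (real n))) \<le> kappa n (sphere 0 1) t"
proof -
  define k where "k = exp (2 * 10 ^ 6 :: real)"
  have k: "0 < k" by (simp add: k_def)
  \<comment> \<open>With A = c / l and l = ln (ln n) this makes 1 / (200 * h) equal to 4 * l, and 2
    powr (4 * l) >= (ln n)^2 outgrows the right-hand side, which is of order ln n.\<close>
  define c where "c = 1 / (800 * 512 * k\<^sup>2)"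
  have c: "0 < c" using k by (simp add: c_def)
  define L where "L = ln t"
  have L: "0 < L" using t by (simp add: L_def)
  have "filterlim (\<lambda>n. ln (ln (real n))) at_top sequentially" by real_asymp
  then have e1: "\<forall>\<^sub>F n in sequentially. max 1 (2000 * (512 * c * k\<^sup>2)) \<le> ln (ln (real n))"
    unfolding filterlim_at_top by blast
  have e2: "\<forall>\<^sub>F n :: nat in sequentially. 1 + ln (1 + (1 + real n / L)\<^sup>2) < (ln (real n))\<^sup>2"
    using L by real_asymp
  have e3: "\<forall>\<^sub>F n :: nat in sequentially. 0 < ln (real n)" by real_asymp
  have "\<forall>\<^sub>F n in sequentially. ennreal (c / ln (ln (real n))) \<le> kappa n (sphere 0 1) t"
    using e1 e2 e3
  proof eventually_elim
    case (elim n)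
    define l where "l = ln (ln (real n))"
    have l: "1 \<le> l" "2000 * (512 * c * k\<^sup>2) \<le> l" using elim by (auto simp: l_def)
    define A where "A = c / l"
    have A: "0 < A" "512 * A * k\<^sup>2 \<le> 1 / 2000" using c l by (auto simp: A_def field_simps)
    show ?case unfolding kappa_def l_def[symmetric] A_def[symmetric]
    proof (rule INF_greatest)
      fix p assume p: "p \<in> monic_polys_zeros_in n (sphere 0 1)"
      show "ennreal A \<le> emeasure lborel (sublevel_set p t)"
      proof (rule ccontr)
        assume "\<not> ?thesis"
        then have "emeasure lborel (sublevel_set p t) \<le> ennreal A" by simp
        from sublevel_area_ge[OF t A(1) A(2)[unfolded k_def] p this]
        have "2 powr (1 / (200 * (512 * A * k\<^sup>2))) \<le> 1 + ln (1 + (1 + real n / L)\<^sup>2)" by (simp add: k_def L_def)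
        moreover have "1 / (200 * (512 * A * k\<^sup>2)) = 4 * l"
          using l k by (simp add: A_def c_def)
        moreover have "(ln (real n))\<^sup>2 \<le> 2 powr (4 * l)"
        proof -
          have "0 < ln (real n)" by (rule elim(3))
          then have "(ln (real n))\<^sup>2 = exp (2 * l)" by (simp add: l_def exp_double)
          also have "\<dots> \<le> exp (4 * l * ln 2)" using l(1) ln2_ge_two_thirds mult_left_mono[of "1/2" "ln 2" "4 * l"] by simp
          finally show ?thesis by (simp add: powr_def mult_ac)
        qed
        ultimately show False using elim(2) by (simp add: l_def)
      qed
    qed
  qed
  then show ?thesis using c by blast
qed

subsection \<open>Self-reciprocal polynomials\<close>

lemma blaschke_identity:
  "(cmod (1 - cnj a * z))\<^sup>2 - (cmod (z - a))\<^sup>2 = (1 - (cmod a)\<^sup>2) * (1 - (cmod z)\<^sup>2)"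
  unfolding cmod_power2 by (simp add: power2_eq_square algebra_simps)

lemma blaschke_le:
  assumes "cmod a \<le> 1"
  shows "cmod z \<le> 1 \<Longrightarrow> cmod (z - a) \<le> cmod (1 - cnj a * z)"
    and "1 \<le> cmod z \<Longrightarrow> cmod (1 - cnj a * z) \<le> cmod (z - a)"
proof -
  have a: "0 \<le> 1 - (cmod a)\<^sup>2" using assms by (simp add: power_le_one)
  show "cmod (z - a) \<le> cmod (1 - cnj a * z)" if "cmod z \<le> 1"
  proof (rule power2_le_imp_le)
    have "0 \<le> 1 - (cmod z)\<^sup>2" using that by (simp add: power_le_one)
    then show "(cmod (z - a))\<^sup>2 \<le> (cmod (1 - cnj a * z))\<^sup>2"
      using blaschke_identity[of a z] a by (metis diff_ge_0_iff_ge mult_nonneg_nonneg)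
  qed simp
  show "cmod (1 - cnj a * z) \<le> cmod (z - a)" if "1 \<le> cmod z"
  proof (rule power2_le_imp_le)
    have "1 - (cmod z)\<^sup>2 \<le> 0" using that by (simp add: one_le_power)
    then show "(cmod (1 - cnj a * z))\<^sup>2 \<le> (cmod (z - a))\<^sup>2"
      using blaschke_identity[of a z] mult_nonneg_nonpos[OF a, of "1 - (cmod z)\<^sup>2"] by linarith
  qed simp
qed

text \<open>For g the product of the z - a i, this is z ^ N times g plus the reciprocal polynomial
  of g. Zeros are indexed by a set rather than by an initial segment, so that a square can be given
  by a product index set.\<close>

definition recip_poly :: "nat \<Rightarrow> 'i set \<Rightarrow> ('i \<Rightarrow> complex) \<Rightarrow> complex poly" where
  "recip_poly N I a = monom 1 N * (\<Prod>i\<in>I. [:- a i, 1:]) + (\<Prod>i\<in>I. [:1, - cnj (a i):])"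

lemma poly_recip_poly:
  "poly (recip_poly N I a) z = z ^ N * (\<Prod>i\<in>I. z - a i) + (\<Prod>i\<in>I. 1 - cnj (a i) * z)"
  by (simp add: recip_poly_def poly_prod poly_monom algebra_simps)

text \<open>For zeros in the closed disc, g is dominated factor by factor by its reciprocal
  polynomial inside the circle and dominates it outside. The smaller summand is therefore at most
  |z| ^ N times the larger one inside, and at most its quotient by |z| ^ N outside.\<close>

lemma
  assumes a: "\<And>i. i \<in> I \<Longrightarrow> cmod (a i) \<le> 1"
  shows recip_poly_inside: "cmod z \<le> 1 \<Longrightarrow>
      (\<Prod>i\<in>I. cmod (1 - cnj (a i) * z)) * (1 - cmod z ^ N) \<le> cmod (poly (recip_poly N I a) z)"
    and recip_poly_outside: "1 \<le> cmod z \<Longrightarrow>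
      (\<Prod>i\<in>I. cmod (z - a i)) * (cmod z ^ N - 1) \<le> cmod (poly (recip_poly N I a) z)"
proof -
  define U where "U = (\<Prod>i\<in>I. z - a i)"
  define V where "V = (\<Prod>i\<in>I. 1 - cnj (a i) * z)"
  have p: "poly (recip_poly N I a) z = z ^ N * U + V" by (simp add: poly_recip_poly U_def V_def)
  have cU: "cmod U = (\<Prod>i\<in>I. cmod (z - a i))" and cV: "cmod V = (\<Prod>i\<in>I. cmod (1 - cnj (a i) * z))"
    by (simp_all add: U_def V_def prod_norm)
  show "(\<Prod>i\<in>I. cmod (1 - cnj (a i) * z)) * (1 - cmod z ^ N) \<le> cmod (poly (recip_poly N I a) z)" if "cmod z \<le> 1"
  proof -
    have "cmod U \<le> cmod V" unfolding cU cV by (intro prod_mono conjI blaschke_le a that) auto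
    then have "cmod z ^ N * cmod U \<le> cmod z ^ N * cmod V" by (intro mult_left_mono) auto
    moreover have "cmod V - cmod (z ^ N * U) \<le> cmod (z ^ N * U + V)"
      using norm_diff_ineq[of V "z ^ N * U"] by (simp add: add.commute)
    ultimately show ?thesis unfolding p cV[symmetric] by (simp add: norm_mult norm_power algebra_simps)
  qed
  show "(\<Prod>i\<in>I. cmod (z - a i)) * (cmod z ^ N - 1) \<le> cmod (poly (recip_poly N I a) z)" if "1 \<le> cmod z"
  proof -
    have "cmod V \<le> cmod U" unfolding cU cV by (intro prod_mono conjI blaschke_le a that) auto
    moreover have "cmod (z ^ N * U) - cmod V \<le> cmod (z ^ N * U + V)"
      using norm_diff_ineq[of "z ^ N * U" V] by simp
    ultimately show ?thesis unfolding p cU[symmetric] by (simp add: norm_mult norm_power algebra_simps)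
  qed
qed

text \<open>Off the circle the lower bounds for the modulus are positive, which excludes zeros
  there. N >= 1 gives the second summand the smaller degree, so the leading coefficient is that of
  the first.\<close>

lemma recip_poly_mem:
  assumes I: "finite I" and a: "\<And>i. i \<in> I \<Longrightarrow> cmod (a i) \<le> 1" and N: "1 \<le> N"
  shows "recip_poly N I a \<in> monic_polys_zeros_in (N + card I) (sphere 0 1)"
proof -
  let ?A = "\<Prod>i\<in>I. [:- a i, 1:]" and ?B = "\<Prod>i\<in>I. [:1, - cnj (a i):]"
  have dA: "degree ?A = card I" by (subst degree_prod_eq_sum_degree) auto
  have lA: "lead_coeff ?A = 1" by (simp add: lead_coeff_prod)
  have A0: "?A \<noteq> 0" using lA by auto
  have dM: "degree (monom 1 N * ?A) = N + card I"
    using A0 dA by (simp add: degree_mult_eq degree_monom_eq)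
  have dB: "degree ?B \<le> card I"
  proof -
    have "degree ?B \<le> sum (degree \<circ> (\<lambda>i. [:1, - cnj (a i):])) I" by (rule degree_prod_sum_le[OF I])
    also have "\<dots> \<le> (\<Sum>i\<in>I. 1)" by (intro sum_mono) auto
    finally show ?thesis by simp
  qed
  have lt: "degree ?B < degree (monom 1 N * ?A)" using dB dM N by linarith
  have deg: "degree (recip_poly N I a) = N + card I"
    unfolding recip_poly_def using degree_add_eq_left[OF lt] dM by simp
  have lead: "lead_coeff (recip_poly N I a) = 1"
    unfolding recip_poly_def using lead_coeff_add_le[OF lt] lA
    by (simp add: add.commute lead_coeff_mult lead_coeff_monom degree_monom_eq)
  have "cmod z = 1" if z0: "poly (recip_poly N I a) z = 0" for z
  proof (rule ccontr)
    assume "cmod z \<noteq> 1"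
    then consider "cmod z < 1" | "1 < cmod z" by linarith
    then show False
    proof cases
      case 1
      have "cmod (1 - cnj (a i) * z) > 0" if "i \<in> I" for i
      proof -
        have "cmod (cnj (a i) * z) \<le> 1 * cmod z" unfolding norm_mult using a[OF that] by (intro mult_right_mono) auto
        then have "cnj (a i) * z \<noteq> 1" using 1 by (metis less_le_not_le mult_1 norm_one)
        then show ?thesis by simp
      qed
      then have "0 < (\<Prod>i\<in>I. cmod (1 - cnj (a i) * z))" by (intro prod_pos) auto
      moreover have "0 < 1 - cmod z ^ N" using 1 N by (simp add: power_Suc_less_one power_less_one_iff)
      ultimately have "0 < cmod (poly (recip_poly N I a) z)"
        using recip_poly_inside[where I = I and a = a and z = z and N = N, OF a] 1 by (meson less_le_trans less_imp_le mult_pos_pos)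
      then show False using z0 by simp
    next
      case 2
      have "cmod (z - a i) > 0" if "i \<in> I" for i using a[OF that] 2 by auto
      then have "0 < (\<Prod>i\<in>I. cmod (z - a i))" by (intro prod_pos) auto
      moreover have "0 < cmod z ^ N - 1" using 2 N by (simp add: one_less_power)
      ultimately have "0 < cmod (poly (recip_poly N I a) z)"
        using recip_poly_outside[where I = I and a = a and z = z and N = N, OF a] 2 by (meson less_le_trans less_imp_le mult_pos_pos)
      then show False using z0 by simp
    qed
  qed
  then show ?thesis using deg lead by (auto simp: monic_polys_zeros_in_def)
qed

section \<open>Powers of |z| off a thin annulus around the unit circle\<close>

lemma emeasure_annulus_le:
  assumes "0 \<le> \<delta>" "\<delta> \<le> 1"
  shows "emeasure lborel {z :: complex. 1 - \<delta> < cmod z \<and> cmod z < 1 + \<delta>} \<le> ennreal (13 * \<delta>)"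
proof -
  have e: "emeasure lborel (cball (0::complex) r) = ennreal (pi * r\<^sup>2)" if "0 \<le> r" for r
    using that by (simp add: emeasure_cball unit_ball_vol_2)
  have "emeasure lborel {z :: complex. 1 - \<delta> < cmod z \<and> cmod z < 1 + \<delta>}
      \<le> emeasure lborel (cball (0::complex) (1 + \<delta>) - cball 0 (1 - \<delta>))"
    by (rule emeasure_mono) auto
  also have "\<dots> = emeasure lborel (cball (0::complex) (1 + \<delta>)) - emeasure lborel (cball (0::complex) (1 - \<delta>))"
    by (rule emeasure_Diff) (use assms e in auto)
  also have "\<dots> = ennreal (pi * (1 + \<delta>)\<^sup>2 - pi * (1 - \<delta>)\<^sup>2)"
    using assms by (simp add: e ennreal_minus)
  also have "pi * (1 + \<delta>)\<^sup>2 - pi * (1 - \<delta>)\<^sup>2 = 4 * pi * \<delta>" by (simp add: power2_eq_square algebra_simps)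
  also have "ennreal (4 * pi * \<delta>) \<le> ennreal (13 * \<delta>)"
    using assms pi_approx by (intro ennreal_leI mult_right_mono) auto
  finally show ?thesis .
qed

text \<open>The width 1 / sqrt N is negligible against 1 / ln (ln N), while N times the width still
  tends to infinity: the power is at most exp (- sqrt N).\<close>

lemma one_minus_inverse_sqrt_power:
  assumes "1 \<le> N" and u: "0 < u" and N: "ln (1 / u) \<le> sqrt (real N)"
  shows "(1 - 1 / sqrt (real N)) ^ N \<le> u"
proof -
  have s: "1 \<le> sqrt (real N)" using assms(1) by simp
  have "(1 - 1 / sqrt (real N)) ^ N \<le> exp (- (1 / sqrt (real N))) ^ N"
    using s exp_ge_add_one_self[of "- (1 / sqrt (real N))"] by (intro power_mono) auto
  also have "\<dots> = exp (- (real N / sqrt (real N)))"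
    by (simp add: exp_of_nat_mult[symmetric])
  also have "real N / sqrt (real N) = sqrt (real N)" by (rule real_div_sqrt) simp
  also have "exp (- sqrt (real N)) \<le> exp (- ln (1 / u))" using N by simp
  also have "\<dots> = u" using u by (simp add: exp_minus)
  finally show ?thesis .
qed

lemma one_plus_inverse_sqrt_power:
  assumes "1 \<le> N"
  shows "1 + sqrt (real N) \<le> (1 + 1 / sqrt (real N)) ^ N"
proof -
  have "1 + real N * (1 / sqrt (real N)) \<le> (1 + 1 / sqrt (real N)) ^ N"
    by (rule Bernoulli_inequality) (simp add: order_trans[of _ 0])
  moreover have "real N * (1 / sqrt (real N)) = sqrt (real N)" using real_div_sqrt[of "real N"] by simp
  ultimately show ?thesis by simp
qed

lemma power_one_minus_far:
  assumes N: "1 \<le> N" "ln (1 / u) \<le> sqrt (real N)" and u: "0 < u" "u < 1"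
    and z: "cmod z \<le> 1 - 1 / sqrt (real N) \<or> 1 + 1 / sqrt (real N) \<le> cmod z"
  shows "1 - u \<le> \<bar>cmod z ^ N - 1\<bar>"
  using z
proof
  assume "cmod z \<le> 1 - 1 / sqrt (real N)"
  then have "cmod z ^ N \<le> (1 - 1 / sqrt (real N)) ^ N" by (intro power_mono) auto
  then show ?thesis using one_minus_inverse_sqrt_power[OF N(1) u(1) N(2)] by simp
next
  assume "1 + 1 / sqrt (real N) \<le> cmod z"
  then have "(1 + 1 / sqrt (real N)) ^ N \<le> cmod z ^ N" by (intro power_mono) (auto simp: add_nonneg_nonneg)
  moreover have "1 \<le> sqrt (real N)" using N by simp
  ultimately show ?thesis using one_plus_inverse_sqrt_power[OF N(1)] u by linarith
qed

text \<open>The polynomial q is squared to make the loss of a factor 1 / t harmless: off the annulus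
  |q|^2 / t <= t, and this gives |q| <= t with the same t.\<close>

lemma sublevel_recip_subset:
  assumes q: "q \<in> monic_polys_zeros_in n (cball 0 1)" and t: "1 < t" and k: "3 \<le> k" and n: "1 \<le> n"
    and N: "ln (1 / (1 - 1 / t)) \<le> sqrt (real n)"
  shows "\<exists>p \<in> monic_polys_zeros_in (n * k) (sphere 0 1).
    sublevel_set p t \<subseteq> sublevel_set q t \<union> {z. 1 - 1 / sqrt (real n) < cmod z \<and> cmod z < 1 + 1 / sqrt (real n)}"
proof -
  obtain a where a: "\<And>z. poly q z = (\<Prod>i<n. (z - a i))" "\<And>i. i < n \<Longrightarrow> a i \<in> cball 0 1"
    using monic_poly_roots[OF q] by blast
  \<comment> \<open>The degree n * (k - 2) + 2 * n equals n * k, and k >= 3 gives M >= n, so that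
    the annulus may be stated with n.\<close>
  define M where "M = n * (k - 2)"
  have M: "1 \<le> M" "n \<le> M" using n k by (auto simp: M_def)
  define I where "I = {..<n} \<times> (UNIV :: bool set)"
  have I: "finite I" "card I = 2 * n" by (auto simp: I_def card_cartesian_product card_UNIV_bool)
  have aI: "cmod (a (fst i)) \<le> 1" if "i \<in> I" for i using a(2) that by (auto simp: I_def)
  have prodI: "(\<Prod>i\<in>I. f (fst i)) = (\<Prod>i<n. f i)\<^sup>2" for f :: "nat \<Rightarrow> real"
  proof -
    have "(\<Prod>i\<in>I. f (fst i)) = (\<Prod>i<n. \<Prod>b\<in>(UNIV :: bool set). f i)"
      unfolding I_def prod.cartesian_product by (simp add: case_prod_unfold)
    then show ?thesis by (simp add: card_UNIV_bool prod_power_distrib)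
  qed
  let ?p = "recip_poly M I (\<lambda>i. a (fst i))"
  have mem: "?p \<in> monic_polys_zeros_in (n * k) (sphere 0 1)"
  proof -
    have "M + card I = n * k" using k I by (simp add: M_def algebra_simps flip: distrib_left)
    then show ?thesis using recip_poly_mem[OF I(1) aI M(1)] by simp
  qed
  have ge: "(cmod (poly q z))\<^sup>2 * \<bar>cmod z ^ M - 1\<bar> \<le> cmod (poly ?p z)" for z
  proof -
    have "(cmod (poly q z))\<^sup>2 = (\<Prod>i<n. cmod (z - a i))\<^sup>2" by (simp add: a(1) prod_norm)
    also have "\<dots> = (\<Prod>i\<in>I. cmod (z - a (fst i)))" by (rule prodI[symmetric])
    finally have qz: "(cmod (poly q z))\<^sup>2 = (\<Prod>i\<in>I. cmod (z - a (fst i)))" .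
    show ?thesis
    proof (cases "cmod z \<le> 1")
      case True
      have "(\<Prod>i\<in>I. cmod (z - a (fst i))) * (1 - cmod z ^ M) \<le> (\<Prod>i\<in>I. cmod (1 - cnj (a (fst i)) * z)) * (1 - cmod z ^ M)"
        using True by (intro mult_right_mono prod_mono conjI blaschke_le aI) (auto simp: power_le_one)
      also have "\<dots> \<le> cmod (poly ?p z)" by (rule recip_poly_inside[where I = I and a = "\<lambda>i. a (fst i)" and z = z and N = M, OF aI True])
      finally show ?thesis using True by (simp add: qz power_le_one abs_of_nonpos)
    next
      case False
      then have "1 \<le> cmod z" by simp
      then show ?thesis using recip_poly_outside[where I = I and a = "\<lambda>i. a (fst i)" and z = z and N = M, OF aI] by (simp add: qz one_le_power)
    qed
  qed
  have "z \<in> sublevel_set q t" if zp: "z \<in> sublevel_set ?p t"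
    and far: "cmod z \<le> 1 - 1 / sqrt (real n) \<or> 1 + 1 / sqrt (real n) \<le> cmod z" for z
  proof -
    have sq: "0 < sqrt (real n)" "sqrt (real n) \<le> sqrt (real M)" using n M by auto
    then have inv: "1 / sqrt (real M) \<le> 1 / sqrt (real n)" by (intro divide_left_mono) auto
    have "1 - (1 - 1 / t) \<le> \<bar>cmod z ^ M - 1\<bar>"
      by (rule power_one_minus_far[OF M(1) order_trans[OF N sq(2)]]) (use inv far t in auto)
    then have "(cmod (poly q z))\<^sup>2 * (1 / t) \<le> (cmod (poly q z))\<^sup>2 * \<bar>cmod z ^ M - 1\<bar>"
      by (intro mult_left_mono) auto
    also have "\<dots> \<le> t" using ge[of z] zp by (simp add: sublevel_set_def)
    finally have "(cmod (poly q z))\<^sup>2 \<le> t\<^sup>2" using t by (simp add: field_simps power2_eq_square)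
    then have "cmod (poly q z) \<le> t" using t by (simp add: power2_le_iff_abs_le)
    then show ?thesis by (simp add: sublevel_set_def)
  qed
  then show ?thesis using mem by (intro bexI[of _ ?p]) force+
qed

text \<open>The annulus has area at most 13 / sqrt n, which by \<open>low\<close> is at most half of
  the circle value K. So K <= Q + K / 2 for the area Q of any competitor, more than enough for K / 3
  <= Q.\<close>

lemma kappa_disc_lower:
  fixes t :: real
  assumes t: "1 < t" and k: "3 \<le> k" and n: "1 \<le> n"
    and N: "ln (1 / (1 - 1 / t)) \<le> sqrt (real n)"
    and low: "ennreal (26 / sqrt (real n)) \<le> kappa (n * k) (sphere 0 1) t"
  shows "kappa (n * k) (sphere 0 1) t / 3 \<le> kappa n (cball 0 1) t"
  unfolding kappa_def[of n]
proof (rule INF_greatest)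
  fix q assume q: "q \<in> monic_polys_zeros_in n (cball 0 1)"
  let ?\<delta> = "1 / sqrt (real n)"
  let ?ann = "{z. 1 - ?\<delta> < cmod z \<and> cmod z < 1 + ?\<delta>}"
  obtain p where p: "p \<in> monic_polys_zeros_in (n * k) (sphere 0 1)" "sublevel_set p t \<subseteq> sublevel_set q t \<union> ?ann"
    using sublevel_recip_subset[OF q t k n N] by blast
  define K where "K = kappa (n * k) (sphere 0 1) t"
  define Q where "Q = emeasure lborel (sublevel_set q t)"
  have "open ?ann" by (intro open_Collect_conj open_Collect_less continuous_intros)
  then have annb: "?ann \<in> sets lborel" by simp
  have "K \<le> emeasure lborel (sublevel_set p t)" unfolding K_def kappa_def by (rule INF_lower[OF p(1)])
  also have "\<dots> \<le> emeasure lborel (sublevel_set q t \<union> ?ann)"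
    by (rule emeasure_mono[OF p(2)]) (use sublevel_set_borel annb in auto)
  also have "\<dots> \<le> Q + emeasure lborel ?ann"
    unfolding Q_def by (rule emeasure_subadditive) (use sublevel_set_borel annb in auto)
  also have "emeasure lborel ?ann \<le> ennreal (13 * ?\<delta>)"
    by (rule emeasure_annulus_le) (use n in auto)
  finally have KQ: "K \<le> Q + ennreal (13 / sqrt (real n))" by simp
  show "K / 3 \<le> Q"
  proof (cases "Q = top")
    case False
    then obtain y where y: "Q = ennreal y" "0 \<le> y" by (metis ennreal_cases)
    define e where "e = 13 / sqrt (real n)"
    have e: "0 \<le> e" by (simp add: e_def)
    have "K \<le> ennreal (y + e)" using KQ y e by (simp add: e_def ennreal_plus)
    then obtain x where x: "K = ennreal x" "0 \<le> x" by (metis ennreal_cases neq_top_trans ennreal_neq_top)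
    have "x \<le> y + e" using \<open>K \<le> ennreal (y + e)\<close> x y e by (simp del: ennreal_plus)
    moreover have "2 * e \<le> x" using low x unfolding K_def[symmetric] by (simp add: e_def)
    ultimately have "x / 3 \<le> y" using y by simp
    moreover have "ennreal x / 3 = ennreal (x / 3)" using divide_ennreal[of x 3] x by simp
    ultimately show ?thesis using x y by (simp add: ennreal_leI)
  qed simp
qed

subsection \<open>An entire function that is small off a strip\<close>

text \<open>The integrand is \<open>exp (z * t) * t powr (- t)\<close>. Rotating the path of integration from the
  positive real to the positive imaginary axis shows that the integral is small once
  \<open>Im z > \<pi> / 2\<close>, although on the real axis it grows doubly exponentially.\<close>

definition mlf :: "complex \<Rightarrow> complex \<Rightarrow> complex" where
  "mlf z t = exp (z * t - t * Ln t)"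

text \<open>Truncation at R keeps the integral proper, hence entire in z with explicit bounds. The
  price is an extra side of the rotated contour, from R to i R, on which the integrand is tiny once
  ln R >= |Re z| + 2.\<close>

definition mlint :: "real \<Rightarrow> complex \<Rightarrow> complex" where
  "mlint R z = integral {0..R} (\<lambda>t. mlf z (of_real t))"

text \<open>Provides continuity of the integrand at the vertex 0 of the contour, where the logarithm
  itself is singular.\<close>

lemma tendsto_xLnx: "((\<lambda>t::complex. t * Ln t) \<longlongrightarrow> 0) (at 0)"
proof (rule Lim_null_comparison)
  have "((\<lambda>x::real. x * (\<bar>ln x\<bar> + pi)) \<longlongrightarrow> 0) (at_right 0)" by real_asymp
  moreover have "filterlim (\<lambda>t::complex. norm t) (at_right 0) (at 0)"
    unfolding filterlim_at using tendsto_norm_zero[OF tendsto_ident_at] by (auto simp: eventually_at_filter)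
  ultimately show "((\<lambda>t::complex. norm t * (\<bar>ln (norm t)\<bar> + pi)) \<longlongrightarrow> 0) (at 0)"
    by (rule filterlim_compose)
  show "\<forall>\<^sub>F t::complex in at 0. norm (t * Ln t) \<le> norm t * (\<bar>ln (norm t)\<bar> + pi)"
  proof (rule eventually_at_topological[THEN iffD2], intro exI[of _ UNIV] conjI ballI impI)
    fix t :: complex assume "t \<noteq> 0"
    then have "norm (Ln t) \<le> \<bar>Re (Ln t)\<bar> + \<bar>Im (Ln t)\<bar>" by (intro cmod_le)
    also have "\<dots> \<le> \<bar>ln (norm t)\<bar> + pi"
      using \<open>t \<noteq> 0\<close> mpi_less_Im_Ln[of t] Im_Ln_le_pi[of t] by (simp add: Re_Ln abs_le_iff)
    finally show "norm (t * Ln t) \<le> norm t * (\<bar>ln (norm t)\<bar> + pi)"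
      by (simp add: norm_mult mult_left_mono)
  qed auto
qed

lemma continuous_mlf:
  assumes "\<And>t. t \<in> S \<Longrightarrow> 0 \<le> Re t"
  shows "continuous_on S (mlf z)"
proof -
  have "isCont (\<lambda>t. t * Ln t) t" if "0 \<le> Re t" for t
  proof (cases "t = 0")
    case True
    then show ?thesis using tendsto_xLnx by (simp add: isCont_def)
  next
    case False
    then have "t \<notin> \<real>\<^sub>\<le>\<^sub>0" using that by (auto simp: complex_nonpos_Reals_iff complex_eq_iff)
    then show ?thesis by (intro continuous_intros) auto
  qed
  then have "continuous_on S (\<lambda>t. t * Ln t)"
    using assms by (intro continuous_at_imp_continuous_on) auto
  from continuous_on_exp[OF continuous_on_diff[OF _ this], of "\<lambda>t. z * t"]
  show ?thesis unfolding mlf_def[abs_def] by (simp add: continuous_on_mult_left)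
qed

lemma norm_mlf:
  assumes "t \<noteq> 0"
  shows "norm (mlf z t) = exp (Re t * (Re z - ln (norm t)) + Im t * (Im (Ln t) - Im z))"
  using assms by (simp add: mlf_def norm_exp_eq_Re Re_Ln algebra_simps)

text \<open>Cauchy's theorem on the triangle 0, R, i R. On the slanted side |t| >= R / 2, so Re z -
  ln |t| <= -1, and arg t - Im z <= -1; since Re t + Im t = R, the integrand is at most exp (- R).
  On the imaginary axis arg t = pi / 2 < 2 <= Im z - 4, so at distance s from 0 it is at most exp
  (-4 * s), and that side contributes at most 1/4.\<close>

lemma mlint_small_upper:
  assumes R: "16 \<le> R" and x: "\<bar>Re z\<bar> + 2 \<le> ln R" and y: "6 \<le> Im z"
  shows "norm (mlint R z) \<le> 1 / 2"
proof -
  let ?R = "of_real R :: complex" and ?iR = "\<i> * of_real R :: complex"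
  have Rpos: "0 < R" using R by simp
  have hull: "0 \<le> Re t \<and> 0 \<le> Im t \<and> Re t + Im t \<le> R" if "t \<in> convex hull {0, ?R, ?iR}" for t
  proof -
    from that have "\<exists>u v w. (0 \<le> u \<and> 0 \<le> v \<and> 0 \<le> w \<and> u + v + w = 1) \<and> t = u *\<^sub>R 0 + v *\<^sub>R ?R + w *\<^sub>R ?iR"
      unfolding convex_hull_3 mem_Collect_eq by (elim exE conjE) (intro exI conjI; assumption)
    then obtain u v w where uvw: "0 \<le> u" "0 \<le> v" "0 \<le> w" "u + v + w = 1" and t: "t = u *\<^sub>R 0 + v *\<^sub>R ?R + w *\<^sub>R ?iR"
      by (elim exE conjE)
    have "Re t = v * R" "Im t = w * R" by (simp_all add: t)
    moreover have "(v + w) * R \<le> 1 * R" using uvw Rpos by (intro mult_right_mono) auto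
    ultimately show ?thesis using uvw Rpos by (simp add: algebra_simps)
  qed
  have cont: "continuous_on (convex hull {0, ?R, ?iR}) (mlf z)"
    by (rule continuous_mlf) (use hull in blast)
  have holo: "mlf z field_differentiable at t" if "t \<in> interior (convex hull {0, ?R, ?iR}) - {0}" for t
  proof -
    have "t \<in> convex hull {0, ?R, ?iR}" using that interior_subset by blast
    then have "0 \<le> Re t" "0 \<le> Im t" "t \<noteq> 0" using hull that by auto
    then have "t \<notin> \<real>\<^sub>\<le>\<^sub>0" by (auto simp: complex_nonpos_Reals_iff complex_eq_iff)
    then show ?thesis unfolding mlf_def[abs_def] field_differentiable_def
      by (intro exI) (auto intro!: derivative_eq_intros)
  qed
  have tri: "(mlf z has_contour_integral 0) (linepath 0 ?R +++ linepath ?R ?iR +++ linepath ?iR 0)"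
    by (rule Cauchy_theorem_triangle_cofinite[OF cont, of "{0}"]) (use holo in auto)
  have sub: "closed_segment u v \<subseteq> convex hull {0, ?R, ?iR}" if "u \<in> {0, ?R, ?iR}" "v \<in> {0, ?R, ?iR}" for u v
    unfolding segment_convex_hull by (rule hull_mono) (use that in auto)
  have ci: "mlf z contour_integrable_on linepath u v" if "u \<in> {0, ?R, ?iR}" "v \<in> {0, ?R, ?iR}" for u v
    by (rule contour_integrable_continuous_linepath[OF continuous_on_subset[OF cont sub[OF that]]])
  have sum0: "contour_integral (linepath 0 ?R) (mlf z) + contour_integral (linepath ?R ?iR) (mlf z)
      + contour_integral (linepath ?iR 0) (mlf z) = 0"
    using contour_integral_unique[OF tri] ci by (simp add: valid_path_join contour_integrable_joinI add.assoc)
  have c1: "contour_integral (linepath 0 ?R) (mlf z) = mlint R z"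
  proof -
    have "contour_integral (linepath 0 ?R) (mlf z) = integral {0..R} (\<lambda>t. mlf z (of_real t))"
      using contour_integral_linepath_Reals_eq[of 0 ?R "mlf z"] Rpos by simp
    then show ?thesis by (simp add: mlint_def)
  qed
  have c2: "norm (contour_integral (linepath ?R ?iR) (mlf z)) \<le> 2 * R * exp (- R)"
  proof -
    have "norm (contour_integral (linepath ?R ?iR) (mlf z)) \<le> exp (- R) * norm (?iR - ?R)"
    proof (rule contour_integral_bound_linepath[OF ci])
      fix t assume "t \<in> closed_segment ?R ?iR"
      then obtain u where u: "0 \<le> u" "u \<le> 1" "t = (1 - u) *\<^sub>R ?R + u *\<^sub>R ?iR"
        by (auto simp: in_segment)
      define a where "a = Re t"
      define b where "b = Im t"
      have ab: "0 \<le> a" "0 \<le> b" "a + b = R"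
      proof -
        have eq: "a = (1 - u) * R" "b = u * R" by (simp_all add: a_def b_def u(3))
        then show "0 \<le> a" "0 \<le> b" using u Rpos by simp_all
        show "a + b = R" unfolding eq by (simp add: algebra_simps)
      qed
      have nt: "R / 2 \<le> norm t"
        using complex_abs_le_norm[of t] ab abs_Re_le_cmod[of t] abs_Im_le_cmod[of t] by (simp add: a_def b_def)
      have t0: "t \<noteq> 0" using nt Rpos by auto
      have "ln (R / 2) \<le> ln (norm t)" using nt Rpos by (intro ln_mono) auto
      then have "ln R - ln 2 \<le> ln (norm t)" using Rpos by (simp add: ln_div)
      then have lnt: "Re z + 1 \<le> ln (norm t)" using x ln_2_less_1 by linarith
      have arg: "Im (Ln t) \<le> 2"
      proof -
        have "\<bar>Im (Ln t)\<bar> \<le> pi / 2" using ab t0 Re_Ln_pos_le[of t] by (simp add: a_def)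
        then show ?thesis using pi_less_4 by linarith
      qed
      have "a * (Re z - ln (norm t)) \<le> a * (- 1)" using ab lnt by (intro mult_left_mono) auto
      moreover have "b * (Im (Ln t) - Im z) \<le> b * (- 1)" using ab arg y by (intro mult_left_mono) auto
      ultimately have "a * (Re z - ln (norm t)) + b * (Im (Ln t) - Im z) \<le> - R" using ab by linarith
      then show "norm (mlf z t) \<le> exp (- R)" unfolding norm_mlf[OF t0] a_def b_def by simp
    qed auto
    also have "norm (?iR - ?R) \<le> 2 * R"
      using norm_triangle_ineq4[of ?iR ?R] Rpos by (simp add: norm_mult)
    then have "exp (- R) * norm (?iR - ?R) \<le> exp (- R) * (2 * R)" by (intro mult_left_mono) auto
    finally show ?thesis by (simp add: mult_ac)
  qed
  have c3: "norm (contour_integral (linepath ?iR 0) (mlf z)) \<le> 1 / 4"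
  proof -
    have "contour_integral (linepath 0 ?iR) (mlf z) = integral {0..1} (\<lambda>x. mlf z (linepath 0 ?iR x) * (?iR - 0))"
      by (rule contour_integral_integral[THEN trans]) (simp add: vector_derivative_linepath_at)
    also have "norm \<dots> \<le> integral {0..1} (\<lambda>x. R * exp (- 4 * R * x))"
    proof (rule integral_norm_bound_integral)
      have lp: "linepath 0 ?iR x = \<i> * of_real (R * x)" for x by (simp add: linepath_def scaleR_conv_of_real)
      have "continuous_on {0..1} (\<lambda>x::real. mlf z (linepath 0 ?iR x))"
        by (rule continuous_on_compose2[OF continuous_mlf[of "{t. 0 \<le> Re t}"]])
           (auto simp: lp intro!: continuous_intros)
      then show "(\<lambda>x. mlf z (linepath 0 ?iR x) * (?iR - 0)) integrable_on {0..1}"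
        by (intro integrable_continuous_real continuous_intros)
      show "(\<lambda>x. R * exp (- 4 * R * x)) integrable_on {0..1}"
        by (intro integrable_continuous_real continuous_intros)
      fix x :: real assume x: "x \<in> {0..1}"
      show "norm (mlf z (linepath 0 ?iR x) * (?iR - 0)) \<le> R * exp (- 4 * R * x)"
      proof (cases "x = 0")
        case True
        then show ?thesis using Rpos by (simp add: mlf_def norm_mult)
      next
        case False
        then have x0: "0 < R * x" using x Rpos by simp
        have "Im (Ln (\<i> * of_real r)) = pi / 2" if "0 < r" for r :: real
          unfolding mult.commute[of \<i>]
          by (subst Ln_times_simple) (use that in \<open>auto simp: Ln_of_real\<close>)
        note Ln_i = this[OF x0]
        have "norm (mlf z (linepath 0 ?iR x)) = exp ((R * x) * (pi / 2 - Im z))"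
          unfolding lp using x0 by (subst norm_mlf) (use Ln_i in auto)
        also have "\<dots> \<le> exp ((R * x) * (- 4))"
          using x0 y pi_less_4 by (intro exp_le_cancel_iff[THEN iffD2] mult_left_mono) auto
        finally show ?thesis using Rpos by (simp add: norm_mult mult_ac)
      qed
    qed
    also have "integral {0..1} (\<lambda>x. R * exp (- 4 * R * x)) = - exp (- 4 * R * 1) / 4 - - exp (- 4 * R * 0) / 4"
      by (rule integral_real_derivative) (auto intro!: derivative_eq_intros)
    also have "\<dots> \<le> 1 / 4" by simp
    finally have "norm (contour_integral (linepath 0 ?iR) (mlf z)) \<le> 1 / 4" .
    then show ?thesis
      using contour_integral_reverse_linepath[of ?iR 0 "mlf z"] continuous_on_subset[OF cont sub] by simp
  qed
  have "2 * R * exp (- R) \<le> 1 / 4"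
  proof -
    \<comment> \<open>exp R >= (1 + R / 4)^4, and R >= 16 makes three of the four factors at least
      5, which is more than 8 * R needs.\<close>
    define s where "s = 1 + R / 4"
    have s: "5 \<le> s" using R by (simp add: s_def)
    have "8 * R \<le> 5 ^ 3 * s" using R by (simp add: s_def)
    also have "\<dots> \<le> s ^ 3 * s" using s by (intro mult_right_mono power_mono) auto
    also have "\<dots> = s ^ 4" by (simp add: power4_eq_xxxx power3_eq_cube)
    also have "\<dots> \<le> exp (R / 4) ^ 4"
      unfolding s_def using R exp_ge_add_one_self[of "R / 4"] by (intro power_mono) auto
    also have "\<dots> = exp R" by (simp add: exp_of_nat_mult[symmetric])
    finally have "8 * R \<le> exp R" .
    then show ?thesis by (simp add: exp_minus field_simps)
  qed
  moreover have "mlint R z = - (contour_integral (linepath ?R ?iR) (mlf z) + contour_integral (linepath ?iR 0) (mlf z))"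
    using sum0 by (simp only: c1 add.assoc eq_neg_iff_add_eq_0)
  then have "norm (mlint R z) \<le> norm (contour_integral (linepath ?R ?iR) (mlf z))
      + norm (contour_integral (linepath ?iR 0) (mlf z))"
    by (simp only: norm_minus_cancel norm_triangle_ineq)
  ultimately have "norm (mlint R z) \<le> 1 / 4 + 1 / 4" using c2 c3 by linarith
  then show ?thesis by simp
qed


lemma mlf_of_real: "0 \<le> t \<Longrightarrow> mlf z (of_real t) = exp (z * of_real t) * of_real (exp (- (t * ln t)))"
proof -
  assume "0 \<le> t"
  then have "of_real t * Ln (of_real t) = (of_real (t * ln t) :: complex)"
    by (cases "t = 0") (auto simp: Ln_of_real)
  then show ?thesis
    by (simp only: mlf_def diff_conv_add_uminus exp_add of_real_minus[symmetric] exp_of_real)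
qed

lemma continuous_on_exp_xlnx: "continuous_on {0..R} (\<lambda>t::real. exp (- (t * ln t)))"
proof -
  have "continuous_on {0..R} (\<lambda>t. Re (mlf 0 (of_real t)))"
    by (intro continuous_on_Re continuous_on_compose2[OF continuous_mlf[of "{t. 0 \<le> Re t}"]] continuous_intros) auto
  also have "?this \<longleftrightarrow> ?thesis"
    by (intro continuous_on_cong refl) (simp add: mlf_of_real)
  finally show ?thesis .
qed

lemma mlint_altdef: "mlint R z = integral {0..R} (\<lambda>t. exp (z * of_real t) * of_real (exp (- (t * ln t))))"
  unfolding mlint_def by (intro integral_cong) (simp add: mlf_of_real)

lemma continuous_on_mlint_integrand:
  "continuous_on {0..R} (\<lambda>t. exp (z * of_real t) * complex_of_real (exp (- (t * ln t))))"
  by (intro continuous_intros continuous_on_exp_xlnx)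

lemma holomorphic_mlint: "mlint R holomorphic_on UNIV"
proof -
  have "(\<lambda>z. integral (cbox 0 R) (\<lambda>t. exp (z * of_real t) * complex_of_real (exp (- (t * ln t))))) holomorphic_on UNIV"
  proof (rule leibniz_rule_holomorphic)
    show "((\<lambda>z. exp (z * of_real t) * complex_of_real (exp (- (t * ln t)))) has_field_derivative
        of_real t * exp (z * of_real t) * complex_of_real (exp (- (t * ln t)))) (at z within UNIV)" for z t
      by (auto intro!: derivative_eq_intros)
    show "(\<lambda>t. exp (z * of_real t) * complex_of_real (exp (- (t * ln t)))) integrable_on cbox 0 R" for z
      using continuous_on_mlint_integrand[of R z] by (auto intro: integrable_continuous_real)
    have A: "continuous_on (UNIV \<times> {0..R}) (\<lambda>x :: complex \<times> real. exp (- (snd x * ln (snd x))))"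
      by (rule continuous_on_compose2[OF continuous_on_exp_xlnx[of R]]) (auto intro!: continuous_intros)
    have B: "continuous_on (UNIV \<times> {0..R})
        (\<lambda>x :: complex \<times> real. of_real (snd x) * exp (fst x * of_real (snd x)))"
      by (intro continuous_intros)
    from continuous_on_mult[OF B continuous_on_of_real[OF A]]
    show "continuous_on (UNIV \<times> cbox 0 R)
        (\<lambda>(z, t). of_real t * exp (z * of_real t) * complex_of_real (exp (- (t * ln t))))"
      by (simp add: case_prod_unfold)
  qed auto
  then show ?thesis by (simp add: mlint_altdef[abs_def])
qed

lemma mlint_cnj: "mlint R (cnj z) = cnj (mlint R z)"
  unfolding mlint_altdef integral_cnj by (simp add: exp_cnj)

lemma mlint_small:
  assumes "16 \<le> R" "\<bar>Re z\<bar> + 2 \<le> ln R" "6 \<le> \<bar>Im z\<bar>"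
  shows "norm (mlint R z) \<le> 1 / 2"
proof (cases "0 \<le> Im z")
  case True
  then show ?thesis using mlint_small_upper[of R z] assms by simp
next
  case False
  then show ?thesis using mlint_small_upper[of R "cnj z"] assms by (simp add: mlint_cnj)
qed

lemma mlint_bound:
  assumes "0 \<le> R" and x: "\<bar>Re z\<bar> \<le> X"
  shows "norm (mlint R z) \<le> R * exp (X * R + 1)"
proof -
  have "norm (mlint R z) \<le> exp (X * R + 1) * (R - 0)"
    unfolding mlint_altdef
  proof (rule integral_bound)
    fix t assume t: "t \<in> {0..R}"
    have "- (t * ln t) \<le> 1"
    proof (cases "t = 0")
      case False
      then have "t > 0" using t by simp
      then have "ln (1 / t) \<le> 1 / t - 1" by (intro ln_le_minus_one) simp
      then have "t * (- ln t) \<le> t * (1 / t - 1)" using \<open>t > 0\<close> by (intro mult_left_mono) (auto simp: ln_div)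
      then show ?thesis using \<open>t > 0\<close> by (simp add: algebra_simps)
    qed simp
    moreover have "Re z * t \<le> X * R" using x t by (intro order_trans[OF mult_right_mono mult_left_mono]) auto
    ultimately have "exp (Re z * t + - (t * ln t)) \<le> exp (X * R + 1)" by simp
    moreover have "norm (exp (z * of_real t) * complex_of_real (exp (- (t * ln t)))) = exp (Re z * t + - (t * ln t))"
      unfolding exp_add by (simp add: norm_mult)
    ultimately show "norm (exp (z * of_real t) * complex_of_real (exp (- (t * ln t)))) \<le> exp (X * R + 1)"
      by simp
  qed (use assms continuous_on_mlint_integrand in auto)
  then show ?thesis by (simp add: mult.commute)
qed

text \<open>t powr (- t) is positive, and at least 1 on [0, 1]. The value at 0 thus serves as a
  divisor for normalising without spoiling upper bounds.\<close>

lemma mlint_0: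
  assumes "1 \<le> R"
  obtains c where "mlint R 0 = of_real c" "1 \<le> c"
proof
  have i: "(\<lambda>t. exp (- (t * ln t))) integrable_on {0..R'}" for R' :: real
    by (rule integrable_continuous_real[OF continuous_on_exp_xlnx])
  show "mlint R 0 = of_real (integral {0..R} (\<lambda>t. exp (- (t * ln t))))"
    unfolding mlint_altdef using integral_linear[OF i[of R] bounded_linear_of_real[where 'a = complex]]
    by (simp add: o_def)
  have "1 = integral {0..1::real} (\<lambda>t. 1 :: real)" by simp
  also have "\<dots> \<le> integral {0..1} (\<lambda>t. exp (- (t * ln t)))"
  proof (rule integral_le)
    fix t :: real assume "t \<in> {0..1}"
    then have "t * ln t \<le> 0" by (cases "t = 0") (auto simp: mult_nonneg_nonpos)
    then show "1 \<le> exp (- (t * ln t))" by simp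
  qed (use i in auto)
  also have "\<dots> \<le> integral {0..R} (\<lambda>t. exp (- (t * ln t)))"
    by (rule integral_subset_le) (use assms i in auto)
  finally show "1 \<le> integral {0..R} (\<lambda>t. exp (- (t * ln t)))" .
qed

subsection \<open>The upper bound\<close>

text \<open>Cauchy's inequality on the circle of radius 2 bounds the k-th coefficient by E / 2^k, so
  that on the unit disc the tail is dominated by a geometric series.\<close>

lemma taylor_polynomial:
  assumes f: "f holomorphic_on UNIV" and E: "\<And>z. cmod z \<le> 2 \<Longrightarrow> cmod (f z) \<le> E" and m: "1 \<le> m"
  obtains g where "degree g \<le> m" "poly g 0 = f 0" "\<And>z. cmod z \<le> 1 \<Longrightarrow> cmod (f z - poly g z) \<le> 2 * E / 2 ^ m"
proof
  define c where "c k = (deriv ^^ k) f 0 / fact k" for k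
  define g where "g = (\<Sum>k<m. monom (c k) k)"
  have c: "cmod (c k) \<le> E / 2 ^ k" for k
  proof -
    have "cmod ((deriv ^^ k) f 0) \<le> fact k * E / 2 ^ k"
      by (rule Cauchy_inequality)
         (use f E in \<open>auto intro: holomorphic_on_subset holomorphic_on_imp_continuous_on\<close>)
    then show ?thesis by (simp add: c_def norm_divide field_simps)
  qed
  show "degree g \<le> m"
    unfolding g_def by (rule degree_sum_le) (auto intro: order_trans[OF degree_monom_le])
  have pg: "poly g z = (\<Sum>k<m. c k * z ^ k)" for z by (simp add: g_def poly_sum poly_monom)
  have "poly g 0 = (\<Sum>k<m. if k = 0 then c 0 else 0)" unfolding pg by (intro sum.cong) auto
  then show "poly g 0 = f 0" using m by (simp add: c_def)
  fix z :: complex assume z: "cmod z \<le> 1"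
  have s: "(\<lambda>k. c k * z ^ k) sums f z"
    using holomorphic_power_series[of f 0 2 z] f z holomorphic_on_subset[OF f] by (simp add: c_def)
  have "(\<lambda>k. c (k + m) * z ^ (k + m)) sums (f z - poly g z)"
    unfolding pg by (rule sums_split_initial_segment[OF s])
  moreover have "(\<lambda>k. E / 2 ^ m * (1 / 2) ^ k) sums (E / 2 ^ m * (1 / (1 - 1 / 2)))"
    by (intro sums_mult geometric_sums) simp
  moreover have "cmod (c (k + m) * z ^ (k + m)) \<le> E / 2 ^ m * (1 / 2) ^ k" for k
  proof -
    have "cmod (c (k + m)) * cmod z ^ (k + m) \<le> E / 2 ^ (k + m) * 1"
      using c z by (intro mult_mono) (auto simp: power_le_one intro: order_trans[OF norm_ge_zero c])
    then show ?thesis by (simp add: norm_mult norm_power power_add power_divide mult_ac)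
  qed
  ultimately have "cmod (f z - poly g z) \<le> E / 2 ^ m * (1 / (1 - 1 / 2))"
    by (rule norm_sums_le)
  then show "cmod (f z - poly g z) \<le> 2 * E / 2 ^ m" by (simp add: mult.commute)
qed

text \<open>All roots lie outside the closed disc, so their reciprocals lie inside; conjugated,
  these are the a i for which g becomes the second summand of a \<open>recip_poly\<close>.\<close>

lemma poly_zero_free_factorization:
  fixes g :: "complex poly"
  assumes g0: "poly g 0 = 1" and nz: "\<And>z. cmod z \<le> 1 \<Longrightarrow> poly g z \<noteq> 0"
  obtains a where "\<And>z. poly g z = (\<Prod>i<degree g. 1 - cnj (a i) * z)" "\<And>i. i < degree g \<Longrightarrow> cmod (a i) \<le> 1"
proof -
  obtain r where r: "smult (lead_coeff g) (\<Prod>i<degree g. [:- r i, 1:]) = g"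
    by (rule complex_poly_decompose')
  have eq: "poly g z = lead_coeff g * (\<Prod>i<degree g. z - r i)" for z
    by (subst r[symmetric]) (simp add: poly_prod)
  have l0: "lead_coeff g \<noteq> 0" using g0 by (metis leading_coeff_0_iff poly_0 zero_neq_one)
  have r1: "1 < cmod (r i)" if "i < degree g" for i
  proof (rule ccontr)
    assume "\<not> 1 < cmod (r i)"
    then have "poly g (r i) \<noteq> 0" by (intro nz) simp
    then show False using that by (auto simp: eq)
  qed
  show ?thesis
  proof (rule that[of "\<lambda>i. cnj (1 / r i)"])
    fix z
    have "poly g z = poly g z / poly g 0" using g0 by simp
    also have "\<dots> = (\<Prod>i<degree g. z - r i) / (\<Prod>i<degree g. 0 - r i)"
      unfolding eq using l0 by simp
    also have "\<dots> = (\<Prod>i<degree g. (z - r i) / (0 - r i))" by (simp only: prod_dividef)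
    also have "\<dots> = (\<Prod>i<degree g. 1 - cnj (cnj (1 / r i)) * z)"
    proof (intro prod.cong refl)
      fix i assume "i \<in> {..<degree g}"
      then have "r i \<noteq> 0" using r1[of i] by auto
      then show "(z - r i) / (0 - r i) = 1 - cnj (cnj (1 / r i)) * z" by (simp add: field_simps)
    qed
    finally show "poly g z = (\<Prod>i<degree g. 1 - cnj (cnj (1 / r i)) * z)" .
    show "cmod (cnj (1 / r i)) \<le> 1" if "i < degree g" for i
      using r1[OF that] by (simp add: norm_divide divide_le_eq)
  qed
qed


text \<open>g is a Taylor polynomial of exp h, where h vanishes at 0 and Re h >= ln (8 * t) on the
  part of the unit disc with |Im z| >= 12 / X. As |h| <= M on the disc of radius 2, |exp h| stays
  between exp (- M) and exp M there; a degree of order M brings the error down to half of exp (- M),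
  which keeps g free of zeros on the unit disc.\<close>

lemma small_sublevel_polynomial:
  fixes t X :: real
  defines "B \<equiv> 2 * ln (8 * t)"
  defines "M \<equiv> B * (1 + exp (X + 2) * exp (X * exp (X + 2) + 1))"
  assumes t: "1 < t" and X: "2 \<le> X"
  obtains g where "real (degree g) \<le> 4 * M + 3" "poly g 0 = 1" "\<And>z. cmod z \<le> 1 \<Longrightarrow> poly g z \<noteq> 0"
    "\<And>z. cmod z \<le> 1 \<Longrightarrow> 12 / X \<le> \<bar>Im z\<bar> \<Longrightarrow> 4 * t \<le> cmod (poly g z)"
proof -
  define R where "R = exp (X + 2)"
  have R: "16 \<le> R" "0 < R" "1 \<le> R"
  proof -
    have "(1 + 1) ^ 4 \<le> exp (1::real) ^ 4"
      using exp_ge_add_one_self[of "1::real"] by (intro power_mono) auto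
    also have "\<dots> = exp 4" by (simp add: exp_of_nat_mult[symmetric])
    also have "\<dots> \<le> R" using X by (simp add: R_def)
    finally show "16 \<le> R" "0 < R" "1 \<le> R" by simp_all
  qed
  have B: "0 < B" using t by (simp add: B_def)
  obtain c where c: "mlint R 0 = of_real c" "1 \<le> c" using mlint_0[OF R(3)] by blast
  \<comment> \<open>The scaling X / 2 takes |Im z| >= 12 / X to imaginary parts of size at least 6,
    where for |z| <= 1 the integral is at most 1/2, and real parts stay at most X for |z| <= 2.
    Dividing by c gives h 0 = 0, and c >= 1 preserves the bound 1/2.\<close>
  define h where "h z = of_real B * (1 - mlint R (z * of_real (X / 2)) / of_real c)" for z
  have Mpos: "0 \<le> M" using B by (simp add: M_def)
  have h: "h holomorphic_on UNIV"
    unfolding h_def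
    by (intro holomorphic_intros holomorphic_on_compose_gen[OF _ holomorphic_mlint, unfolded o_def]) (use c in auto)
  have hM: "cmod (h z) \<le> M" if "cmod z \<le> 2" for z
  proof -
    have "\<bar>Re (z * of_real (X / 2))\<bar> \<le> X"
      using abs_Re_le_cmod[of z] that X mult_right_mono[of "\<bar>Re z\<bar>" 2 "X / 2"] by (simp add: abs_mult)
    then have "cmod (mlint R (z * of_real (X / 2))) \<le> R * exp (X * R + 1)"
      by (intro mlint_bound) (use R in auto)
    then have "cmod (mlint R (z * of_real (X / 2)) / of_real c) \<le> R * exp (X * R + 1)"
      using c by (simp add: norm_divide divide_le_eq) (smt (verit) mult_le_cancel_left1 norm_ge_zero)
    then have "cmod (1 - mlint R (z * of_real (X / 2)) / of_real c) \<le> 1 + R * exp (X * R + 1)"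
      using norm_triangle_ineq4[of 1 "mlint R (z * of_real (X / 2)) / of_real c"] by simp
    then show ?thesis using B by (simp add: h_def M_def norm_mult R_def[symmetric] del: of_real_divide)
  qed
  have Reh: "B / 2 \<le> Re (h z)" if "cmod z \<le> 1" "12 / X \<le> \<bar>Im z\<bar>" for z
  proof -
    have "\<bar>Re (z * of_real (X / 2))\<bar> + 2 \<le> ln R"
      using abs_Re_le_cmod[of z] that X mult_right_mono[of "\<bar>Re z\<bar>" 1 "X / 2"] by (simp add: abs_mult R_def)
    moreover have "6 \<le> \<bar>Im (z * of_real (X / 2))\<bar>" using that X by (simp add: abs_mult field_simps)
    ultimately have "cmod (mlint R (z * of_real (X / 2))) \<le> 1 / 2" by (intro mlint_small R)
    then have "cmod (mlint R (z * of_real (X / 2)) / of_real c) \<le> 1 / 2"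
      using c by (simp add: norm_divide divide_le_eq)
    then have "Re (mlint R (z * of_real (X / 2)) / of_real c) \<le> 1 / 2"
      using complex_Re_le_cmod order_trans by blast
    then have "B * (1 / 2) \<le> B * Re (1 - mlint R (z * of_real (X / 2)) / of_real c)"
      using B by (intro mult_left_mono) auto
    then show ?thesis by (simp add: h_def del: of_real_divide)
  qed
  define f where "f z = exp (h z)" for z
  have f: "f holomorphic_on UNIV" unfolding f_def by (intro holomorphic_intros h)
  have f0: "f 0 = 1" using c by (simp add: f_def h_def)
  have fE: "cmod (f z) \<le> exp M" "exp (- M) \<le> cmod (f z)" if "cmod z \<le> 2" for z
    using hM[OF that] abs_Re_le_cmod[of "h z"] by (auto simp: f_def norm_exp_eq_Re)
  \<comment> \<open>With ln 2 >= 1/2, m >= 4 * M + 2 implies 2 ^ m >= 4 * exp (2 * M), which is what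
    \<open>err\<close> amounts to.\<close>
  define m where "m = nat \<lceil>4 * M + 2\<rceil>"
  have m: "4 * M + 2 \<le> real m" "real m \<le> 4 * M + 3" "1 \<le> m"
    unfolding m_def using Mpos by (auto simp: real_nat_ceiling_ge) linarith+
  obtain g where g: "degree g \<le> m" "poly g 0 = f 0" "\<And>z. cmod z \<le> 1 \<Longrightarrow> cmod (f z - poly g z) \<le> 2 * exp M / 2 ^ m"
    using taylor_polynomial[OF f fE(1) m(3)] by blast
  have err: "2 * exp M / 2 ^ m \<le> exp (- M) / 2"
  proof -
    have "4 * exp (2 * M) \<le> exp (real m * ln 2)"
    proof -
      have "4 * exp (2 * M) = exp (2 * ln 2 + 2 * M)"
        by (simp add: exp_add exp_double power2_eq_square)
      also have "\<dots> \<le> exp (real m * ln 2)"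
      proof -
        have "2 * M \<le> 4 * M * ln 2" using Mpos ln2_ge_two_thirds mult_left_mono[of "1/2" "ln 2" "4 * M"] by simp
        moreover have "(4 * M + 2) * ln 2 \<le> real m * ln 2" using m(1) by (intro mult_right_mono) auto
        ultimately have "2 * ln 2 + 2 * M \<le> real m * ln 2" by (simp add: algebra_simps)
        then show ?thesis by simp
      qed
      finally show ?thesis .
    qed
    also have "exp (real m * ln 2) = 2 ^ m" by (simp add: exp_of_nat_mult)
    finally have "4 * exp (2 * M) \<le> 2 ^ m" .
    moreover have "exp (2 * M) = exp M * exp M" by (simp add: exp_add[symmetric])
    ultimately show ?thesis by (simp add: exp_minus field_simps)
  qed
  show ?thesis
  proof (rule that)
    show "real (degree g) \<le> 4 * M + 3" using g(1) m(2) by linarith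
    show "poly g 0 = 1" using g(2) f0 by simp
    show "poly g z \<noteq> 0" if z: "cmod z \<le> 1" for z
    proof
      assume "poly g z = 0"
      then have "cmod (f z) \<le> exp (- M) / 2" using g(3)[OF z] err by simp
      moreover have "exp (- M) \<le> cmod (f z)" using fE(2)[of z] z by simp
      moreover have "0 < exp (- M)" by simp
      ultimately show False by linarith
    qed
    show "4 * t \<le> cmod (poly g z)" if z: "cmod z \<le> 1" "12 / X \<le> \<bar>Im z\<bar>" for z
    proof -
      have "exp (B / 2) \<le> cmod (f z)" using Reh[OF z] by (simp add: f_def norm_exp_eq_Re)
      moreover have "exp (B / 2) = 8 * t" using t by (simp add: B_def)
      moreover have "exp (- M) \<le> 1" using Mpos by simp
      moreover have "cmod (f z) - cmod (f z - poly g z) \<le> cmod (poly g z)"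
        using norm_triangle_ineq2[of "f z" "f z - poly g z"] by simp
      ultimately show ?thesis using g(3)[OF z(1)] err t by linarith
    qed
  qed
qed

text \<open>Inside the circle the summand g dominates, |g| >= 4 * t off the strip, and half of that
  still exceeds t. Outside, |z| <= 2 since otherwise |z| ^ N is too large, and reflection in the
  circle transfers the lower bound for g; it divides the imaginary part by |z|^2 <= 4, hence a strip
  four times as wide.\<close>

lemma recip_sublevel_strip:
  fixes g :: "complex poly"
  assumes t: "1 < t" and g0: "poly g 0 = 1" and nz: "\<And>z. cmod z \<le> 1 \<Longrightarrow> poly g z \<noteq> 0"
    and big: "\<And>z. cmod z \<le> 1 \<Longrightarrow> s \<le> \<bar>Im z\<bar> \<Longrightarrow> 4 * t \<le> cmod (poly g z)"
    and s: "0 \<le> s" and N: "1 \<le> N" "ln 2 \<le> sqrt (real N)" "t + 1 < 2 ^ N"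
  shows "\<exists>p \<in> monic_polys_zeros_in (N + degree g) (sphere 0 1). sublevel_set p t \<subseteq>
    {z. 1 - 1 / sqrt (real N) < cmod z \<and> cmod z < 1 + 1 / sqrt (real N)} \<union> cbox (Complex (-2) (- 4 * s)) (Complex 2 (4 * s))"
proof -
  obtain a where a: "\<And>z. poly g z = (\<Prod>i<degree g. 1 - cnj (a i) * z)" "\<And>i. i < degree g \<Longrightarrow> cmod (a i) \<le> 1"
    using poly_zero_free_factorization[OF g0 nz] by metis
  define I where "I = {..<degree g}"
  let ?p = "recip_poly N I a"
  have aI: "cmod (a i) \<le> 1" if "i \<in> I" for i using a(2) that by (simp add: I_def)
  have mem: "?p \<in> monic_polys_zeros_in (N + degree g) (sphere 0 1)"
    using recip_poly_mem[of I a N] aI N(1) by (simp add: I_def)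
  have "z \<in> cbox (Complex (-2) (- 4 * s)) (Complex 2 (4 * s))"
    if zp: "cmod (poly ?p z) \<le> t" and far: "cmod z \<le> 1 - 1 / sqrt (real N) \<or> 1 + 1 / sqrt (real N) \<le> cmod z" for z
  proof -
    have half: "1 / 2 \<le> \<bar>cmod z ^ N - 1\<bar>"
      using power_one_minus_far[OF N(1), of "1/2" z] N(2) far by simp
    have main: "cmod z \<le> 2 \<and> \<bar>Im z\<bar> \<le> 4 * s"
    proof (cases "cmod z \<le> 1")
      case True
      have "\<bar>Im z\<bar> < s"
      proof (rule ccontr)
        assume "\<not> \<bar>Im z\<bar> < s"
        then have "4 * t \<le> (\<Prod>i\<in>I. cmod (1 - cnj (a i) * z))"
          using big[OF True] by (simp add: a(1) I_def prod_norm)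
        moreover have "1 / 2 \<le> 1 - cmod z ^ N" using half True by (simp add: power_le_one abs_of_nonpos)
        ultimately have "4 * t * (1 / 2) \<le> (\<Prod>i\<in>I. cmod (1 - cnj (a i) * z)) * (1 - cmod z ^ N)"
          using t by (intro mult_mono) (auto intro: prod_nonneg)
        also have "\<dots> \<le> t" using recip_poly_inside[where I = I and a = a and z = z and N = N, OF aI True] zp by linarith
        finally show False using t by simp
      qed
      then show ?thesis using True s by simp
    next
      case False
      then have z1: "1 < cmod z" by simp
      then have z0: "z \<noteq> 0" by auto
      have out: "(\<Prod>i\<in>I. cmod (z - a i)) * (cmod z ^ N - 1) \<le> t"
        using recip_poly_outside[where I = I and a = a and z = z and N = N, OF aI less_imp_le[OF z1]] zp by linarith
      have zN: "1 \<le> cmod z ^ N" using z1 by (simp add: one_le_power)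
      have two: "cmod z \<le> 2"
      proof (rule ccontr)
        assume "\<not> cmod z \<le> 2"
        then have z2: "2 < cmod z" by simp
        have "1 \<le> (\<Prod>i\<in>I. cmod (z - a i))"
        proof (rule prod_ge_1)
          fix i assume "i \<in> I"
          then show "1 \<le> cmod (z - a i)" using aI[of i] z2 norm_triangle_ineq2[of z "a i"] by linarith
        qed
        then have "1 * (cmod z ^ N - 1) \<le> t" using out zN by (intro order_trans[OF mult_right_mono out]) auto
        then have "cmod z ^ N \<le> t + 1" by simp
        moreover have "2 ^ N \<le> cmod z ^ N" using z2 by (intro power_mono) auto
        ultimately show False using N(3) by (meson less_le_trans order_trans less_irrefl)
      qed
      have "\<bar>Im z\<bar> < 4 * s"
      proof (rule ccontr)
        assume ns: "\<not> \<bar>Im z\<bar> < 4 * s"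
        \<comment> \<open>At the reflected point the factors of g have modulus |z - a i| / |z|, so
          |g| at w is a lower bound for the dominant product at z.\<close>
        define w where "w = 1 / cnj z"
        have w1: "cmod w \<le> 1" using z1 by (simp add: w_def norm_divide divide_le_eq)
        have "Im w = Im z / (cmod z)\<^sup>2"
          by (simp add: w_def Im_divide cmod_power2)
        moreover have "s \<le> \<bar>Im z\<bar> / (cmod z)\<^sup>2"
        proof -
          have "(cmod z)\<^sup>2 \<le> 2\<^sup>2" using two by (intro power_mono) auto
          then have "s * (cmod z)\<^sup>2 \<le> s * 4" using s by (intro mult_left_mono) auto
          also have "\<dots> \<le> \<bar>Im z\<bar>" using ns by simp
          finally show ?thesis using z0 by (simp add: field_simps)
        qed
        ultimately have "s \<le> \<bar>Im w\<bar>" by simp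
        then have "4 * t \<le> cmod (poly g w)" using big[OF w1] by simp
        also have "\<dots> = (\<Prod>i\<in>I. cmod (1 - cnj (a i) * w))" by (simp add: a(1) I_def prod_norm)
        also have "\<dots> \<le> (\<Prod>i\<in>I. cmod (z - a i))"
        proof (intro prod_mono conjI)
          fix i assume "i \<in> I"
          have "1 - cnj (a i) * w = cnj (z - a i) / cnj z" using z0 by (simp add: w_def field_simps)
          then have "cmod (1 - cnj (a i) * w) = cmod (z - a i) / cmod z" by (simp add: norm_divide flip: complex_cnj_diff)
          also have "\<dots> \<le> cmod (z - a i)" using z1 by (simp add: divide_le_eq mult_le_cancel_left1)
          finally show "cmod (1 - cnj (a i) * w) \<le> cmod (z - a i)" .
        qed auto
        finally have "4 * t \<le> (\<Prod>i\<in>I. cmod (z - a i))" .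
        moreover have "1 / 2 \<le> cmod z ^ N - 1" using half zN by simp
        ultimately have "4 * t * (1 / 2) \<le> (\<Prod>i\<in>I. cmod (z - a i)) * (cmod z ^ N - 1)"
          using t by (intro mult_mono) (auto intro: prod_nonneg)
        then show False using out t by simp
      qed
      then show ?thesis using two by simp
    qed
    then show ?thesis using abs_Re_le_cmod[of z] by (auto simp: in_cbox_complex_iff)
  qed
  then show ?thesis using mem unfolding sublevel_set_def by (intro bexI[of _ ?p]) force+
qed

lemma kappa_sphere_upper:
  fixes t :: real
  assumes t: "1 < t"
  shows "\<forall>\<^sub>F n in sequentially. kappa n (sphere 0 1) t \<le> ennreal (10000 / ln (ln (real n)))"
proof -
  define B where "B = 2 * ln (8 * t)"
  have B: "0 < B" using t by (simp add: B_def)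
  define M where "M X = B * (1 + exp (X + 2) * exp (X * exp (X + 2) + 1))" for X
  have e1: "\<forall>\<^sub>F n :: nat in sequentially. 2 \<le> ln (ln (real n)) / 4" by real_asymp
  have e2: "\<forall>\<^sub>F n :: nat in sequentially. 4 * M (ln (ln (real n)) / 4) + 3 \<le> real n / 2"
    unfolding M_def using B by real_asymp
  have e3: "\<forall>\<^sub>F n :: nat in sequentially. t + 1 < 2 powr (real n / 2)" by real_asymp
  have e4: "\<forall>\<^sub>F n :: nat in sequentially. 26 / sqrt (real n) \<le> 1 / ln (ln (real n))" by real_asymp
  have e5: "\<forall>\<^sub>F n :: nat in sequentially. 8 \<le> n" by (rule eventually_ge_at_top)
  show ?thesis
    using e1 e2 e3 e4 e5
  proof eventually_elim
    case (elim n)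
    define l where "l = ln (ln (real n))"
    \<comment> \<open>The degree bound is roughly exp (X * exp (X + 2)), and for X = l / 4 the
      factor exp X is only the fourth root of ln n; so the degree is eventually below n / 2.\<close>
    define X where "X = l / 4"
    have X: "2 \<le> X" "0 < l" using elim(1) by (auto simp: X_def l_def)
    obtain g where g: "real (degree g) \<le> 4 * M X + 3" "poly g 0 = 1" "\<And>z. cmod z \<le> 1 \<Longrightarrow> poly g z \<noteq> 0"
      "\<And>z. cmod z \<le> 1 \<Longrightarrow> 12 / X \<le> \<bar>Im z\<bar> \<Longrightarrow> 4 * t \<le> cmod (poly g z)"
      using small_sublevel_polynomial[OF t X(1)] unfolding M_def B_def by blast
    have dn: "real (degree g) \<le> real n / 2" using g(1) elim(2) by (simp add: X_def l_def)
    \<comment> \<open>At least half of the degree is left for the power of z, so that the annulus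
      has area O(1 / sqrt n).\<close>
    define N where "N = n - degree g"
    have N: "N + degree g = n" "real n / 2 \<le> real N" "1 \<le> N" "4 \<le> N"
      using dn elim(5) by (auto simp: N_def of_nat_diff)
    have sN: "sqrt (real n) / 2 \<le> sqrt (real N)" "2 \<le> sqrt (real N)"
    proof -
      have "sqrt (real n / 4) \<le> sqrt (real N)" using N by (intro real_sqrt_le_mono) simp
      then show "sqrt (real n) / 2 \<le> sqrt (real N)" by (simp add: real_sqrt_divide)
      have "sqrt 4 \<le> sqrt (real N)" using N(4) by (intro real_sqrt_le_mono) simp
      then show "2 \<le> sqrt (real N)" by simp
    qed
    have tN: "t + 1 < 2 ^ N"
    proof -
      have "2 powr (real n / 2) \<le> 2 powr (real N)" using N(2) by simp
      then show ?thesis using elim(3) by (simp add: powr_realpow)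
    qed
    let ?ann = "{z. 1 - 1 / sqrt (real N) < cmod z \<and> cmod z < 1 + 1 / sqrt (real N)}"
    let ?box = "cbox (Complex (-2) (- 4 * (12 / X))) (Complex 2 (4 * (12 / X)))"
    have "ln (2::real) \<le> sqrt (real N)" using sN(2) ln_2_less_1 by linarith
    then obtain p where p: "p \<in> monic_polys_zeros_in n (sphere 0 1)" "sublevel_set p t \<subseteq> ?ann \<union> ?box"
      using recip_sublevel_strip[OF t g(2-4) _ N(3) _ tN] X unfolding N(1) by force
    have "open ?ann" by (intro open_Collect_conj open_Collect_less continuous_intros)
    then have annb: "?ann \<in> sets lborel" by simp
    have "kappa n (sphere 0 1) t \<le> emeasure lborel (sublevel_set p t)"
      unfolding kappa_def by (rule INF_lower[OF p(1)])
    also have "\<dots> \<le> emeasure lborel (?ann \<union> ?box)"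
      by (rule emeasure_mono[OF p(2)]) (use annb in auto)
    also have "\<dots> \<le> emeasure lborel ?ann + emeasure lborel ?box"
      by (rule emeasure_subadditive) (use annb in auto)
    also have "\<dots> \<le> ennreal (13 * (1 / sqrt (real N))) + ennreal (4 * (96 / X))"
    proof (rule add_mono)
      show "emeasure lborel ?ann \<le> ennreal (13 * (1 / sqrt (real N)))"
        by (rule emeasure_annulus_le) (use sN(2) in \<open>simp_all add: divide_le_eq\<close>)
      have "emeasure lborel ?box = ennreal (4 * (96 / X))"
        using X by (subst emeasure_lborel_cbox) (auto simp: Basis_complex_def)
      then show "emeasure lborel ?box \<le> ennreal (4 * (96 / X))" by simp
    qed
    also have "\<dots> = ennreal (13 * (1 / sqrt (real N)) + 4 * (96 / X))"
      using X by (intro ennreal_plus[symmetric]) auto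
    also have "\<dots> \<le> ennreal (10000 / l)"
    proof (rule ennreal_leI)
      have "13 * (1 / sqrt (real N)) \<le> 13 * (1 / (sqrt (real n) / 2))"
      proof -
        have "0 < sqrt (real n) / 2" "0 < sqrt (real N)" using elim(5) N(3) by auto
        then show ?thesis using sN(1) by (intro mult_left_mono divide_left_mono mult_pos_pos) auto
      qed
      also have "\<dots> = 26 / sqrt (real n)" by simp
      also have "\<dots> \<le> 1 / l" using elim(4) by (simp add: l_def)
      finally have "13 * (1 / sqrt (real N)) \<le> 1 / l" .
      moreover have "4 * (96 / X) = 1536 / l" using X by (simp add: X_def)
      moreover have "1 / l + 1536 / l \<le> 10000 / l" using X by (simp add: add_divide_distrib[symmetric] divide_right_mono)
      ultimately show "13 * (1 / sqrt (real N)) + 4 * (96 / X) \<le> 10000 / l" by linarith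
    qed
    finally show ?case by (simp add: l_def)
  qed
qed

section \<open>The chain of inequalities between circle and disc\<close>

theorem theorem2:
  fixes t :: real
  assumes "t > 1"
  shows "\<exists>c C :: real. 0 < c \<and> c < C \<and>
    (\<forall>\<^sub>F n :: nat in sequentially.
       ennreal (c / ln (ln (real n)))
         \<le> kappa (n * nat \<lfloor>(ln (ln (real n))) ^ 4\<rfloor>) (sphere 0 1) t / 3 \<and>
       kappa (n * nat \<lfloor>(ln (ln (real n))) ^ 4\<rfloor>) (sphere 0 1) t / 3
         \<le> kappa n (cball 0 1) t \<and>
       kappa n (cball 0 1) t \<le> kappa n (sphere 0 1) t \<and>
       kappa n (sphere 0 1) t \<le> ennreal (C / ln (ln (real n))))"
proof -
  obtain c where c: "0 < c" "\<forall>\<^sub>F n in sequentially. ennreal (c / ln (ln (real n))) \<le> kappa n (sphere 0 1) t"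
    using kappa_sphere_lower[OF assms] by blast
  define k where "k n = nat \<lfloor>(ln (ln (real n))) ^ 4\<rfloor>" for n :: nat
  have kub: "real (k n) \<le> (ln (ln (real n))) ^ 4" for n
    unfolding k_def by (simp add: of_nat_floor)
  have f1: "\<forall>\<^sub>F n :: nat in sequentially. 3 \<le> (ln (ln (real n))) ^ 4" by real_asymp
  then have f2: "\<forall>\<^sub>F n :: nat in sequentially. 3 \<le> k n"
    by eventually_elim (simp add: k_def le_nat_iff le_floor_iff)
  have f3: "\<forall>\<^sub>F n :: nat in sequentially. (ln (ln (real n))) ^ 4 \<le> real n" by real_asymp
  have f4: "\<forall>\<^sub>F n :: nat in sequentially. ln 2 \<le> ln (ln (real n)) \<and> exp 1 \<le> real n"
    by (intro eventually_conj) real_asymp+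
  have f5: "\<forall>\<^sub>F n :: nat in sequentially. ln (1 / (1 - 1 / t)) \<le> sqrt (real n)" by real_asymp
  have f6: "\<forall>\<^sub>F n :: nat in sequentially. 26 / sqrt (real n) \<le> c / (2 * ln (ln (real n)))" using c(1) by real_asymp
  obtain n0 where n0: "\<And>n. n0 \<le> n \<Longrightarrow> ennreal (c / ln (ln (real n))) \<le> kappa n (sphere 0 1) t"
    using c(2) unfolding eventually_sequentially by blast
  have f7: "\<forall>\<^sub>F n :: nat in sequentially. max 1 n0 \<le> n" by (rule eventually_ge_at_top)
  \<comment> \<open>In c / 6 a factor 2 comes from ln (ln (n * k n)) <= 2 * ln (ln n) and a factor 3
    from the division by 3; the minimum with 1 keeps the lower constant below the upper one.\<close>
  define c' where "c' = min (c / 6) 1"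
  have c': "0 < c'" "c' < 10000" "c' \<le> c / 6" using c by (auto simp: c'_def)
  have "\<forall>\<^sub>F n in sequentially. ennreal (c' / ln (ln (real n))) \<le> kappa (n * k n) (sphere 0 1) t / 3 \<and>
      kappa (n * k n) (sphere 0 1) t / 3 \<le> kappa n (cball 0 1) t \<and>
      kappa n (cball 0 1) t \<le> kappa n (sphere 0 1) t \<and>
      kappa n (sphere 0 1) t \<le> ennreal (10000 / ln (ln (real n)))"
    using f2 f3 f4 f5 f6 f7 kappa_sphere_upper[OF assms]
  proof eventually_elim
    case (elim n)
    define l where "l = ln (ln (real n))"
    have l: "ln 2 \<le> l" "0 < l" using elim(3) less_le_trans[of 0 "ln 2 :: real" l] by (auto simp: l_def)
    have n: "1 \<le> n" "n0 \<le> n" "n \<le> n * k n" using elim by auto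
    have ln1: "1 \<le> ln (real n)"
      using elim(3) n by (subst ln_ge_iff) auto
    have ll: "ln (ln (real (n * k n))) \<le> 2 * l" "0 < ln (ln (real (n * k n)))"
    proof -
      have "ln (real n) \<le> ln (real (n * k n))" using n by (intro ln_mono) auto
      then have "l \<le> ln (ln (real (n * k n)))" unfolding l_def by (rule ln_mono[rotated 2]) (use ln1 in linarith)+
      then show "0 < ln (ln (real (n * k n)))" using l by linarith
      \<comment> \<open>As k n <= n, the degree n * k n is at most n^2, which adds only ln 2 to the
        iterated logarithm.\<close>
      have "real (k n) \<le> real n" using kub[of n] elim(2) by linarith
      then have "real (n * k n) \<le> real n * real n" by (simp add: mult_left_mono)
      then have "ln (real (n * k n)) \<le> ln (real n * real n)" using n elim(1) by (intro ln_mono) auto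
      also have "\<dots> = 2 * ln (real n)" using n by (subst ln_mult) auto
      finally have "ln (ln (real (n * k n))) \<le> ln (2 * ln (real n))"
        by (rule ln_mono[rotated 2]) (use ln1 \<open>ln (real n) \<le> ln (real (n * k n))\<close> in linarith)+
      also have "\<dots> = ln 2 + l" using ln1 unfolding l_def by (subst ln_mult) auto
      finally show "ln (ln (real (n * k n))) \<le> 2 * l" using l by simp
    qed
    have "ennreal (c / (2 * l)) \<le> ennreal (c / ln (ln (real (n * k n))))"
      using ll l c(1) by (intro ennreal_leI divide_left_mono) auto
    also have "\<dots> \<le> kappa (n * k n) (sphere 0 1) t" by (rule n0) (use n in linarith)
    finally have low: "ennreal (c / (2 * l)) \<le> kappa (n * k n) (sphere 0 1) t" .
    have 1: "ennreal (c' / l) \<le> kappa (n * k n) (sphere 0 1) t / 3"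
    proof -
      have "c' / l \<le> c / (2 * l) / 3"
        using divide_right_mono[OF c'(3), of l] l by simp
      then have "ennreal (c' / l) \<le> ennreal (c / (2 * l) / 3)" by (rule ennreal_leI)
      also have "\<dots> = ennreal (c / (2 * l)) / 3"
        using divide_ennreal[of "c / (2 * l)" 3] c(1) l by simp
      also have "\<dots> \<le> kappa (n * k n) (sphere 0 1) t / 3" using low by (rule divide_right_mono_ennreal)
      finally show ?thesis .
    qed
    have "ennreal (26 / sqrt (real n)) \<le> ennreal (c / (2 * l))" using elim(5) by (intro ennreal_leI) (simp add: l_def)
    then have 2: "kappa (n * k n) (sphere 0 1) t / 3 \<le> kappa n (cball 0 1) t"
      by (intro kappa_disc_lower assms elim n order_trans[OF _ low])
    have 3: "kappa n (cball 0 1) t \<le> kappa n (sphere 0 1) t"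
      unfolding kappa_def
      by (rule INF_superset_mono) (auto simp: monic_polys_zeros_in_def)
    show ?case using 1 2 3 elim(7) by (simp add: l_def)
  qed
  then show ?thesis unfolding k_def using c' by blast
qed

end
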